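(* Let $0\le \delta<\infty$, let $k\ge 1$ be an integer and let $1\le p<\infty$. If $\Omega\subset\mathbb{R}^n$ is a bounded $\delta$-Gromov hyperbolic domain with $C^0$-boundary, then $C^{\infty}(\mathbb{R}^n)\cap W^{k,\infty}(\Omega)$ is dense in $L^{k,p}(\Omega)$ (with respect to the homogeneous Sobolev seminorm).
   Context: A domain is a nonempty connected open set. For a domain $\Omega\subset\mathbb{R}^n$, $k\in\mathbb{N}$ and $p\in[1,\infty]$, the homogeneous Sobolev space is $L^{k,p}(\Omega)=\{u\in L^1_{loc}(\Omega): D^{\alpha}u\in L^p(\Omega)\text{ for all multi-indices } |\alpha|=k\}$ (distributional derivatives), equipped with the seminorm $\sum_{|\alpha|=k}\|D^{\alpha}u\|_{L^p(\Omega)}$. The space $W^{k,p}(\Omega)=\{u\in L^1_{loc}(\Omega): D^{\alpha}u\in L^p(\Omega)\text{ for all } |\alpha|\le k\}$ is equipped with the norm $\sum_{|\alpha|\le k}\|D^{\alpha}u\|_{L^p(\Omega)}$. The class $C^{\infty}(\mathbb{R}^n)\cap W^{k,\infty}(\Omega)$ consists of (restrictions to $\Omega$ of) functions in $C^\infty(\mathbb{R}^n)$ whose restriction to $\Omega$ belongs to $W^{k,\infty}(\Omega)$. For a domain $\Omega\subsetneq\mathbb{R}^n$ write $d_{\Omega}(z)=\mathrm{dist}(z,\partial\Omega)$. The quasihyperbolic distance is $k_{\Omega}(x,y)=\inf_{\gamma}\int_{\gamma}\frac{|dz|}{d_{\Omega}(z)}$, the infimum being over rectifiable curves $\gamma\subset\Omega$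 joining $x$ and $y$. A quasihyperbolic geodesic joining $x$ and $y$ is a curve attaining this infimum (such curves always exist). The domain $\Omega\subsetneq\mathbb{R}^n$ is $\delta$-Gromov hyperbolic if for any three points $x,y,z\in\Omega$, any quasihyperbolic geodesics $\Gamma_{xy},\Gamma_{yz},\Gamma_{zx}$ joining them pairwise, and any $w$ lying on one of these three geodesics, the ball $\{u\in\Omega: k_{\Omega}(u,w)\le\delta\}$ intersects the union of the other two geodesics. The domain $\Omega$ has $C^0$-boundary if for every $x\in\partial\Omega$ there is a neighbourhood $U_x\subset\mathbb{R}^n$ of $x$ such that, in suitable coordinates $(y_1,\dots,y_n)$, $U_x\cap\Omega$ has the representation $y_n<f(y_1,\dots,y_{n-1})$ with a continuous function $f$, i.e. $U_x\cap\Omega=\{y\in U_x: y_n<f(y_1,\dots,y_{n-1})\}$. *)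

theory Defs
  imports "HOL-Analysis.Analysis"
begin

definition is_domain :: "'a::topological_space set \<Rightarrow> bool" where
  "is_domain \<Omega> \<longleftrightarrow> \<Omega> \<noteq> {} \<and> open \<Omega> \<and> connected \<Omega>"

definition partial_deriv :: "'n::finite \<Rightarrow> (real^'n \<Rightarrow> real) \<Rightarrow> real^'n \<Rightarrow> real" where
  "partial_deriv i f x = deriv (\<lambda>t. f (x + t *\<^sub>R axis i 1)) 0"

primrec Ck :: "nat \<Rightarrow> (real^'n::finite \<Rightarrow> real) \<Rightarrow> bool" where
  "Ck 0 f \<longleftrightarrow> continuous_on UNIV f"
| "Ck (Suc m) f \<longleftrightarrow> f differentiable_on UNIV \<and> (\<forall>i. Ck m (partial_deriv i f))"

definition smooth :: "(real^'n::finite \<Rightarrow> real) \<Rightarrow> bool" where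
  "smooth f \<longleftrightarrow> (\<forall>m. Ck m f)"

text \<open>A multi-index is a function \<open>\<alpha> :: 'n \<Rightarrow> nat\<close>. The index type carries no order, so the
  order in which the partial derivatives are taken is fixed by an arbitrary enumeration of it.
  The derivative \<open>D\<^sup>\<alpha>\<close> is only ever applied to smooth functions, where that choice is
  immaterial.\<close>

definition mi_order :: "('n::finite \<Rightarrow> nat) \<Rightarrow> nat" where
  "mi_order \<alpha> = (\<Sum>i\<in>UNIV. \<alpha> i)"

definition index_enum :: "'n::finite list" where
  "index_enum = (SOME is. distinct is \<and> set is = UNIV)"

definition mi_deriv :: "('n::finite \<Rightarrow> nat) \<Rightarrow> (real^'n \<Rightarrow> real) \<Rightarrow> real^'n \<Rightarrow> real" where
  "mi_deriv \<alpha> f = foldr (\<lambda>i g. (partial_deriv i ^^ \<alpha> i) g) index_enum f"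

definition test_function :: "(real^'n::finite) set \<Rightarrow> (real^'n \<Rightarrow> real) \<Rightarrow> bool" where
  "test_function \<Omega> \<phi> \<longleftrightarrow>
     smooth \<phi> \<and> (\<exists>K. compact K \<and> K \<subseteq> \<Omega> \<and> (\<forall>x. x \<notin> K \<longrightarrow> \<phi> x = 0))"

text \<open>A function on \<open>\<Omega>\<close> is represented by a total function; all notions below depend only on
  its values on \<open>\<Omega>\<close>, up to null sets.\<close>

definition L1_loc :: "(real^'n::finite) set \<Rightarrow> (real^'n \<Rightarrow> real) set" where
  "L1_loc \<Omega> = {u. \<forall>K. compact K \<and> K \<subseteq> \<Omega> \<longrightarrow> integrable (lebesgue_on K) u}"

definition Lp :: "ennreal \<Rightarrow> (real^'n::finite) set \<Rightarrow> (real^'n \<Rightarrow> real) set" where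
  "Lp p \<Omega> = {v. v \<in> borel_measurable (lebesgue_on \<Omega>) \<and>
     (if p = \<infinity> then \<exists>C. AE x in lebesgue_on \<Omega>. \<bar>v x\<bar> \<le> C
      else integrable (lebesgue_on \<Omega>) (\<lambda>x. \<bar>v x\<bar> powr enn2real p))}"

definition Lp_norm :: "ennreal \<Rightarrow> (real^'n::finite) set \<Rightarrow> (real^'n \<Rightarrow> real) \<Rightarrow> real" where
  "Lp_norm p \<Omega> v =
     (if p = \<infinity> then Inf {C. 0 \<le> C \<and> (AE x in lebesgue_on \<Omega>. \<bar>v x\<bar> \<le> C)}
      else (LINT x|lebesgue_on \<Omega>. \<bar>v x\<bar> powr enn2real p) powr (1 / enn2real p))"

definition is_weak_deriv ::
  "(real^'n::finite) set \<Rightarrow> ('n \<Rightarrow> nat) \<Rightarrow> (real^'n \<Rightarrow> real) \<Rightarrow> (real^'n \<Rightarrow> real) \<Rightarrow> bool" where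
  "is_weak_deriv \<Omega> \<alpha> u v \<longleftrightarrow> u \<in> L1_loc \<Omega> \<and> v \<in> L1_loc \<Omega> \<and>
     (\<forall>\<phi>. test_function \<Omega> \<phi> \<longrightarrow>
        (LINT x|lebesgue_on \<Omega>. u x * mi_deriv \<alpha> \<phi> x)
          = (- 1) ^ mi_order \<alpha> * (LINT x|lebesgue_on \<Omega>. v x * \<phi> x))"

text \<open>The weak derivative is unique up to null sets.\<close>

definition weak_deriv ::
  "(real^'n::finite) set \<Rightarrow> ('n \<Rightarrow> nat) \<Rightarrow> (real^'n \<Rightarrow> real) \<Rightarrow> real^'n \<Rightarrow> real" where
  "weak_deriv \<Omega> \<alpha> u = (SOME v. is_weak_deriv \<Omega> \<alpha> u v)"

definition sobolev_L :: "nat \<Rightarrow> ennreal \<Rightarrow> (real^'n::finite) set \<Rightarrow> (real^'n \<Rightarrow> real) set" where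
  "sobolev_L k p \<Omega> = {u \<in> L1_loc \<Omega>. \<forall>\<alpha>. mi_order \<alpha> = k \<longrightarrow> (\<exists>v \<in> Lp p \<Omega>. is_weak_deriv \<Omega> \<alpha> u v)}"

definition sobolev_L_seminorm ::
  "nat \<Rightarrow> ennreal \<Rightarrow> (real^'n::finite) set \<Rightarrow> (real^'n \<Rightarrow> real) \<Rightarrow> real" where
  "sobolev_L_seminorm k p \<Omega> u = (\<Sum>\<alpha> | mi_order \<alpha> = k. Lp_norm p \<Omega> (weak_deriv \<Omega> \<alpha> u))"

definition sobolev_W :: "nat \<Rightarrow> ennreal \<Rightarrow> (real^'n::finite) set \<Rightarrow> (real^'n \<Rightarrow> real) set" where
  "sobolev_W k p \<Omega> = {u \<in> L1_loc \<Omega>. \<forall>\<alpha>. mi_order \<alpha> \<le> k \<longrightarrow> (\<exists>v \<in> Lp p \<Omega>. is_weak_deriv \<Omega> \<alpha> u v)}"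

definition dense_wrt_seminorm ::
  "(('a \<Rightarrow> real) \<Rightarrow> real) \<Rightarrow> ('a \<Rightarrow> real) set \<Rightarrow> ('a \<Rightarrow> real) set \<Rightarrow> bool" where
  "dense_wrt_seminorm N A X \<longleftrightarrow>
     A \<subseteq> X \<and> (\<forall>u\<in>X. \<forall>\<epsilon>>0. \<exists>g\<in>A. N (\<lambda>x. u x - g x) < \<epsilon>)"

text \<open>Lengths of the polygons inscribed in the subcurve \<open>\<gamma>|[0,t]\<close>.\<close>

definition inscribed_lengths :: "(real \<Rightarrow> 'a::metric_space) \<Rightarrow> real \<Rightarrow> real set" where
  "inscribed_lengths \<gamma> t =
     {(\<Sum>i<length ts - 1. dist (\<gamma> (ts ! i)) (\<gamma> (ts ! Suc i))) | ts. sorted ts \<and> set ts \<subseteq> {0..t}}"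

definition arc_length :: "(real \<Rightarrow> 'a::metric_space) \<Rightarrow> real \<Rightarrow> real" where
  "arc_length \<gamma> t = Sup (inscribed_lengths \<gamma> t)"

definition rectifiable :: "(real \<Rightarrow> 'a::metric_space) \<Rightarrow> bool" where
  "rectifiable \<gamma> \<longleftrightarrow> path \<gamma> \<and> bdd_above (inscribed_lengths \<gamma> 1)"

text \<open>The choice of \<open>t\<close> is immaterial: \<open>\<gamma>\<close> is constant wherever \<open>arc_length \<gamma>\<close> is.\<close>

definition arc_length_param :: "(real \<Rightarrow> 'a::metric_space) \<Rightarrow> real \<Rightarrow> 'a" where
  "arc_length_param \<gamma> s = \<gamma> (SOME t. t \<in> {0..1} \<and> arc_length \<gamma> t = s)"

definition line_integral :: "(real \<Rightarrow> 'a::metric_space) \<Rightarrow> ('a \<Rightarrow> real) \<Rightarrow> real" where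
  "line_integral \<gamma> \<rho> = integral {0..arc_length \<gamma> 1} (\<lambda>s. \<rho> (arc_length_param \<gamma> s))"

definition bdry_dist :: "'a::metric_space set \<Rightarrow> 'a \<Rightarrow> real" where
  "bdry_dist \<Omega> z = infdist z (frontier \<Omega>)"

definition curves_joining ::
  "'a::metric_space set \<Rightarrow> 'a \<Rightarrow> 'a \<Rightarrow> (real \<Rightarrow> 'a) set" where
  "curves_joining \<Omega> x y =
     {\<gamma>. rectifiable \<gamma> \<and> path_image \<gamma> \<subseteq> \<Omega> \<and> pathstart \<gamma> = x \<and> pathfinish \<gamma> = y}"

definition qh_length :: "'a::metric_space set \<Rightarrow> (real \<Rightarrow> 'a) \<Rightarrow> real" where
  "qh_length \<Omega> \<gamma> = line_integral \<gamma> (\<lambda>z. 1 / bdry_dist \<Omega> z)"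

definition qh_dist :: "'a::metric_space set \<Rightarrow> 'a \<Rightarrow> 'a \<Rightarrow> real" where
  "qh_dist \<Omega> x y = (INF \<gamma>\<in>curves_joining \<Omega> x y. qh_length \<Omega> \<gamma>)"

definition qh_geodesic ::
  "'a::metric_space set \<Rightarrow> 'a \<Rightarrow> 'a \<Rightarrow> (real \<Rightarrow> 'a) \<Rightarrow> bool" where
  "qh_geodesic \<Omega> x y \<gamma> \<longleftrightarrow> \<gamma> \<in> curves_joining \<Omega> x y \<and> qh_length \<Omega> \<gamma> = qh_dist \<Omega> x y"

definition gromov_hyperbolic :: "real \<Rightarrow> 'a::metric_space set \<Rightarrow> bool" where
  "gromov_hyperbolic \<delta> \<Omega> \<longleftrightarrow> is_domain \<Omega> \<and> \<Omega> \<noteq> UNIV \<and>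
     (\<forall>x\<in>\<Omega>. \<forall>y\<in>\<Omega>. \<forall>z\<in>\<Omega>. \<forall>\<gamma>\<^sub>1 \<gamma>\<^sub>2 \<gamma>\<^sub>3.
        qh_geodesic \<Omega> x y \<gamma>\<^sub>1 \<and> qh_geodesic \<Omega> y z \<gamma>\<^sub>2 \<and> qh_geodesic \<Omega> z x \<gamma>\<^sub>3 \<longrightarrow>
          (\<forall>w\<in>path_image \<gamma>\<^sub>1.
             {u\<in>\<Omega>. qh_dist \<Omega> u w \<le> \<delta>} \<inter> (path_image \<gamma>\<^sub>2 \<union> path_image \<gamma>\<^sub>3) \<noteq> {}) \<and>
          (\<forall>w\<in>path_image \<gamma>\<^sub>2.
             {u\<in>\<Omega>. qh_dist \<Omega> u w \<le> \<delta>} \<inter> (path_image \<gamma>\<^sub>3 \<union> path_image \<gamma>\<^sub>1) \<noteq> {}) \<and>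
          (\<forall>w\<in>path_image \<gamma>\<^sub>3.
             {u\<in>\<Omega>. qh_dist \<Omega> u w \<le> \<delta>} \<inter> (path_image \<gamma>\<^sub>1 \<union> path_image \<gamma>\<^sub>2) \<noteq> {}))"

text \<open>\<open>y = T z\<close> are the suitable coordinates, \<open>i\<close> is the index of the distinguished coordinate
  (\<open>y\<^sub>n\<close> in the usual notation), and a function of the remaining \<open>n - 1\<close> coordinates is a
  function of \<open>y\<close> that does not depend on its \<open>i\<close>-th coordinate. A translation of the
  coordinates can be absorbed into \<open>f\<close>.\<close>

definition C0_boundary :: "(real^'n::finite) set \<Rightarrow> bool" where
  "C0_boundary \<Omega> \<longleftrightarrow>
     (\<forall>x\<in>frontier \<Omega>. \<exists>U T i f.
        open U \<and> x \<in> U \<and> orthogonal_transformation (T :: real^'n \<Rightarrow> real^'n) \<and>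
        continuous_on UNIV (f :: real^'n \<Rightarrow> real) \<and>
        (\<forall>y y'. (\<forall>j. j \<noteq> i \<longrightarrow> y $ j = y' $ j) \<longrightarrow> f y = f y') \<and>
        U \<inter> \<Omega> = {z \<in> U. T z $ i < f (T z)})"

end

theory Submission
  imports Defs "HOL-Probability.Probability"
begin

text \<open>Near each point of the closure of \<open>\<Omega>\<close> there is one vector \<open>d\<close> such that all nearby points \<open>z\<close> of \<open>\<Omega>\<close>
  can be moved further into \<open>\<Omega>\<close>, to \<open>z - s d\<close> with \<open>0 < s \<le> 1\<close>: below the graph of a continuous function one
  moves downwards, and around interior points one need not move at all. Moreover, for each \<open>s\<close> a ball around
  \<open>z - s d\<close> of a radius independent of \<open>z\<close> fits into \<open>\<Omega>\<close> (\<open>C0_boundary_segment_property\<close>). Two classical arguments then give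
  the theorem.

  The first one recovers the derivatives of lower order. If \<open>u\<close> is locally integrable and its
  derivatives of order \<open>k\<close> are in \<open>L\<^sup>p\<close>, then so are those of order less than \<open>k\<close>, in a
  neighbourhood in \<open>\<Omega>\<close> of each point of the closure. Indeed, integrating the gradient along the segment from
  \<open>x\<close> to \<open>x - d\<close> and from there to the points of a small ball, and averaging over the ball, writes a
  function as an average of its values over a compact subset of \<open>\<Omega>\<close> plus averages of translates of its
  first derivatives. Applied to \<open>D\<^sup>l u\<close> the first term is smooth, since derivatives may be moved
  to the averaging kernel, and by Jensen's inequality averages of translates preserve \<open>L\<^sup>p\<close>. This is
  carried out on test functions by transposition (\<open>averaged_fundamental_theorem\<close>, \<open>average_transpose\<close>,
  \<open>lower_order_weak_deriv\<close>), and by descending induction it reaches every order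
  (\<open>local_weak_derivs_upto\<close>).

  The second one is the approximation. With all lower derivatives at hand, the product rule
  (\<open>supported_sobolev_mult\<close>) allows the function to be cut into finitely many pieces, each supported in one of these
  neighbourhoods. A piece is mollified with a kernel concentrated near \<open>s d\<close> instead of \<open>0\<close>. The
  result is smooth on the whole space, and at points of \<open>\<Omega>\<close> it is computed from values inside \<open>\<Omega>\<close>
  only, so its derivatives there are the mollified derivatives. These converge in \<open>L\<^sup>p\<close> as \<open>s\<close> and
  the width of the kernel tend to \<open>0\<close>, because translation is continuous in \<open>L\<^sup>p\<close>
  (\<open>translation_continuous_Lp\<close>, \<open>supported_sobolev_approximable\<close>). Adding up the pieces gives the
  approximation of \<open>u\<close>. Since \<open>\<Omega>\<close> is bounded, every function that is smooth on the whole space has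
  bounded derivatives on \<open>\<Omega>\<close>.\<close>

section \<open>Smooth functions and their iterated partial derivatives\<close>

lemma partial_deriv_DERIV:
  assumes "f differentiable (at x)"
  shows "((\<lambda>t. f (x + t *\<^sub>R axis i 1)) has_real_derivative partial_deriv i f x) (at 0)"
proof -
  have "f differentiable at (x + 0 *\<^sub>R axis i 1)" using assms by simp
  then have "(f \<circ> (\<lambda>t. x + t *\<^sub>R axis i 1)) differentiable (at (0::real))"
    by (intro differentiable_chain_at) (auto intro!: derivative_intros)
  then show ?thesis
    unfolding partial_deriv_def o_def
    by (simp add: DERIV_deriv_iff_real_differentiable)
qed

lemma partial_deriv_eq_frechet:
  assumes "(f has_derivative f') (at x)"
  shows "partial_deriv i f x = f' (axis i 1)"
proof -
  have "(f has_derivative f') (at (x + 0 *\<^sub>R axis i 1))" using assms by simp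
  then have "((\<lambda>t. f (x + t *\<^sub>R axis i 1)) has_derivative (\<lambda>t. f' (t *\<^sub>R axis i 1))) (at (0::real))"
    by (rule has_derivative_compose[rotated]) (auto intro!: derivative_eq_intros)
  moreover have "f' (t *\<^sub>R axis i 1) = f' (axis i 1) * t" for t
    using assms by (simp add: has_derivative_def linear_cmul bounded_linear.linear)
  ultimately have "((\<lambda>t. f (x + t *\<^sub>R axis i 1)) has_real_derivative f' (axis i 1)) (at 0)"
    by (simp add: has_field_derivative_def)
  then show ?thesis unfolding partial_deriv_def by (rule DERIV_imp_deriv)
qed

lemma has_derivative_partials:
  assumes "f differentiable (at x)"
  shows "(f has_derivative (\<lambda>h. \<Sum>i\<in>UNIV. h $ i * partial_deriv i f x)) (at x)"
proof -
  obtain f' where f': "(f has_derivative f') (at x)" using assms by (auto simp: differentiable_def)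
  then have lin: "linear f'" by (simp add: has_derivative_def bounded_linear.linear)
  have "f' h = (\<Sum>i\<in>UNIV. h $ i * partial_deriv i f x)" for h
  proof -
    have "f' h = f' (\<Sum>i\<in>UNIV. h $ i *\<^sub>R axis i 1)"
      using basis_expansion[of h] by (simp add: scalar_mult_eq_scaleR)
    also have "\<dots> = (\<Sum>i\<in>UNIV. h $ i * f' (axis i 1))"
      using lin by (simp add: linear_sum linear_cmul)
    finally show ?thesis using partial_deriv_eq_frechet[OF f'] by simp
  qed
  then have "f' = (\<lambda>h. \<Sum>i\<in>UNIV. h $ i * partial_deriv i f x)" by auto
  with f' show ?thesis by simp
qed

lemma Ck_antimono: "Ck n f \<Longrightarrow> m \<le> n \<Longrightarrow> Ck m f"
proof (induction n arbitrary: m f)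
  case (Suc n)
  show ?case
  proof (cases m)
    case 0
    then show ?thesis using Suc.prems(1)
      by (auto intro: differentiable_imp_continuous_on)
  next
    case (Suc m')
    then show ?thesis using Suc.prems Suc.IH by auto
  qed
qed simp

lemma smooth_iff: "smooth f \<longleftrightarrow> f differentiable_on UNIV \<and> (\<forall>i. smooth (partial_deriv i f))"
proof
  assume f: "smooth f"
  then have "Ck (Suc m) f" for m unfolding smooth_def by blast
  then show "f differentiable_on UNIV \<and> (\<forall>i. smooth (partial_deriv i f))"
    unfolding smooth_def by simp
next
  assume f: "f differentiable_on UNIV \<and> (\<forall>i. smooth (partial_deriv i f))"
  show "smooth f" unfolding smooth_def
  proof
    fix m show "Ck m f"
      using f by (cases m) (auto simp: smooth_def intro: differentiable_imp_continuous_on)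
  qed
qed

lemma smooth_coinduct:
  assumes "X f" and "\<And>f. X f \<Longrightarrow> f differentiable_on UNIV"
    and "\<And>f i. X f \<Longrightarrow> X (partial_deriv i f)"
  shows "smooth f"
proof -
  have "X f \<Longrightarrow> Ck m f" for m f
    by (induction m arbitrary: f) (auto simp: assms(2,3) intro: differentiable_imp_continuous_on)
  then show ?thesis using assms(1) by (simp add: smooth_def)
qed

lemma smooth_partial: "smooth f \<Longrightarrow> smooth (partial_deriv i f)"
  by (simp add: smooth_iff[of f])

lemma smooth_differentiable: "smooth f \<Longrightarrow> f differentiable (at x)"
  by (simp add: smooth_iff[of f] differentiable_on_def)

lemma smooth_has_derivative:
  "smooth f \<Longrightarrow> (f has_derivative (\<lambda>h. \<Sum>i\<in>UNIV. h $ i * partial_deriv i f x)) (at x)"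
  by (intro has_derivative_partials smooth_differentiable)

lemma smooth_continuous: "smooth f \<Longrightarrow> continuous_on S f"
  by (meson differentiable_imp_continuous_on smooth_iff continuous_on_subset subset_UNIV)

lemma smooth_borel [measurable_dest]: "smooth f \<Longrightarrow> f \<in> borel_measurable borel"
  by (intro borel_measurable_continuous_onI smooth_continuous)

lemma partial_deriv_const: "partial_deriv i (\<lambda>x. c) = (\<lambda>x. 0)"
  by (simp add: partial_deriv_def fun_eq_iff)

lemma smooth_const: "smooth (\<lambda>x. c)"
  by (rule smooth_coinduct[of "\<lambda>f. \<exists>c. f = (\<lambda>x. c)"]) (auto simp: partial_deriv_const)

lemma partial_deriv_add:
  assumes "f differentiable_on UNIV" "g differentiable_on UNIV"
  shows "partial_deriv i (\<lambda>x. f x + g x) = (\<lambda>x. partial_deriv i f x + partial_deriv i g x)"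
proof
  fix x
  have "f differentiable (at x)" "g differentiable (at x)"
    using assms by (auto simp: differentiable_on_def)
  then show "partial_deriv i (\<lambda>x. f x + g x) x = partial_deriv i f x + partial_deriv i g x"
    unfolding partial_deriv_def
    by (intro DERIV_imp_deriv DERIV_add partial_deriv_DERIV[unfolded partial_deriv_def])
qed

lemma partial_deriv_mult:
  assumes "f differentiable_on UNIV" "g differentiable_on UNIV"
  shows "partial_deriv i (\<lambda>x. f x * g x) = (\<lambda>x. partial_deriv i f x * g x + f x * partial_deriv i g x)"
proof
  fix x
  have "f differentiable (at x)" "g differentiable (at x)"
    using assms by (auto simp: differentiable_on_def)
  then have "((\<lambda>t. f (x + t *\<^sub>R axis i 1) * g (x + t *\<^sub>R axis i 1)) has_real_derivative
      (partial_deriv i f x * g (x + 0 *\<^sub>R axis i 1) + partial_deriv i g x * f (x + 0 *\<^sub>R axis i 1))) (at 0)"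
    by (intro DERIV_mult partial_deriv_DERIV)
  then show "partial_deriv i (\<lambda>x. f x * g x) x = partial_deriv i f x * g x + f x * partial_deriv i g x"
    by (subst partial_deriv_def) (simp add: DERIV_imp_deriv mult.commute)
qed

lemma Ck_add: "Ck m f \<Longrightarrow> Ck m g \<Longrightarrow> Ck m (\<lambda>x. f x + g x)"
  by (induction m arbitrary: f g)
    (auto simp: partial_deriv_add intro: continuous_on_add differentiable_on_add)

lemma smooth_add: "smooth f \<Longrightarrow> smooth g \<Longrightarrow> smooth (\<lambda>x. f x + g x)"
  by (simp add: smooth_def Ck_add)

lemma Ck_mult: "Ck m f \<Longrightarrow> Ck m g \<Longrightarrow> Ck m (\<lambda>x. f x * g x)"
proof (induction m arbitrary: f g)
  case (Suc m)
  then have "Ck m f" "Ck m g" by (meson Ck_antimono le_SucI order_refl)+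
  with Suc show ?case
    by (auto simp: partial_deriv_mult intro!: Ck_add differentiable_on_mult)
qed (auto intro: continuous_on_mult)

lemma smooth_mult: "smooth f \<Longrightarrow> smooth g \<Longrightarrow> smooth (\<lambda>x. f x * g x)"
  by (simp add: smooth_def Ck_mult)

lemma smooth_cmult: "smooth f \<Longrightarrow> smooth (\<lambda>x. c * f x)"
  by (intro smooth_mult smooth_const)

lemma smooth_diff: "smooth f \<Longrightarrow> smooth g \<Longrightarrow> smooth (\<lambda>x. f x - g x)"
  using smooth_add[of f "\<lambda>x. (-1) * g x"] smooth_cmult[of g "-1"] by simp

lemma smooth_sum: "(\<And>i. i \<in> I \<Longrightarrow> smooth (f i)) \<Longrightarrow> smooth (\<lambda>x. \<Sum>i\<in>I. f i x)"
  by (induction I rule: infinite_finite_induct) (auto intro: smooth_const smooth_add)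

lemma smooth_prod: "(\<And>i. i \<in> I \<Longrightarrow> smooth (f i)) \<Longrightarrow> smooth (\<lambda>x. \<Prod>i\<in>I. f i x)"
  by (induction I rule: infinite_finite_induct) (auto intro: smooth_const smooth_mult)

lemma partial_deriv_cmult: "f differentiable_on UNIV \<Longrightarrow>
  partial_deriv i (\<lambda>x. c * f x) = (\<lambda>x. c * partial_deriv i f x)"
  using partial_deriv_mult[of "\<lambda>x. c" f i] by (simp add: partial_deriv_const)

lemma partial_deriv_affine:
  "partial_deriv i (\<lambda>x. f (a + c *\<^sub>R x)) = (\<lambda>x. c * partial_deriv i f (a + c *\<^sub>R x))"
  if "f differentiable_on UNIV"
proof
  fix x
  have "f differentiable (at (a + c *\<^sub>R x))" using that by (auto simp: differentiable_on_def)
  then have "(f has_derivative (\<lambda>h. \<Sum>i\<in>UNIV. h $ i * partial_deriv i f (a + c *\<^sub>R x))) (at (a + c *\<^sub>R x))"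
    by (rule has_derivative_partials)
  then have "((\<lambda>x. f (a + c *\<^sub>R x)) has_derivative
      (\<lambda>h. \<Sum>i\<in>UNIV. (c *\<^sub>R h) $ i * partial_deriv i f (a + c *\<^sub>R x))) (at x)"
    by (rule has_derivative_compose[rotated]) (auto intro!: derivative_eq_intros)
  from partial_deriv_eq_frechet[OF this, of i]
  show "partial_deriv i (\<lambda>x. f (a + c *\<^sub>R x)) x = c * partial_deriv i f (a + c *\<^sub>R x)"
    by (simp add: axis_def if_distrib[of "\<lambda>x. _ * x * _"] if_distrib[of "\<lambda>x. x * _"] sum.delta cong: if_cong)
qed

lemma smooth_affine: "smooth f \<Longrightarrow> smooth (\<lambda>x. f (a + c *\<^sub>R x))"
proof -
  assume f: "smooth f"
  let ?X = "\<lambda>g. \<exists>b f. smooth f \<and> g = (\<lambda>x. b * f (a + c *\<^sub>R x))"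
  show ?thesis
  proof (rule smooth_coinduct[of ?X])
    show "?X (\<lambda>x. f (a + c *\<^sub>R x))" using f by (intro exI[of _ 1] exI[of _ f]) simp
  next
    fix g assume "?X g"
    then obtain b f where f: "smooth f" and g: "g = (\<lambda>x. b * f (a + c *\<^sub>R x))" by blast
    have d: "(\<lambda>x. f (a + c *\<^sub>R x)) differentiable_on UNIV"
      unfolding differentiable_on_def
    proof
      fix x
      have "(f \<circ> (\<lambda>x. a + c *\<^sub>R x)) differentiable (at x)"
        by (intro differentiable_chain_at smooth_differentiable f) (auto intro!: derivative_intros)
      then show "(\<lambda>x. f (a + c *\<^sub>R x)) differentiable (at x)" by (simp add: o_def)
    qed
    then show "g differentiable_on UNIV" unfolding g by (intro differentiable_on_mult) auto
    fix i
    have "partial_deriv i g = (\<lambda>x. (b * c) * partial_deriv i f (a + c *\<^sub>R x))"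
      using f d unfolding g
      by (subst partial_deriv_cmult) (auto simp: partial_deriv_affine smooth_iff[of f])
    then show "?X (partial_deriv i g)" using smooth_partial[OF f] by blast
  qed
qed

text \<open>Unlike a multi-index, a list of directions can be extended by one more derivative at either end.\<close>

definition list_deriv :: "'n::finite list \<Rightarrow> (real^'n \<Rightarrow> real) \<Rightarrow> real^'n \<Rightarrow> real" where
  "list_deriv l f = foldr partial_deriv l f"

lemma list_deriv_Nil [simp]: "list_deriv [] f = f"
  by (simp add: list_deriv_def)

lemma list_deriv_Cons [simp]: "list_deriv (i # l) f = partial_deriv i (list_deriv l f)"
  by (simp add: list_deriv_def)

lemma list_deriv_append: "list_deriv (l @ m) f = list_deriv l (list_deriv m f)"
  by (simp add: list_deriv_def)

lemma smooth_list_deriv: "smooth f \<Longrightarrow> smooth (list_deriv l f)"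
  by (induction l) (auto intro: smooth_partial)

lemma smooth_diffble: "smooth f \<Longrightarrow> f differentiable_on UNIV"
  by (simp add: smooth_iff[of f])

lemma list_deriv_add: "smooth f \<Longrightarrow> smooth g \<Longrightarrow>
    list_deriv l (\<lambda>x. f x + g x) = (\<lambda>x. list_deriv l f x + list_deriv l g x)"
  by (induction l) (auto simp: partial_deriv_add smooth_diffble smooth_list_deriv)

lemma list_deriv_cmult: "smooth f \<Longrightarrow> list_deriv l (\<lambda>x. c * f x) = (\<lambda>x. c * list_deriv l f x)"
  by (induction l) (auto simp: partial_deriv_cmult smooth_diffble smooth_list_deriv)

lemma list_deriv_const0: "list_deriv l (\<lambda>x. 0) = (\<lambda>x. 0)"
  by (induction l) (auto simp: partial_deriv_const)

lemma list_deriv_sum: "finite I \<Longrightarrow> (\<And>i. i \<in> I \<Longrightarrow> smooth (f i)) \<Longrightarrow>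
    list_deriv l (\<lambda>x. \<Sum>i\<in>I. f i x) = (\<lambda>x. \<Sum>i\<in>I. list_deriv l (f i) x)"
  by (induction I rule: finite_induct)
    (auto simp: list_deriv_const0 list_deriv_add smooth_sum)

lemma partial_deriv_zero_open:
  assumes "open U" "x \<in> U" "\<And>y. y \<in> U \<Longrightarrow> f y = 0"
  shows "partial_deriv i f x = 0"
proof -
  have "(f has_derivative (\<lambda>h. 0)) (at x)"
    by (rule has_derivative_transform_within_open[of "\<lambda>x. 0" _ _ _ U]) (use assms in auto)
  then show ?thesis by (rule partial_deriv_eq_frechet)
qed

lemma list_deriv_zero_open:
  assumes "open U" "\<And>y. y \<in> U \<Longrightarrow> f y = 0" "x \<in> U"
  shows "list_deriv l f x = 0"
  using assms(3) by (induction l arbitrary: x) (auto simp: assms intro: partial_deriv_zero_open[OF assms(1)])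

lemma list_deriv_zero_off_closed:
  assumes "closed K" "\<And>y. y \<notin> K \<Longrightarrow> f y = 0" "x \<notin> K"
  shows "list_deriv l f x = 0"
  using assms by (intro list_deriv_zero_open[of "-K"]) auto

lemma partial_deriv_line:
  assumes "smooth f"
  shows "((\<lambda>t. f (x + t *\<^sub>R v)) has_real_derivative
          (\<Sum>i\<in>UNIV. v $ i * partial_deriv i f (x + t *\<^sub>R v))) (at t)"
proof -
  have "((\<lambda>t. f (x + t *\<^sub>R v)) has_derivative
      (\<lambda>h. \<Sum>i\<in>UNIV. (h *\<^sub>R v) $ i * partial_deriv i f (x + t *\<^sub>R v))) (at t)"
    by (rule has_derivative_compose[OF _ smooth_has_derivative[OF assms]])
      (auto intro!: derivative_eq_intros)
  then show ?thesis
    unfolding has_field_derivative_def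
    by (rule has_derivative_eq_rhs) (simp add: fun_eq_iff sum_distrib_left sum_distrib_right mult_ac)
qed

lemma partial_deriv_axis_line:
  assumes "smooth f"
  shows "((\<lambda>t. f (x + t *\<^sub>R axis i 1)) has_real_derivative partial_deriv i f (x + t *\<^sub>R axis i 1)) (at t)"
proof -
  have "(\<Sum>j\<in>UNIV. axis i 1 $ j * partial_deriv j f y) = partial_deriv i f y" for y
    by (simp add: axis_def if_distrib[of "\<lambda>x. x * _"] sum.delta cong: if_cong)
  then show ?thesis using partial_deriv_line[OF assms, of x "axis i 1" t] by simp
qed

text \<open>Apply the mean value theorem first in direction \<open>i\<close>, to the difference of \<open>f\<close> in direction
  \<open>j\<close>, and then in direction \<open>j\<close>, to \<open>\<partial>\<^sub>i f\<close>.\<close>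

lemma second_difference:
  assumes f: "smooth f" and h: "h > 0"
  obtains s t where "0 < s" "s < h" "0 < t" "t < h"
    "f (x + h *\<^sub>R axis i 1 + h *\<^sub>R axis j 1) - f (x + h *\<^sub>R axis i 1) - f (x + h *\<^sub>R axis j 1) + f x
      = h * h * partial_deriv j (partial_deriv i f) (x + s *\<^sub>R axis i 1 + t *\<^sub>R axis j 1)"
proof -
  let ?g = "\<lambda>s. f ((x + h *\<^sub>R axis j 1) + s *\<^sub>R axis i 1) - f (x + s *\<^sub>R axis i 1)"
  have "\<exists>s>0. s < h \<and> ?g h - ?g 0 = (h - 0) * (partial_deriv i f ((x + h *\<^sub>R axis j 1) + s *\<^sub>R axis i 1)
      - partial_deriv i f (x + s *\<^sub>R axis i 1))"
    using MVT2[OF h, of ?g "\<lambda>s. partial_deriv i f ((x + h *\<^sub>R axis j 1) + s *\<^sub>R axis i 1)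
      - partial_deriv i f (x + s *\<^sub>R axis i 1)"]
    using DERIV_diff[OF partial_deriv_axis_line[OF f] partial_deriv_axis_line[OF f]] by blast
  then obtain s where s: "0 < s" "s < h" "?g h - ?g 0 = h * (partial_deriv i f ((x + h *\<^sub>R axis j 1) + s *\<^sub>R axis i 1)
      - partial_deriv i f (x + s *\<^sub>R axis i 1))" by auto
  let ?k = "\<lambda>t. partial_deriv i f ((x + s *\<^sub>R axis i 1) + t *\<^sub>R axis j 1)"
  have "\<exists>t>0. t < h \<and> ?k h - ?k 0 = (h - 0) * partial_deriv j (partial_deriv i f) (x + s *\<^sub>R axis i 1 + t *\<^sub>R axis j 1)"
    using MVT2[OF h, of ?k "\<lambda>t. partial_deriv j (partial_deriv i f) ((x + s *\<^sub>R axis i 1) + t *\<^sub>R axis j 1)"]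
      partial_deriv_axis_line[OF smooth_partial[OF f]] by blast
  then obtain t where t: "0 < t" "t < h"
    "?k h - ?k 0 = h * partial_deriv j (partial_deriv i f) (x + s *\<^sub>R axis i 1 + t *\<^sub>R axis j 1)" by auto
  show ?thesis
  proof (rule that[OF s(1,2) t(1,2)])
    have "f (x + h *\<^sub>R axis i 1 + h *\<^sub>R axis j 1) - f (x + h *\<^sub>R axis i 1) - f (x + h *\<^sub>R axis j 1) + f x = ?g h - ?g 0"
      by (simp add: algebra_simps)
    also have "\<dots> = h * (?k h - ?k 0)" unfolding s(3) by (simp add: algebra_simps)
    finally show "f (x + h *\<^sub>R axis i 1 + h *\<^sub>R axis j 1) - f (x + h *\<^sub>R axis i 1) - f (x + h *\<^sub>R axis j 1) + f x
      = h * h * partial_deriv j (partial_deriv i f) (x + s *\<^sub>R axis i 1 + t *\<^sub>R axis j 1)"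
      unfolding t(3) by simp
  qed
qed

text \<open>The second difference is symmetric in \<open>i\<close> and \<open>j\<close>, so it is \<open>h\<^sup>2\<close> times either mixed derivative at
  points that tend to \<open>x\<close> with \<open>h\<close>.\<close>

lemma partial_deriv_commute:
  assumes f: "smooth f"
  shows "partial_deriv i (partial_deriv j f) = partial_deriv j (partial_deriv i f)"
proof
  fix x
  let ?F = "partial_deriv j (partial_deriv i f)" and ?G = "partial_deriv i (partial_deriv j f)"
  have "smooth ?F" "smooth ?G" by (intro smooth_partial f)+
  then have cont: "isCont ?F x" "isCont ?G x"
    by (auto dest: smooth_continuous[of _ UNIV] simp: continuous_on_eq_continuous_at)
  show "?G x = ?F x"
  proof (rule ccontr)
    assume ne: "?G x \<noteq> ?F x"
    define e where "e = \<bar>?G x - ?F x\<bar> / 2"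
    have e: "e > 0" using ne by (simp add: e_def)
    obtain d1 where d1: "d1 > 0" "\<And>y. dist y x < d1 \<Longrightarrow> dist (?F y) (?F x) < e"
      using cont(1) e by (auto simp: continuous_at_eps_delta)
    obtain d2 where d2: "d2 > 0" "\<And>y. dist y x < d2 \<Longrightarrow> dist (?G y) (?G x) < e"
      using cont(2) e by (auto simp: continuous_at_eps_delta)
    define h where "h = min d1 d2 / 3"
    have h: "h > 0" using d1 d2 by (simp add: h_def)
    obtain s t where st: "0 < s" "s < h" "0 < t" "t < h"
      "f (x + h *\<^sub>R axis i 1 + h *\<^sub>R axis j 1) - f (x + h *\<^sub>R axis i 1) - f (x + h *\<^sub>R axis j 1) + f x
      = h * h * ?F (x + s *\<^sub>R axis i 1 + t *\<^sub>R axis j 1)" using second_difference[OF f h] by metis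
    obtain s' t' where st': "0 < s'" "s' < h" "0 < t'" "t' < h"
      "f (x + h *\<^sub>R axis j 1 + h *\<^sub>R axis i 1) - f (x + h *\<^sub>R axis j 1) - f (x + h *\<^sub>R axis i 1) + f x
      = h * h * ?G (x + s' *\<^sub>R axis j 1 + t' *\<^sub>R axis i 1)" using second_difference[OF f h] by metis
    have near: "dist (x + a *\<^sub>R axis i 1 + b *\<^sub>R axis j 1) x < min d1 d2"
      if "0 < a" "a < h" "0 < b" "b < h" for a b i j
    proof -
      have "dist (x + a *\<^sub>R axis i 1 + b *\<^sub>R axis j 1) x \<le> norm (a *\<^sub>R axis i (1::real)) + norm (b *\<^sub>R axis j (1::real))"
        by (metis add.assoc add_diff_cancel_left' dist_norm norm_triangle_ineq)
      also have "\<dots> < 2 * h" using that by simp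
      also have "\<dots> \<le> min d1 d2" using h using d1(1) d2(1) by (auto simp: h_def min_def)
      finally show ?thesis .
    qed
    have "h * h * ?F (x + s *\<^sub>R axis i 1 + t *\<^sub>R axis j 1) = h * h * ?G (x + s' *\<^sub>R axis j 1 + t' *\<^sub>R axis i 1)"
      using st(5) st'(5) by (simp add: algebra_simps)
    then have "?F (x + s *\<^sub>R axis i 1 + t *\<^sub>R axis j 1) = ?G (x + s' *\<^sub>R axis j 1 + t' *\<^sub>R axis i 1)"
      using h by simp
    moreover have "dist (?F (x + s *\<^sub>R axis i 1 + t *\<^sub>R axis j 1)) (?F x) < e"
      using near[OF st(1-4), of i j] by (intro d1(2)) simp
    moreover have "dist (?G (x + s' *\<^sub>R axis j 1 + t' *\<^sub>R axis i 1)) (?G x) < e"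
      using near[OF st'(1-4), of j i] by (intro d2(2)) simp
    ultimately show False unfolding e_def dist_real_def
      by (smt (verit) field_sum_of_halves)
  qed
qed

lemma list_deriv_partial_commute:
  "smooth f \<Longrightarrow> list_deriv l (partial_deriv i f) = partial_deriv i (list_deriv l f)"
  by (induction l) (auto simp: partial_deriv_commute smooth_list_deriv)

lemma list_deriv_mset:
  "mset l = mset m \<Longrightarrow> smooth f \<Longrightarrow> list_deriv l f = list_deriv m f"
proof (induction l arbitrary: m)
  case (Cons i l)
  then obtain m1 m2 where m: "m = m1 @ i # m2"
    by (metis list.set_intros(1) set_mset_mset split_list)
  have "list_deriv m f = partial_deriv i (list_deriv (m1 @ m2) f)"
    using Cons.prems(2) by (simp add: m list_deriv_append list_deriv_partial_commute smooth_list_deriv)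
  moreover have "list_deriv l f = list_deriv (m1 @ m2) f"
    using Cons.prems m by (intro Cons.IH) auto
  ultimately show ?case by simp
qed simp

lemma index_enum: "distinct (index_enum :: 'n::finite list)" "set (index_enum :: 'n list) = UNIV"
proof -
  have "\<exists>is :: 'n list. distinct is \<and> set is = UNIV"
    using finite_distinct_list[OF finite] by (metis (no_types))
  from someI_ex[OF this]
  show "distinct (index_enum :: 'n list)" "set (index_enum :: 'n list) = UNIV"
    unfolding index_enum_def by auto
qed

text \<open>The directions of the derivatives in \<^const>\<open>mi_deriv\<close>, in the order in which it takes them.\<close>

definition mi_list :: "('n::finite \<Rightarrow> nat) \<Rightarrow> 'n list" where
  "mi_list \<alpha> = concat (map (\<lambda>i. replicate (\<alpha> i) i) index_enum)"

lemma mi_deriv_eq: "mi_deriv \<alpha> f = list_deriv (mi_list \<alpha>) f"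
proof -
  have rep: "(partial_deriv i ^^ n) g = list_deriv (replicate n i) g" for n i and g :: "real^'n \<Rightarrow> real"
    by (induction n) auto
  have "foldr (\<lambda>i g. (partial_deriv i ^^ \<alpha> i) g) is f = list_deriv (concat (map (\<lambda>i. replicate (\<alpha> i) i) is)) f" for "is"
    by (induction "is") (auto simp: rep list_deriv_append)
  then show ?thesis by (simp add: mi_deriv_def mi_list_def)
qed

lemma count_mi_list: "count (mset (mi_list \<alpha>)) i = \<alpha> i"
proof -
  have "count (mset (concat (map (\<lambda>i. replicate (\<alpha> i) i) is))) i = (if i \<in> set is then \<alpha> i else 0)"
    if "distinct is" for "is"
    using that by (induction "is") auto
  from this[OF index_enum(1)] show ?thesis by (simp add: mi_list_def index_enum(2))
qed

lemma length_mi_list: "length (mi_list \<alpha>) = mi_order \<alpha>"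
proof -
  have "length (mi_list \<alpha>) = (\<Sum>i\<leftarrow>index_enum. \<alpha> i)"
    by (simp add: mi_list_def length_concat o_def)
  also have "\<dots> = mi_order \<alpha>"
    unfolding mi_order_def using index_enum by (metis sum_list_distinct_conv_sum_set)
  finally show ?thesis .
qed

lemma mset_mi_list_count: "mset (mi_list (\<lambda>i. count (mset l) i)) = mset l"
  by (intro multiset_eqI) (simp only: count_mi_list)

section \<open>Bump functions and test functions\<close>

text \<open>These functions extend \<open>exp (- 1 / t) / t ^ m\<close> by zero. Their span is closed under
  differentiation, which makes them smooth.\<close>

definition flat :: "nat \<Rightarrow> real \<Rightarrow> real" where
  "flat m t = (if t > 0 then exp (- 1 / t) / t ^ m else 0)"

lemma flat_bound: "\<bar>flat m t\<bar> \<le> real (Suc m) ^ Suc m * \<bar>t\<bar>"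
proof (cases "t > 0")
  case True
  let ?n = "Suc m"
  (* (1 + x / n) ^ n <= exp x for x = 1 / t *)
  have "(1 / (t * ?n)) ^ ?n \<le> (1 + (1 / t) / ?n) ^ ?n"
    using True by (intro power_mono) (auto simp: field_simps)
  also have "\<dots> \<le> exp (1 / t)"
  proof (rule exp_ge_one_plus_x_over_n_power_n)
    have "0 \<le> 1 / t" using True by simp
    then show "- real (Suc m) \<le> 1 / t" by linarith
  qed simp
  finally have "1 \<le> exp (1 / t) * (t * ?n) ^ ?n"
    using True by (simp add: power_divide field_simps del: power_Suc of_nat_Suc)
  then have "exp (- 1 / t) \<le> exp (- 1 / t) * (exp (1 / t) * (t * ?n) ^ ?n)"
    by (metis exp_ge_zero mult_left_mono mult.right_neutral)
  also have "\<dots> = (t * ?n) ^ ?n"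
    by (simp add: mult.assoc[symmetric] exp_add[symmetric] del: power_Suc of_nat_Suc)
  also have "\<dots> = real ?n ^ ?n * t * t ^ m"
    by (simp add: power_mult_distrib)
  finally show ?thesis using True by (simp add: flat_def divide_le_eq)
next
  case False
  have "0 \<le> real (Suc m) ^ Suc m * \<bar>t\<bar>" by (intro mult_nonneg_nonneg zero_le_power) auto
  then show ?thesis using False by (simp only: flat_def if_False abs_zero)
qed

lemma flat_DERIV: "(flat m has_real_derivative flat (m + 2) t - m * flat (m + 1) t) (at t)"
proof (cases t "0 :: real" rule: linorder_cases)
  case less
  have "((\<lambda>_. 0) has_real_derivative 0) (at t)" by simp
  then have "(flat m has_real_derivative 0) (at t)"
    by (rule has_field_derivative_transform_within_open[of _ _ _ "{..<0}"]) (use less in \<open>auto simp: flat_def\<close>)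
  then show ?thesis using less by (simp add: flat_def)
next
  case equal
  have "((\<lambda>h. (flat m h - flat m 0) / h) \<longlongrightarrow> 0) (at 0)"
  proof (rule Lim_null_comparison)
    show "\<forall>\<^sub>F h in at 0. norm ((flat m h - flat m 0) / h) \<le> real (Suc (Suc m)) ^ Suc (Suc m) * \<bar>h\<bar>"
    proof (intro always_eventually allI)
      fix h :: real
      have "flat m h / h = flat (Suc m) h" by (simp add: flat_def)
      then show "norm ((flat m h - flat m 0) / h) \<le> real (Suc (Suc m)) ^ Suc (Suc m) * \<bar>h\<bar>"
        using flat_bound[of "Suc m" h] by (simp add: flat_def[of m 0])
    qed
    show "((\<lambda>h. real (Suc (Suc m)) ^ Suc (Suc m) * \<bar>h\<bar>) \<longlongrightarrow> 0) (at 0)"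
      by (intro tendsto_eq_intros | simp)+
  qed
  then show ?thesis using equal by (simp add: has_field_derivative_iff flat_def[of _ 0])
next
  case greater
  have "((\<lambda>t. exp (- 1 / t) / t ^ m) has_real_derivative
     (exp (-1 / t) * (1 / t\<^sup>2) * t ^ m - exp (- 1 / t) * (m * t ^ (m - 1))) / (t ^ m * t ^ m)) (at t)"
    using greater by (auto intro!: derivative_eq_intros simp: power2_eq_square)
  also have "(exp (-1 / t) * (1 / t\<^sup>2) * t ^ m - exp (- 1 / t) * (m * t ^ (m - 1))) / (t ^ m * t ^ m)
      = flat (m + 2) t - m * flat (m + 1) t"
    using greater by (cases m) (simp_all add: flat_def field_simps power2_eq_square)
  finally have "((\<lambda>t. exp (- 1 / t) / t ^ m) has_real_derivative flat (m + 2) t - m * flat (m + 1) t) (at t)" .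
  then show ?thesis
    by (rule has_field_derivative_transform_within_open[of _ _ _ "{0<..}"]) (use greater in \<open>auto simp: flat_def\<close>)
qed

lemma smooth_flat_compose:
  assumes s: "smooth s"
  shows "smooth (\<lambda>x. flat m (s x))"
proof -
  have d: "((\<lambda>x. flat m (s x)) has_derivative
      (\<lambda>h. (flat (m + 2) (s x) - m * flat (m + 1) (s x)) * (\<Sum>i\<in>UNIV. h $ i * partial_deriv i s x))) (at x)" for m x
    by (rule has_derivative_compose[OF smooth_has_derivative[OF s]])
      (use flat_DERIV[of m "s x"] in \<open>simp add: has_field_derivative_def\<close>)
  have dd: "(\<lambda>x. flat m (s x)) differentiable_on UNIV" for m
    using d by (auto simp: differentiable_on_def differentiable_def)
  have p: "partial_deriv i (\<lambda>x. flat m (s x)) =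
      (\<lambda>x. (flat (m + 2) (s x) + (- real m) * flat (m + 1) (s x)) * partial_deriv i s x)" for m i
  proof
    fix x show "partial_deriv i (\<lambda>x. flat m (s x)) x =
      (flat (m + 2) (s x) + (- real m) * flat (m + 1) (s x)) * partial_deriv i s x"
      using partial_deriv_eq_frechet[OF d, of i m x]
      by (simp add: axis_def if_distrib[of "\<lambda>x. x * _"] sum.delta cong: if_cong)
  qed
  have const: "Ck k (\<lambda>x. c)" for k and c :: real
    using smooth_const unfolding smooth_def by blast
  have "Ck k (\<lambda>x. flat m (s x))" for k
  proof (induction k arbitrary: m)
    case 0 then show ?case using dd by (simp add: differentiable_imp_continuous_on)
  next
    case (Suc k)
    have "Ck k (partial_deriv i s)" for i using smooth_partial[OF s] by (simp add: smooth_def)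
    then have "Ck k (partial_deriv i (\<lambda>x. flat m (s x)))" for i
      unfolding p by (intro Ck_mult Ck_add Suc const)
    then show ?case using dd by simp
  qed
  then show ?thesis by (simp add: smooth_def)
qed

lemma partial_deriv_nth:
  fixes j :: "'a::finite"
  shows "partial_deriv i (\<lambda>x. x $ j) = (\<lambda>x. axis i 1 $ j)"
proof
  fix x :: "real^'a"
  have "((\<lambda>x. x $ j) has_derivative (\<lambda>x. x $ j)) (at x)"
    by (intro bounded_linear.has_derivative[OF bounded_linear_vec_nth] has_derivative_ident)
  then show "partial_deriv i (\<lambda>x. x $ j) x = axis i 1 $ j" by (rule partial_deriv_eq_frechet)
qed

lemma smooth_nth: "smooth (\<lambda>x. x $ j)"
  unfolding smooth_iff[of "\<lambda>x. x $ j"] partial_deriv_nth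
  by (auto intro!: smooth_const bounded_linear_imp_differentiable_on bounded_linear_vec_nth)

text \<open>This is \<open>flat 0 (r\<^sup>2 - (dist x a)\<^sup>2)\<close>, written with coordinates so that the argument is visibly smooth.\<close>

definition bump :: "real^'n::finite \<Rightarrow> real \<Rightarrow> real^'n \<Rightarrow> real" where
  "bump a r x = flat 0 (r\<^sup>2 - (\<Sum>i\<in>UNIV. (x $ i - a $ i) * (x $ i - a $ i)))"

lemma smooth_bump: "smooth (bump a r)"
  unfolding bump_def[abs_def]
  by (intro smooth_flat_compose smooth_diff smooth_const smooth_sum smooth_mult smooth_nth)

lemma bump_pos_iff: "r > 0 \<Longrightarrow> bump a r x > 0 \<longleftrightarrow> dist x a < r"
proof -
  assume r: "r > 0"
  have "(\<Sum>i\<in>UNIV. (x $ i - a $ i) * (x $ i - a $ i)) = (x - a) \<bullet> (x - a)"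
    by (simp add: inner_vec_def)
  also have "\<dots> = (dist x a)\<^sup>2" by (simp add: dist_norm power2_norm_eq_inner)
  finally have eq: "bump a r x = flat 0 (r\<^sup>2 - (dist x a)\<^sup>2)" by (simp add: bump_def)
  have "(dist x a)\<^sup>2 < r\<^sup>2 \<longleftrightarrow> dist x a < r"
    using r by (metis abs_of_pos abs_of_nonneg power2_less_imp_less less_imp_le power_strict_mono zero_le_dist zero_less_numeral)
  then show ?thesis unfolding eq flat_def by auto
qed

lemma bump_nonneg: "bump a r x \<ge> 0"
  by (simp add: bump_def flat_def)

lemma bump_zero: "r > 0 \<Longrightarrow> x \<notin> cball a r \<Longrightarrow> bump a r x = 0"
  using bump_pos_iff[of r a x] bump_nonneg[of a r x] by (auto simp: dist_commute)

text \<open>On the whole space the support condition only demands compact support.\<close>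

abbreviation test :: "(real^'n::finite \<Rightarrow> real) \<Rightarrow> bool" where
  "test \<equiv> test_function UNIV"

lemma testD:
  assumes "test_function \<Omega> \<phi>"
  shows "smooth \<phi>" "\<exists>K. compact K \<and> K \<subseteq> \<Omega> \<and> (\<forall>x. x \<notin> K \<longrightarrow> \<phi> x = 0)" "test \<phi>"
  using assms by (auto simp: test_function_def)

lemma test_function_partial: "test_function \<Omega> \<phi> \<Longrightarrow> test_function \<Omega> (partial_deriv i \<phi>)"
  unfolding test_function_def
  using smooth_partial list_deriv_zero_off_closed[of _ \<phi> _ "[i]"] compact_imp_closed
  by (metis list_deriv_Cons list_deriv_Nil)

lemma test_function_list_deriv: "test_function \<Omega> \<phi> \<Longrightarrow> test_function \<Omega> (list_deriv l \<phi>)"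
  by (induction l) (auto intro: test_function_partial)

lemma test_function_mono: "test_function \<Omega> \<phi> \<Longrightarrow> \<Omega> \<subseteq> \<Omega>' \<Longrightarrow> test_function \<Omega>' \<phi>"
  by (auto simp: test_function_def)

lemma test_function_outside: "test_function \<Omega> \<phi> \<Longrightarrow> x \<notin> \<Omega> \<Longrightarrow> \<phi> x = 0"
  by (auto simp: test_function_def)

lemma test_bounded:
  assumes "test \<phi>" obtains B where "B > 0" "\<And>x. \<bar>\<phi> x\<bar> \<le> B"
proof -
  obtain K where K: "compact K" "\<And>x. x \<notin> K \<Longrightarrow> \<phi> x = 0" using testD(2)[OF assms] by auto
  have "bounded (\<phi> ` K)"
    using K smooth_continuous[OF testD(1)[OF assms]] by (intro compact_imp_bounded compact_continuous_image)
  then obtain B where B: "B > 0" "\<And>x. x \<in> K \<Longrightarrow> \<bar>\<phi> x\<bar> \<le> B" by (auto simp: bounded_pos)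
  have "\<bar>\<phi> x\<bar> \<le> B" for x using B K(2)[of x] by (cases "x \<in> K") auto
  then show ?thesis using B(1) that by blast
qed

lemma test_integrable: "test \<phi> \<Longrightarrow> integrable lborel \<phi>"
proof -
  assume t: "test \<phi>"
  obtain K where K: "compact K" "\<And>x. x \<notin> K \<Longrightarrow> \<phi> x = 0" using testD(2)[OF t] by auto
  have "integrable lborel (\<lambda>x. indicator K x *\<^sub>R \<phi> x)"
    using K(1) smooth_continuous[OF testD(1)[OF t]] by (rule borel_integrable_compact)
  also have "(\<lambda>x. indicator K x *\<^sub>R \<phi> x) = \<phi>" using K(2) by (force simp: indicator_def)
  finally show ?thesis .
qed

lemma test_uniformly_continuous:
  assumes "test \<phi>" "e > 0"
  obtains d where "d > 0" "\<And>x y. dist x y < d \<Longrightarrow> \<bar>\<phi> x - \<phi> y\<bar> < e"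
proof -
  obtain K where K: "compact K" "\<And>x. x \<notin> K \<Longrightarrow> \<phi> x = 0" using testD(2)[OF assms(1)] by auto
  define K' where "K' = {x + y |x y. x \<in> K \<and> y \<in> cball 0 1}"
  have "compact K'" unfolding K'_def by (intro compact_sums K compact_cball)
  then have "uniformly_continuous_on K' \<phi>"
    by (intro compact_uniformly_continuous smooth_continuous testD(1)[OF assms(1)])
  then obtain d where d: "d > 0" "\<And>x y. x \<in> K' \<Longrightarrow> y \<in> K' \<Longrightarrow> dist y x < d \<Longrightarrow> dist (\<phi> y) (\<phi> x) < e"
    using assms(2) by (auto simp: uniformly_continuous_on_def)
  have near: "y \<in> K'" if "x \<in> K" "dist x y \<le> 1" for x y
    unfolding K'_def using that by (intro CollectI exI[of _ x] exI[of _ "y - x"]) (auto simp: dist_norm norm_minus_commute)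
  have "\<bar>\<phi> x - \<phi> y\<bar> < e" if "dist x y < min d 1" for x y
  proof (cases "x \<in> K \<or> y \<in> K")
    case True
    then have "x \<in> K'" "y \<in> K'" using near[of x x] near[of x y] near[of y y] near[of y x] that
      by (auto simp: dist_commute)
    then show ?thesis using d(2)[of y x] that by (simp add: dist_real_def)
  qed (use K assms in auto)
  then show ?thesis using that[of "min d 1"] d(1) by auto
qed

section \<open>Averages of translates\<close>

lemma norm_integral_le_integral:
  fixes f g :: "'w \<Rightarrow> real"
  assumes "integrable M f" "integrable M g" "\<And>x. x \<in> space M \<Longrightarrow> norm (f x) \<le> g x"
  shows "norm (LINT x|M. f x) \<le> (LINT x|M. g x)"
  by (smt (verit, best) assms integrable_norm integral_mono integral_norm_bound)

lemma lborel_distr_isometry: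
  fixes a :: "'a::euclidean_space"
  assumes "c = 1 \<or> c = -1"
  shows "distr lborel borel (\<lambda>x. a + c *\<^sub>R x) = lborel"
proof -
  have "lborel = density (distr lborel borel (\<lambda>x. a + c *\<^sub>R x)) (\<lambda>_. \<bar>c\<bar> ^ DIM('a))"
    using assms by (intro lborel_affine) auto
  also have "(\<lambda>_::'a. ennreal (\<bar>c\<bar> ^ DIM('a))) = (\<lambda>_. 1)" using assms by auto
  finally show ?thesis by (simp add: density_1)
qed

lemma lborel_integral_isometry:
  fixes f :: "'a::euclidean_space \<Rightarrow> real"
  assumes "f \<in> borel_measurable borel" "c = 1 \<or> c = -1"
  shows "(LINT x|lborel. f (a + c *\<^sub>R x)) = (LINT x|lborel. f x)"
    and "integrable lborel (\<lambda>x. f (a + c *\<^sub>R x)) \<longleftrightarrow> integrable lborel f"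
  using integral_distr[of "\<lambda>x. a + c *\<^sub>R x" lborel borel f]
    integrable_distr_eq[of "\<lambda>x. a + c *\<^sub>R x" lborel borel f] assms(1)
  by (simp_all add: lborel_distr_isometry[OF assms(2)])

lemma lborel_nn_integral_isometry:
  fixes f :: "'a::euclidean_space \<Rightarrow> ennreal"
  assumes "f \<in> borel_measurable borel" "c = 1 \<or> c = -1"
  shows "(\<integral>\<^sup>+x. f (a + c *\<^sub>R x) \<partial>lborel) = (\<integral>\<^sup>+x. f x \<partial>lborel)"
  using nn_integral_distr[of "\<lambda>x. a + c *\<^sub>R x" lborel borel f] assms(1)
  by (simp add: lborel_distr_isometry[OF assms(2)])

text \<open>The mean value theorem on the segment from \<open>x\<close> to \<open>x + h\<close>, together with the uniform continuity
  of the partial derivatives.\<close>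

lemma test_uniformly_differentiable:
  assumes "test \<psi>" "e > 0"
  obtains d where "d > 0"
    "\<And>x h. norm h < d \<Longrightarrow> \<bar>\<psi> (x + h) - \<psi> x - (\<Sum>i\<in>UNIV. h $ i * partial_deriv i \<psi> x)\<bar> \<le> e * norm h"
proof -
  let ?n = "real CARD('a)"
  have "\<exists>d>0. \<forall>x y. dist x y < d \<longrightarrow> \<bar>partial_deriv i \<psi> x - partial_deriv i \<psi> y\<bar> < e / ?n" for i
    using test_uniformly_continuous[OF test_function_partial[OF assms(1)], of "e / ?n" i] assms(2)
    by (metis zero_less_card_finite of_nat_0_less_iff divide_pos_pos)
  then obtain d where d: "\<And>i. d i > 0"
    "\<And>i x y. dist x y < d i \<Longrightarrow> \<bar>partial_deriv i \<psi> x - partial_deriv i \<psi> y\<bar> < e / ?n" by metis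
  let ?d = "Min (range d)"
  show ?thesis
  proof (rule that)
    show "?d > 0" using d(1) by simp
    fix x h :: "real^'a" assume h: "norm h < ?d"
    have sm: "smooth \<psi>" by (rule testD(1)[OF assms(1)])
    have "\<exists>t>0. t < 1 \<and> \<psi> (x + 1 *\<^sub>R h) - \<psi> (x + 0 *\<^sub>R h) =
        (1 - 0) * (\<Sum>i\<in>UNIV. h $ i * partial_deriv i \<psi> (x + t *\<^sub>R h))"
      by (rule MVT2) (auto intro: partial_deriv_line[OF sm])
    then obtain t where t: "0 < t" "t < 1" "\<psi> (x + h) - \<psi> x = (\<Sum>i\<in>UNIV. h $ i * partial_deriv i \<psi> (x + t *\<^sub>R h))"
      by auto
    have "\<bar>\<psi> (x + h) - \<psi> x - (\<Sum>i\<in>UNIV. h $ i * partial_deriv i \<psi> x)\<bar>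
        = \<bar>\<Sum>i\<in>UNIV. h $ i * (partial_deriv i \<psi> (x + t *\<^sub>R h) - partial_deriv i \<psi> x)\<bar>"
      unfolding t(3) by (simp add: sum_subtractf algebra_simps)
    also have "\<dots> \<le> (\<Sum>i\<in>(UNIV::'a set). norm h * (e / ?n))"
    proof (rule order_trans[OF sum_abs], rule sum_mono)
      fix i
      have "dist (x + t *\<^sub>R h) x \<le> norm h" using t by (simp add: dist_norm mult_left_le_one_le)
      also have "\<dots> < d i" using h by simp
      finally have "\<bar>partial_deriv i \<psi> (x + t *\<^sub>R h) - partial_deriv i \<psi> x\<bar> \<le> e / ?n"
        using d(2) by (simp add: less_imp_le)
      then show "\<bar>h $ i * (partial_deriv i \<psi> (x + t *\<^sub>R h) - partial_deriv i \<psi> x)\<bar> \<le> norm h * (e / ?n)"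
        unfolding abs_mult by (intro mult_mono component_le_norm_cart) auto
    qed
    also have "\<dots> = e * norm h" by simp
    finally show "\<bar>\<psi> (x + h) - \<psi> x - (\<Sum>i\<in>UNIV. h $ i * partial_deriv i \<psi> x)\<bar> \<le> e * norm h" .
  qed
qed

text \<open>This is the convolution of \<open>\<psi>\<close> with the image of the signed measure \<open>a M\<close> under \<open>- q\<close>. The same notion serves
  for mollifications, for averages over balls and for averages over paths.\<close>

definition average :: "'w measure \<Rightarrow> ('w \<Rightarrow> real) \<Rightarrow> ('w \<Rightarrow> real^'n::finite) \<Rightarrow> (real^'n \<Rightarrow> real) \<Rightarrow> real^'n \<Rightarrow> real" where
  "average M a q \<psi> x = (LINT w|M. a w * \<psi> (x + q w))"

lemma average_integrable:
  assumes "integrable M a" "q \<in> borel_measurable M" "test \<psi>"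
  shows "integrable M (\<lambda>w. a w * \<psi> (x + q w))"
proof -
  obtain B where B: "B > 0" "\<And>x. \<bar>\<psi> x\<bar> \<le> B" using test_bounded[OF assms(3)] by blast
  note [measurable] = assms(2) borel_measurable_integrable[OF assms(1)] smooth_borel[OF testD(1)[OF assms(3)]]
  show ?thesis
  proof (rule Bochner_Integration.integrable_bound)
    show "integrable M (\<lambda>w. B * \<bar>a w\<bar>)" using assms(1) by simp
    show "AE w in M. norm (a w * \<psi> (x + q w)) \<le> norm (B * \<bar>a w\<bar>)"
    proof (intro AE_I2)
      fix w show "norm (a w * \<psi> (x + q w)) \<le> norm (B * \<bar>a w\<bar>)"
        using mult_left_mono[OF B(2)[of "x + q w"], of "\<bar>a w\<bar>"] B(1) by (simp add: abs_mult mult.commute)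
    qed
  qed measurable
qed

text \<open>The error of the linear approximation of \<open>\<psi>\<close> is uniformly small, so it stays small after integration
  against \<open>a\<close>.\<close>

lemma average_has_derivative:
  assumes "integrable M a" "q \<in> borel_measurable M" "test \<psi>"
  shows "(average M a q \<psi> has_derivative
           (\<lambda>h. \<Sum>i\<in>UNIV. h $ i * average M a q (partial_deriv i \<psi>) x)) (at x)"
proof -
  note int = average_integrable[OF assms(1,2)]
  have intp: "integrable M (\<lambda>w. a w * partial_deriv i \<psi> (x + q w))" for i x
    by (intro int test_function_partial assms)
  let ?D = "\<lambda>h. \<Sum>i\<in>UNIV. h $ i * average M a q (partial_deriv i \<psi>) x"
  let ?A = "LINT w|M. \<bar>a w\<bar>"
  show ?thesis unfolding has_derivative_at_alt
  proof (intro conjI allI impI)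
    show "bounded_linear ?D"
      by (intro bounded_linear_sum bounded_linear_mult_left[THEN bounded_linear_compose] bounded_linear_vec_nth)
    fix e :: real assume e: "e > 0"
    have A: "?A \<ge> 0" by simp
    define e' where "e' = e / (?A + 1)"
    have e': "e' > 0" "?A * e' \<le> e" unfolding e'_def
    proof -
      show "e / (?A + 1) > 0" using e A by (intro divide_pos_pos) linarith+
      have "?A * (e / (?A + 1)) = e * (?A / (?A + 1))" by simp
      also have "\<dots> \<le> e * 1" using e A by (intro mult_left_mono) (simp_all only: divide_le_eq_1, linarith+)
      finally show "?A * (e / (?A + 1)) \<le> e" by simp
    qed
    obtain d where d: "d > 0" "\<And>x h. norm h < d \<Longrightarrow>
       \<bar>\<psi> (x + h) - \<psi> x - (\<Sum>i\<in>UNIV. h $ i * partial_deriv i \<psi> x)\<bar> \<le> e' * norm h"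
      using test_uniformly_differentiable[OF assms(3) e'(1)] by blast
    show "\<exists>d>0. \<forall>y. norm (y - x) < d \<longrightarrow>
       norm (average M a q \<psi> y - average M a q \<psi> x - ?D (y - x)) \<le> e * norm (y - x)"
    proof (intro exI[of _ d] conjI allI impI d(1))
      fix y assume y: "norm (y - x) < d"
      let ?h = "y - x"
      let ?R = "\<lambda>w. \<psi> (x + q w + ?h) - \<psi> (x + q w) - (\<Sum>i\<in>UNIV. ?h $ i * partial_deriv i \<psi> (x + q w))"
      have eq: "a w * ?R w = a w * \<psi> (y + q w) - a w * \<psi> (x + q w)
          - (\<Sum>i\<in>UNIV. ?h $ i * (a w * partial_deriv i \<psi> (x + q w)))" for w
        by (simp add: algebra_simps sum_distrib_left sum_subtractf)
      have "average M a q \<psi> y - average M a q \<psi> x - ?D ?h = (LINT w|M. a w * ?R w)"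
        unfolding eq average_def
        by (subst Bochner_Integration.integral_diff,
            (intro Bochner_Integration.integrable_diff int assms Bochner_Integration.integrable_sum integrable_mult_right intp)+)
          (simp add: int assms intp)
      also have "norm \<dots> \<le> (LINT w|M. \<bar>a w\<bar> * (e' * norm ?h))"
      proof (rule norm_integral_le_integral)
        show "integrable M (\<lambda>w. a w * ?R w)" unfolding eq
          by (intro Bochner_Integration.integrable_diff int assms Bochner_Integration.integrable_sum integrable_mult_right intp)
        show "integrable M (\<lambda>w. \<bar>a w\<bar> * (e' * norm ?h))" using assms(1) by simp
        fix w show "norm (a w * ?R w) \<le> \<bar>a w\<bar> * (e' * norm ?h)"
          unfolding real_norm_def abs_mult using d(2)[OF y, of "x + q w"] by (intro mult_left_mono) auto
      qed
      also have "\<dots> = ?A * e' * norm ?h" by simp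
      also have "\<dots> \<le> e * norm ?h" by (intro mult_right_mono e') auto
      finally show "norm (average M a q \<psi> y - average M a q \<psi> x - ?D ?h) \<le> e * norm ?h" .
    qed
  qed
qed

lemma average_partial:
  assumes "integrable M a" "q \<in> borel_measurable M" "test \<psi>"
  shows "partial_deriv i (average M a q \<psi>) = average M a q (partial_deriv i \<psi>)"
proof
  fix x
  show "partial_deriv i (average M a q \<psi>) x = average M a q (partial_deriv i \<psi>) x"
    using partial_deriv_eq_frechet[OF average_has_derivative[OF assms], of i x]
    by (simp add: axis_def if_distrib[of "\<lambda>x. x * _"] sum.delta cong: if_cong)
qed

lemma average_smooth:
  assumes "integrable M a" "q \<in> borel_measurable M" "test \<psi>"
  shows "smooth (average M a q \<psi>)"
proof (rule smooth_coinduct[of "\<lambda>f. \<exists>\<psi>. test \<psi> \<and> f = average M a q \<psi>"])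
  show "f differentiable_on UNIV" if "\<exists>\<psi>. test \<psi> \<and> f = average M a q \<psi>" for f
    using that average_has_derivative[OF assms(1,2)] by (auto simp: differentiable_on_def differentiable_def)
qed (use assms in \<open>auto simp: average_partial intro: test_function_partial\<close>)

lemma average_list_deriv:
  assumes "integrable M a" "q \<in> borel_measurable M" "test \<psi>"
  shows "list_deriv l (average M a q \<psi>) = average M a q (list_deriv l \<psi>)"
  by (induction l) (simp_all add: average_partial[OF assms(1,2)] assms(3) test_function_list_deriv)

text \<open>If \<open>\<psi>\<close> is supported in \<open>K\<close> and all shifts that count are in \<open>Q\<close>, then the average is supported in
  the compact set \<open>K - Q\<close>.\<close>

lemma average_test_function:
  assumes "integrable M a" "q \<in> borel_measurable M" "smooth \<psi>"
    and K: "compact K" "\<And>x. x \<notin> K \<Longrightarrow> \<psi> x = 0" and Q: "compact Q" "\<And>w. w \<in> space M \<Longrightarrow> a w \<noteq> 0 \<Longrightarrow> q w \<in> Q"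
    and sub: "\<And>x y. x \<in> K \<Longrightarrow> y \<in> Q \<Longrightarrow> x - y \<in> \<Omega>"
  shows "test_function \<Omega> (average M a q \<psi>)"
proof -
  have t: "test \<psi>" using K assms(3) by (auto simp: test_function_def)
  have eq: "{x - y |x y. x \<in> K \<and> y \<in> Q} = (\<lambda>p. fst p - snd p) ` (K \<times> Q)" by force
  have "compact {x - y |x y. x \<in> K \<and> y \<in> Q}"
    unfolding eq by (intro compact_continuous_image compact_Times K Q continuous_intros)
  moreover have "average M a q \<psi> x = 0" if x: "x \<notin> {x - y |x y. x \<in> K \<and> y \<in> Q}" for x
  proof -
    have "a w * \<psi> (x + q w) = 0" if "w \<in> space M" for w
    proof (rule ccontr)
      assume "a w * \<psi> (x + q w) \<noteq> 0"
      then have "q w \<in> Q" "x + q w \<in> K" using Q(2)[OF that] K(2)[of "x + q w"] by auto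
      then show False using x by (metis (mono_tags, lifting) add_diff_cancel_right' mem_Collect_eq)
    qed
    then show ?thesis unfolding average_def by (subst Bochner_Integration.integral_cong[OF refl, of _ _ "\<lambda>_. 0"]) auto
  qed
  ultimately show ?thesis
    unfolding test_function_def using average_smooth[OF assms(1,2) t] sub by blast
qed

text \<open>Near the origin the integral of \<open>\<phi> (x + w)\<close> over a large ball of \<open>w\<close> is constant in \<open>x\<close>, by translation
  invariance. Its derivative at \<open>0\<close> is the integral of the derivative.\<close>

lemma test_integral_partial_zero:
  assumes "test \<phi>" shows "(LINT x|lborel. partial_deriv i \<phi> x) = 0"
proof -
  obtain K where K: "compact K" "\<And>x. x \<notin> K \<Longrightarrow> \<phi> x = 0" using testD(2)[OF assms] by auto
  obtain R where R: "R > 0" "K \<subseteq> ball 0 R" using compact_imp_bounded[OF K(1)]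
    by (metis bounded_subset_ballD)
  let ?a = "indicator (ball 0 (R + 1)) :: real^'a \<Rightarrow> real"
  have ia: "integrable lborel ?a" by (intro integrable_real_indicator emeasure_bounded_finite) auto
  note [measurable] = smooth_borel[OF testD(1)[OF assms]]
  let ?c = "LINT x|lborel. \<phi> x"
  let ?G = "average lborel ?a (\<lambda>x. x) \<phi>"
  have G: "?G x = ?c" if "x \<in> ball 0 1" for x
  proof -
    have "?a w * \<phi> (x + w) = \<phi> (x + 1 *\<^sub>R w)" for w
    proof (cases "w \<in> ball 0 (R + 1)")
      case False
      have "x + w \<notin> K"
      proof
        assume "x + w \<in> K"
        then have "norm (x + w) < R" using R by auto
        moreover have "norm w \<le> norm (x + w) + norm x" by (metis add_diff_cancel_left' norm_triangle_ineq4 add.commute)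
        ultimately show False using that False by auto
      qed
      then show ?thesis using K(2) by simp
    qed simp
    then have "?G x = (LINT w|lborel. \<phi> (x + 1 *\<^sub>R w))"
      unfolding average_def by (intro Bochner_Integration.integral_cong) auto
    then show ?thesis using lborel_integral_isometry(1)[of \<phi> 1 x] by simp
  qed
  have "(?G has_derivative (\<lambda>h. 0)) (at 0)"
    by (rule has_derivative_transform_within_open[of "\<lambda>x. ?c" _ _ _ "ball 0 1"]) (use G in auto)
  then have "partial_deriv i ?G 0 = 0" by (rule partial_deriv_eq_frechet)
  then have "average lborel ?a (\<lambda>x. x) (partial_deriv i \<phi>) 0 = 0"
    by (subst (asm) average_partial) (use ia assms in auto)
  moreover have "?a w * partial_deriv i \<phi> (0 + w) = partial_deriv i \<phi> w" for w
  proof (cases "w \<in> ball 0 (R + 1)")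
    case False
    then have "w \<notin> K" using R by auto
    then show ?thesis using list_deriv_zero_off_closed[OF compact_imp_closed[OF K(1)], of \<phi> w "[i]"] K(2) by simp
  qed simp
  then have "average lborel ?a (\<lambda>x. x) (partial_deriv i \<phi>) 0 = (LINT w|lborel. partial_deriv i \<phi> w)"
    unfolding average_def by (intro Bochner_Integration.integral_cong) auto
  ultimately show ?thesis by simp
qed

lemma test_function_mult:
  assumes "test_function \<Omega> \<phi>" "smooth g" shows "test_function \<Omega> (\<lambda>x. g x * \<phi> x)"
  using assms unfolding test_function_def by (metis mult_zero_right smooth_mult)

lemma integration_by_parts_partial:
  assumes "smooth g" "test \<phi>"
  shows "(LINT x|lborel. g x * partial_deriv i \<phi> x) = - (LINT x|lborel. partial_deriv i g x * \<phi> x)"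
proof -
  have "(LINT x|lborel. partial_deriv i (\<lambda>x. g x * \<phi> x) x) = 0"
    by (intro test_integral_partial_zero test_function_mult assms)
  also have "partial_deriv i (\<lambda>x. g x * \<phi> x) = (\<lambda>x. partial_deriv i g x * \<phi> x + g x * partial_deriv i \<phi> x)"
    using assms testD(1)[OF assms(2)] by (intro partial_deriv_mult smooth_diffble)
  also have "(LINT x|lborel. \<dots> x) = (LINT x|lborel. partial_deriv i g x * \<phi> x) + (LINT x|lborel. g x * partial_deriv i \<phi> x)"
    using assms by (intro Bochner_Integration.integral_add test_integrable test_function_mult
       test_function_partial smooth_partial)
  finally show ?thesis by simp
qed

lemma integration_by_parts:
  assumes "smooth g" "test \<phi>"
  shows "(LINT x|lborel. g x * list_deriv l \<phi> x) = (-1) ^ length l * (LINT x|lborel. list_deriv l g x * \<phi> x)"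
  using assms(1)
proof (induction l arbitrary: g)
  case (Cons i l)
  have "(LINT x|lborel. g x * list_deriv (i # l) \<phi> x) = - (LINT x|lborel. partial_deriv i g x * list_deriv l \<phi> x)"
    using integration_by_parts_partial[OF Cons.prems test_function_list_deriv[OF assms(2)]] by simp
  also have "\<dots> = - ((-1) ^ length l * (LINT x|lborel. list_deriv l (partial_deriv i g) x * \<phi> x))"
    by (subst Cons.IH) (simp_all add: smooth_partial Cons.prems)
  finally show ?case using Cons.prems by (simp add: list_deriv_partial_commute)
qed simp

text \<open>A bump is positive on an open ball, so its integral is positive and it can be normalized.\<close>

lemma mollifier_exists:
  assumes "r > 0"
  obtains \<phi> :: "real^'n::finite \<Rightarrow> real" where "smooth \<phi>" "\<And>x. \<phi> x \<ge> 0" "\<And>x. x \<notin> cball a r \<Longrightarrow> \<phi> x = 0"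
    "(LINT x|lborel. \<phi> x) = 1"
proof -
  let ?b = "bump a r"
  have tb: "test ?b" unfolding test_function_def using smooth_bump bump_zero[OF assms, of _ a]
    by (metis compact_cball subset_UNIV)
  let ?I = "LINT x|lborel. ?b x"
  have "?I > 0"
  proof (rule ccontr)
    assume "\<not> ?I > 0"
    moreover have "?I \<ge> 0" using bump_nonneg by (intro integral_nonneg_AE) auto
    ultimately have "?I = 0" by simp
    then have "AE x in lborel. ?b x = 0"
      using integral_nonneg_eq_0_iff_AE[OF test_integrable[OF tb]] bump_nonneg by auto
    then have "AE x in lborel. x \<notin> ball a r"
    proof (rule eventually_mono)
      fix x assume "?b x = 0" then show "x \<notin> ball a r" using bump_pos_iff[OF assms, of a x] by (simp add: dist_commute)
    qed
    then have "ball a r \<in> null_sets lborel" by (subst AE_iff_null_sets) auto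
    then have "negligible (ball a r)" by (simp add: negligible_iff_null_sets null_sets_completionI)
    then show False using open_not_negligible[of "ball a r"] assms by simp
  qed
  then show ?thesis
    using that[of "\<lambda>x. (1 / ?I) * ?b x"] smooth_cmult[OF smooth_bump, of "1 / ?I" a r] bump_nonneg[of a r] bump_zero[OF assms, of _ a]
    by simp
qed

lemma prob_space_density_lborel:
  assumes "smooth \<phi>" "\<And>x. \<phi> x \<ge> 0" "(LINT x|lborel. \<phi> x) = 1"
  shows "prob_space (density lborel (\<lambda>x. ennreal (\<phi> x)))"
proof
  note [measurable] = smooth_borel[OF assms(1)]
  have "integrable lborel \<phi>" using assms(3) not_integrable_integral_eq by fastforce
  then have "(\<integral>\<^sup>+x. ennreal (\<phi> x) \<partial>lborel) = 1" using assms by (subst nn_integral_eq_integral) auto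
  then show "emeasure (density lborel (\<lambda>x. ennreal (\<phi> x))) (space (density lborel (\<lambda>x. ennreal (\<phi> x)))) = 1"
    by (simp add: emeasure_density)
qed

text \<open>Mollify the indicator of the ball of radius \<open>2 r\<close> with a kernel of radius \<open>r\<close>: from inside \<open>ball a r\<close> the kernel
  sees only ones, from outside \<open>cball a (3 * r)\<close> only zeros.\<close>

lemma plateau_cutoff_exists:
  assumes "r > 0"
  obtains \<eta> :: "real^'n::finite \<Rightarrow> real" where "smooth \<eta>" "\<And>x. x \<in> ball a r \<Longrightarrow> \<eta> x = 1" "\<And>x. x \<notin> cball a (3 * r) \<Longrightarrow> \<eta> x = 0"
proof -
  obtain \<phi> :: "real^'n \<Rightarrow> real" where \<phi>: "smooth \<phi>" "\<And>x. \<phi> x \<ge> 0" "\<And>x. x \<notin> cball 0 r \<Longrightarrow> \<phi> x = 0"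
    "(LINT x|lborel. \<phi> x) = 1" using mollifier_exists[OF assms] by metis
  have t: "test \<phi>" unfolding test_function_def using \<phi> by (metis compact_cball subset_UNIV)
  let ?I = "indicator (ball a (2 * r)) :: real^'n \<Rightarrow> real"
  let ?\<eta> = "average lborel ?I (\<lambda>y. - y) \<phi>"
  have ia: "integrable lborel ?I" by (intro integrable_real_indicator emeasure_bounded_finite) auto
  note [measurable] = smooth_borel[OF \<phi>(1)]
  show ?thesis
  proof (rule that)
    show "smooth ?\<eta>" by (rule average_smooth[OF ia _ t]) measurable
    fix x assume x: "x \<in> ball a r"
    have "?I w * \<phi> (x + - w) = \<phi> (x + (-1) *\<^sub>R w)" for w
    proof (cases "w \<in> ball a (2 * r)")
      case False
      then have "dist a w \<ge> 2 * r" by simp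
      moreover have "dist a w \<le> dist a x + dist x w" by (rule dist_triangle)
      ultimately have "dist x w > r" using x by simp
      then show ?thesis using \<phi>(3)[of "x - w"] by (simp add: dist_norm norm_minus_commute)
    qed simp
    then have "?\<eta> x = (LINT w|lborel. \<phi> (x + (-1) *\<^sub>R w))"
      unfolding average_def by (intro Bochner_Integration.integral_cong) auto
    then show "?\<eta> x = 1" using lborel_integral_isometry(1)[of \<phi> "-1" x] \<phi>(1,4) smooth_borel by metis
  next
    fix x assume x: "x \<notin> cball a (3 * r)"
    have "?I w * \<phi> (x + - w) = 0" for w
    proof (cases "w \<in> ball a (2 * r)")
      case True
      then have "dist a w < 2 * r" by simp
      moreover have "dist a x \<le> dist a w + dist w x" by (rule dist_triangle)
      ultimately have "dist w x > r" using x by simp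
      then show ?thesis using \<phi>(3)[of "x - w"] by (simp add: dist_norm norm_minus_commute)
    qed simp
    then show "?\<eta> x = 0" unfolding average_def
      by (subst Bochner_Integration.integral_cong[OF refl, of _ _ "\<lambda>_. 0"]) auto
  qed
qed

section \<open>Averages of translates in \<open>L\<^sup>p\<close>\<close>

text \<open>The power \<open>p\<close> of the norm, as an extended real number, so that estimates need no integrability.\<close>

abbreviation Lp_mass :: "real \<Rightarrow> ('a::euclidean_space \<Rightarrow> real) \<Rightarrow> ennreal" where
  "Lp_mass P f \<equiv> (\<integral>\<^sup>+x. ennreal (\<bar>f x\<bar> powr P) \<partial>lborel)"

abbreviation Lp_mass_on :: "'a::euclidean_space set \<Rightarrow> real \<Rightarrow> ('a \<Rightarrow> real) \<Rightarrow> ennreal" where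
  "Lp_mass_on \<Omega> P f \<equiv> (\<integral>\<^sup>+x. ennreal (indicator \<Omega> x * \<bar>f x\<bar> powr P) \<partial>lborel)"

abbreviation L1_mass :: "('a::euclidean_space \<Rightarrow> real) \<Rightarrow> ennreal" where
  "L1_mass f \<equiv> (\<integral>\<^sup>+x. ennreal \<bar>f x\<bar> \<partial>lborel)"

lemma powr_above_tangent:
  fixes s t P :: real
  assumes "P \<ge> 1" "s > 0" "t \<ge> 0"
  shows "s powr P + P * s powr (P - 1) * (t - s) \<le> t powr P"
proof (cases "t = 0")
  case True
  have "s powr P = s powr (P - 1) * s" using assms by (simp add: powr_diff)
  then have "s powr P + P * s powr (P - 1) * (t - s) = (1 - P) * s powr P"
    using True by (simp add: algebra_simps)
  also have "\<dots> \<le> 0" using assms by (simp add: mult_nonpos_nonneg)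
  finally show ?thesis using True by simp
next
  case False
  have "(P * s powr (P - 1)) * (t - s) \<le> t powr P - s powr P"
  proof (rule convex_on_imp_above_tangent[OF powr_convex[OF assms(1)]])
    show "((\<lambda>x. x powr P) has_real_derivative P * s powr (P - 1)) (at s within {0<..})"
      using assms by (auto intro!: derivative_eq_intros has_field_derivative_powr)
    show "connected {0::real<..}" by (rule connected_Ioi)
  qed (use assms False in \<open>auto simp: interior_open\<close>)
  then show ?thesis by simp
qed

lemma powr_add_le:
  fixes a b P :: real
  assumes "P \<ge> 1"
  shows "\<bar>a + b\<bar> powr P \<le> 2 powr P * (\<bar>a\<bar> powr P + \<bar>b\<bar> powr P)"
proof -
  have "\<bar>a + b\<bar> powr P \<le> (2 * max \<bar>a\<bar> \<bar>b\<bar>) powr P"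
    using assms by (intro powr_mono2) auto
  also have "\<dots> = 2 powr P * (max \<bar>a\<bar> \<bar>b\<bar>) powr P" by (simp add: powr_mult)
  also have "(max \<bar>a\<bar> \<bar>b\<bar>) powr P \<le> \<bar>a\<bar> powr P + \<bar>b\<bar> powr P" by (simp add: max_def)
  finally show ?thesis by simp
qed

lemma le_one_plus_powr:
  fixes t P :: real
  assumes "P \<ge> 1" "t \<ge> 0" shows "t \<le> 1 + t powr P"
proof (cases "t \<le> 1")
  case False
  then have "t powr 1 \<le> t powr P" using assms by (intro powr_mono) auto
  then show ?thesis using False by simp
next
  case True then show ?thesis using powr_ge_zero[of t P] by linarith
qed

text \<open>Integrate the tangent at the mean value.\<close>

lemma (in prob_space) jensen_powr:
  fixes f :: "'a \<Rightarrow> real"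
  assumes "P \<ge> 1" "integrable M f" "\<And>x. x \<in> space M \<Longrightarrow> f x \<ge> 0" "integrable M (\<lambda>x. f x powr P)"
  shows "(LINT x|M. f x) powr P \<le> (LINT x|M. f x powr P)"
proof (cases "(LINT x|M. f x) = 0")
  case True
  then show ?thesis using assms by (simp add: integral_nonneg_AE)
next
  case False
  let ?s = "LINT x|M. f x"
  have "?s \<ge> 0" using assms(3) by (intro integral_nonneg_AE AE_I2) auto
  then have s: "?s > 0" using False by simp
  have "?s powr P = (LINT x|M. ?s powr P + P * ?s powr (P - 1) * (f x - ?s))"
    using assms(2) by (simp add: prob_space)
  also have "\<dots> \<le> (LINT x|M. f x powr P)"
    using assms s by (intro integral_mono powr_above_tangent) auto
  finally show ?thesis .
qed

text \<open>If \<open>f\<close> is not integrable, then its integral is \<open>0\<close> by convention. If the right-hand side is finite, then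
  \<open>\<bar>f\<bar> \<le> 1 + \<bar>f\<bar> powr P\<close> makes \<open>f\<close> integrable.\<close>

lemma (in prob_space) jensen_powr_nn:
  fixes f :: "'a \<Rightarrow> real"
  assumes P: "P \<ge> 1" and [measurable]: "f \<in> borel_measurable M"
  shows "ennreal (\<bar>LINT x|M. f x\<bar> powr P) \<le> (\<integral>\<^sup>+x. ennreal (\<bar>f x\<bar> powr P) \<partial>M)"
proof (cases "integrable M f \<and> (\<integral>\<^sup>+x. ennreal (\<bar>f x\<bar> powr P) \<partial>M) < \<infinity>")
  case True
  then have int: "integrable M (\<lambda>x. \<bar>f x\<bar> powr P)"
    by (intro integrableI_bounded) auto
  have "\<bar>LINT x|M. f x\<bar> powr P \<le> (LINT x|M. \<bar>f x\<bar>) powr P"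
    using P integral_norm_bound[of M f] by (intro powr_mono2) auto
  also have "\<dots> \<le> (LINT x|M. \<bar>f x\<bar> powr P)"
    using True int by (intro jensen_powr P) auto
  finally show ?thesis using int
    by (subst nn_integral_eq_integral) (auto intro: ennreal_leI)
next
  case False
  show ?thesis
  proof (cases "integrable M f")
    case True
    with False have "(\<integral>\<^sup>+x. ennreal (\<bar>f x\<bar> powr P) \<partial>M) = \<infinity>" by (simp add: not_less top_unique)
    then show ?thesis by simp
  next
    case False
    then show ?thesis by (simp add: not_integrable_integral_eq)
  qed
qed

lemma jensen_lborel:
  fixes F :: "'a::euclidean_space \<Rightarrow> 'w \<Rightarrow> real"
  assumes "prob_space M" "P \<ge> 1" and [measurable]: "case_prod F \<in> borel_measurable (lborel \<Otimes>\<^sub>M M)"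
  shows "Lp_mass P (\<lambda>x. LINT w|M. F x w)
      \<le> (\<integral>\<^sup>+w. \<integral>\<^sup>+x. ennreal (\<bar>F x w\<bar> powr P) \<partial>lborel \<partial>M)"
proof -
  interpret prob_space M by fact
  interpret pair_sigma_finite lborel M ..
  have "Lp_mass P (\<lambda>x. LINT w|M. F x w)
      \<le> (\<integral>\<^sup>+x. \<integral>\<^sup>+w. ennreal (\<bar>F x w\<bar> powr P) \<partial>M \<partial>lborel)"
    by (intro nn_integral_mono jensen_powr_nn assms) measurable
  also have "\<dots> = (\<integral>\<^sup>+w. \<integral>\<^sup>+x. ennreal (\<bar>F x w\<bar> powr P) \<partial>lborel \<partial>M)"
    by (rule Fubini'[symmetric]) measurable
  finally show ?thesis .
qed

lemma average_borel_measurable [measurable]: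
  fixes q :: "'w \<Rightarrow> real^'n::finite" and v \<psi> :: "real^'n \<Rightarrow> real"
  assumes "prob_space M" and [measurable]: "a \<in> borel_measurable M" "q \<in> borel_measurable M" "v \<in> borel_measurable borel"
  shows "average M a q v \<in> borel_measurable borel"
proof -
  interpret prob_space M by fact
  have "(\<lambda>x. LINT w|M. a w * v (x + q w)) \<in> borel_measurable borel"
    by (rule borel_measurable_lebesgue_integral) measurable
  then show ?thesis by (simp add: average_def[abs_def])
qed

text \<open>Averages of translates are bounded on \<open>L\<^sup>p\<close>, since each translate has the same norm.\<close>

lemma average_powr_nn_integral_le:
  fixes q :: "'w \<Rightarrow> real^'n::finite" and v \<psi> :: "real^'n \<Rightarrow> real"
  assumes M: "prob_space M" and P: "P \<ge> 1"
    and [measurable]: "a \<in> borel_measurable M" "q \<in> borel_measurable M" "v \<in> borel_measurable borel"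
    and a: "\<And>w. w \<in> space M \<Longrightarrow> \<bar>a w\<bar> \<le> C"
  shows "Lp_mass P (\<lambda>x. average M a q v x) \<le> ennreal (C powr P) * Lp_mass P v"
proof -
  interpret prob_space M by fact
  have "Lp_mass P (\<lambda>x. average M a q v x)
     \<le> (\<integral>\<^sup>+w. \<integral>\<^sup>+x. ennreal (\<bar>a w * v (x + q w)\<bar> powr P) \<partial>lborel \<partial>M)"
    unfolding average_def by (rule jensen_lborel[OF M P]) measurable
  also have "\<dots> \<le> (\<integral>\<^sup>+w. ennreal (C powr P) * Lp_mass P v \<partial>M)"
  proof (rule nn_integral_mono)
    fix w assume w: "w \<in> space M"
    have "Lp_mass P (\<lambda>x. a w * v (x + q w))
        = ennreal (\<bar>a w\<bar> powr P) * Lp_mass P (\<lambda>x. v (q w + 1 *\<^sub>R x))"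
      by (subst nn_integral_cmult[symmetric]) (auto simp: abs_mult powr_mult ennreal_mult add.commute)
    also have "Lp_mass P (\<lambda>x. v (q w + 1 *\<^sub>R x)) = Lp_mass P v"
      by (rule lborel_nn_integral_isometry) auto
    also have "ennreal (\<bar>a w\<bar> powr P) * \<dots> \<le> ennreal (C powr P) * \<dots>"
      using a[OF w] P by (intro mult_right_mono ennreal_leI powr_mono2) auto
    finally show "Lp_mass P (\<lambda>x. a w * v (x + q w)) \<le> ennreal (C powr P) * Lp_mass P v" .
  qed
  also have "\<dots> = ennreal (C powr P) * Lp_mass P v"
    by (simp add: emeasure_space_1)
  finally show ?thesis .
qed

lemma average_powr_integrable:
  fixes q :: "'w \<Rightarrow> real^'n::finite" and v \<psi> :: "real^'n \<Rightarrow> real"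
  assumes M: "prob_space M" and P: "P \<ge> 1"
    and m [measurable]: "a \<in> borel_measurable M" "q \<in> borel_measurable M" "v \<in> borel_measurable borel"
    and a: "\<And>w. w \<in> space M \<Longrightarrow> \<bar>a w\<bar> \<le> C"
    and int: "integrable lborel (\<lambda>x. \<bar>v x\<bar> powr P)"
  shows "integrable lborel (\<lambda>x. \<bar>average M a q v x\<bar> powr P)"
proof (rule integrableI_bounded)
  note [measurable] = average_borel_measurable[OF M m]
  show "(\<lambda>x. \<bar>average M a q v x\<bar> powr P) \<in> borel_measurable lborel" by measurable
  have "Lp_mass P v < \<infinity>"
    using int by (simp add: integrable_iff_bounded)
  then have "ennreal (C powr P) * Lp_mass P v < \<infinity>"
    by (simp add: ennreal_mult_less_top)
  then show "(\<integral>\<^sup>+x. ennreal (norm (\<bar>average M a q v x\<bar> powr P)) \<partial>lborel) < \<infinity>"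
    using average_powr_nn_integral_le[OF M P m a] by (simp add: order_le_less_trans)
qed

lemma integrable_translates:
  fixes q :: "'w \<Rightarrow> real^'n::finite" and v \<psi> :: "real^'n \<Rightarrow> real"
  assumes M: "prob_space M" and [measurable]: "a \<in> borel_measurable M" "q \<in> borel_measurable M"
    and a: "\<And>w. w \<in> space M \<Longrightarrow> \<bar>a w\<bar> \<le> C"
    and int: "integrable lborel v" and [measurable]: "v \<in> borel_measurable borel" "\<psi> \<in> borel_measurable borel"
    and \<psi>: "\<And>x. \<bar>\<psi> x\<bar> \<le> B"
  shows "integrable (lborel \<Otimes>\<^sub>M M) (\<lambda>(x, w). a w * v (x + q w) * \<psi> x)"
proof -
  interpret prob_space M by fact
  interpret pair_sigma_finite lborel M ..
  have v: "L1_mass v < \<infinity>" using int by (simp add: integrable_iff_bounded)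
  show ?thesis
  proof (rule integrableI_bounded)
    have "(\<integral>\<^sup>+z. ennreal (norm (case z of (x, w) \<Rightarrow> a w * v (x + q w) * \<psi> x)) \<partial>(lborel \<Otimes>\<^sub>M M))
       = (\<integral>\<^sup>+w. \<integral>\<^sup>+x. ennreal (norm (a w * v (x + q w) * \<psi> x)) \<partial>lborel \<partial>M)"
      by (subst nn_integral_snd[symmetric]) (auto simp: case_prod_unfold)
    also have "\<dots> \<le> (\<integral>\<^sup>+w. ennreal (C * B) * L1_mass v \<partial>M)"
    proof (rule nn_integral_mono)
      fix w assume w: "w \<in> space M"
      have CB: "C \<ge> 0" "B \<ge> 0" using a[OF w] \<psi>[of 0] by linarith+
      have "(\<integral>\<^sup>+x. ennreal (norm (a w * v (x + q w) * \<psi> x)) \<partial>lborel)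
          \<le> (\<integral>\<^sup>+x. ennreal (C * B) * ennreal \<bar>v (q w + 1 *\<^sub>R x)\<bar> \<partial>lborel)"
      proof (rule nn_integral_mono)
        fix x
        have "norm (a w * v (x + q w) * \<psi> x) = (\<bar>a w\<bar> * \<bar>\<psi> x\<bar>) * \<bar>v (x + q w)\<bar>"
          by (simp add: abs_mult)
        also have "\<dots> \<le> (C * B) * \<bar>v (x + q w)\<bar>"
          using a[OF w] \<psi>[of x] CB by (intro mult_right_mono mult_mono) auto
        finally show "ennreal (norm (a w * v (x + q w) * \<psi> x)) \<le> ennreal (C * B) * ennreal \<bar>v (q w + 1 *\<^sub>R x)\<bar>"
          using CB by (simp add: ennreal_mult[symmetric] add.commute)
      qed
      also have "\<dots> = ennreal (C * B) * L1_mass (\<lambda>x. v (q w + 1 *\<^sub>R x))"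
        by (rule nn_integral_cmult) auto
      also have "L1_mass (\<lambda>x. v (q w + 1 *\<^sub>R x)) = L1_mass v"
        by (rule lborel_nn_integral_isometry) auto
      finally show "(\<integral>\<^sup>+x. ennreal (norm (a w * v (x + q w) * \<psi> x)) \<partial>lborel) \<le> ennreal (C * B) * L1_mass v" .
    qed
    also have "\<dots> = ennreal (C * B) * L1_mass v" by (simp add: emeasure_space_1)
    also have "\<dots> < \<infinity>" using v by (simp add: ennreal_mult_less_top)
    finally show "(\<integral>\<^sup>+z. ennreal (norm (case z of (x, w) \<Rightarrow> a w * v (x + q w) * \<psi> x)) \<partial>(lborel \<Otimes>\<^sub>M M)) < \<infinity>" .
  qed measurable
qed

text \<open>Averaging over the opposite shifts is the transposed operation: by Fubini's theorem one may substitute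
  \<open>x - q w\<close> for \<open>x\<close> for each \<open>w\<close> separately.\<close>

lemma average_transpose:
  fixes q :: "'w \<Rightarrow> real^'n::finite" and v \<psi> :: "real^'n \<Rightarrow> real"
  assumes M: "prob_space M" and [measurable]: "a \<in> borel_measurable M" "q \<in> borel_measurable M"
    and a: "\<And>w. w \<in> space M \<Longrightarrow> \<bar>a w\<bar> \<le> C"
    and int: "integrable lborel v" and [measurable]: "v \<in> borel_measurable borel" "\<psi> \<in> borel_measurable borel"
    and \<psi>: "\<And>x. \<bar>\<psi> x\<bar> \<le> B"
  shows "(LINT x|lborel. v x * average M a q \<psi> x) = (LINT x|lborel. average M a (\<lambda>w. - q w) v x * \<psi> x)"
    and "integrable lborel (\<lambda>x. average M a (\<lambda>w. - q w) v x * \<psi> x)"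
proof -
  interpret prob_space M by fact
  interpret pair_sigma_finite lborel M ..
  have i1: "integrable (lborel \<Otimes>\<^sub>M M) (\<lambda>(x, w). a w * v (x + - q w) * \<psi> x)"
    by (rule integrable_translates[OF M _ _ a int _ _ \<psi>]) measurable
  have "integrable (lborel \<Otimes>\<^sub>M M) (\<lambda>(x, w). v x * (a w * \<psi> (x + q w)))"
  proof (rule integrableI_bounded)
    have "integrable (lborel \<Otimes>\<^sub>M M) (\<lambda>(x, w). (C * B) * v (x + 0) * 1)"
      by (rule integrable_translates[OF M, where a = "\<lambda>_. C * B" and C = "\<bar>C * B\<bar>" and q = "\<lambda>_. 0" and \<psi> = "\<lambda>_. 1" and B = 1])
        (use int in auto)
    then have fin: "(\<integral>\<^sup>+z. ennreal (norm (case z of (x, w) \<Rightarrow> (C * B) * v (x + 0) * 1)) \<partial>(lborel \<Otimes>\<^sub>M M)) < \<infinity>"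
      by (simp add: integrable_iff_bounded)
    have "(\<integral>\<^sup>+z. ennreal (norm (case z of (x, w) \<Rightarrow> v x * (a w * \<psi> (x + q w)))) \<partial>(lborel \<Otimes>\<^sub>M M))
      \<le> (\<integral>\<^sup>+z. ennreal (norm (case z of (x, w) \<Rightarrow> (C * B) * v (x + 0) * 1)) \<partial>(lborel \<Otimes>\<^sub>M M))"
    proof (rule nn_integral_mono, safe)
      fix x :: "real^'n" and w assume "(x, w) \<in> space (lborel \<Otimes>\<^sub>M M)"
      then have w: "w \<in> space M" by (simp add: space_pair_measure)
      have "\<bar>a w\<bar> * \<bar>\<psi> (x + q w)\<bar> \<le> \<bar>C\<bar> * \<bar>B\<bar>"
        using a[OF w] \<psi>[of "x + q w"] by (intro mult_mono) auto
      then have "\<bar>v x\<bar> * (\<bar>a w\<bar> * \<bar>\<psi> (x + q w)\<bar>) \<le> \<bar>v x\<bar> * (\<bar>C\<bar> * \<bar>B\<bar>)" by (intro mult_left_mono) auto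
      then show "ennreal (norm (v x * (a w * \<psi> (x + q w)))) \<le> ennreal (norm (C * B * v (x + 0) * 1))"
        by (intro ennreal_leI) (simp add: abs_mult mult_ac)
    qed
    then show "(\<integral>\<^sup>+z. ennreal (norm (case z of (x, w) \<Rightarrow> v x * (a w * \<psi> (x + q w)))) \<partial>(lborel \<Otimes>\<^sub>M M)) < \<infinity>"
      using fin by (rule order_le_less_trans)
  qed measurable
  note i2 = this
  have "(LINT x|lborel. v x * average M a q \<psi> x) = (LINT x|lborel. LINT w|M. v x * (a w * \<psi> (x + q w)))"
    by (simp add: average_def)
  also have "\<dots> = (LINT w|M. LINT x|lborel. v x * (a w * \<psi> (x + q w)))"
    by (rule Fubini_integral[OF i2, symmetric])
  also have "\<dots> = (LINT w|M. LINT x|lborel. a w * v (x + - q w) * \<psi> x)"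
  proof (rule Bochner_Integration.integral_cong[OF refl])
    fix w
    show "(LINT x|lborel. v x * (a w * \<psi> (x + q w))) = (LINT x|lborel. a w * v (x + - q w) * \<psi> x)"
      using lborel_integral_isometry(1)[of "\<lambda>x. a w * v (x + - q w) * \<psi> x" 1 "q w"]
      by (simp add: add.commute mult_ac)
  qed
  also have "\<dots> = (LINT x|lborel. LINT w|M. a w * v (x + - q w) * \<psi> x)"
    by (rule Fubini_integral[OF i1])
  also have "\<dots> = (LINT x|lborel. average M a (\<lambda>w. - q w) v x * \<psi> x)"
    by (simp add: average_def)
  finally show "(LINT x|lborel. v x * average M a q \<psi> x) = (LINT x|lborel. average M a (\<lambda>w. - q w) v x * \<psi> x)" .
  have "integrable lborel (\<lambda>x. LINT w|M. a w * v (x + - q w) * \<psi> x)"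
    using integrable_fst[OF i1] by simp
  then show "integrable lborel (\<lambda>x. average M a (\<lambda>w. - q w) v x * \<psi> x)" by (simp add: average_def)
qed

text \<open>By Jensen's inequality an average of translates is no further from the function than the worst of the
  translates.\<close>

lemma average_diff_powr_le:
  fixes q :: "'w \<Rightarrow> real^'n::finite" and v \<psi> :: "real^'n \<Rightarrow> real"
  assumes M: "prob_space M" and P: "P \<ge> 1"
    and [measurable]: "q \<in> borel_measurable M" "v \<in> borel_measurable borel"
    and int: "integrable lborel v"
    and T: "\<And>w. w \<in> space M \<Longrightarrow> Lp_mass P (\<lambda>x. v (x + q w) - v x) \<le> ennreal e"
  shows "Lp_mass P (\<lambda>x. average M (\<lambda>_. 1) q v x - v x) \<le> ennreal e"
proof -
  interpret prob_space M by fact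
  interpret pair_sigma_finite lborel M ..
  have "integrable (lborel \<Otimes>\<^sub>M M) (\<lambda>(x, w). 1 * v (x + q w) * 1)"
    by (rule integrable_translates[OF M, where C = 1 and B = 1]) (use int in auto)
  then have "AE x in lborel. integrable M (\<lambda>w. v (x + q w))" by (drule_tac AE_integrable_fst) simp
  then have "AE x in lborel. average M (\<lambda>_. 1) q v x - v x = (LINT w|M. v (x + q w) - v x)"
    by (rule eventually_mono) (simp add: average_def prob_space)
  then have "Lp_mass P (\<lambda>x. average M (\<lambda>_. 1) q v x - v x)
     = Lp_mass P (\<lambda>x. LINT w|M. v (x + q w) - v x)"
    by (intro nn_integral_cong_AE) auto
  also have "\<dots> \<le> (\<integral>\<^sup>+w. \<integral>\<^sup>+x. ennreal (\<bar>v (x + q w) - v x\<bar> powr P) \<partial>lborel \<partial>M)"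
    by (rule jensen_lborel[OF M P]) measurable
  also have "\<dots> \<le> (\<integral>\<^sup>+w. ennreal e \<partial>M)" by (intro nn_integral_mono T)
  also have "\<dots> = ennreal e" by (simp add: emeasure_space_1)
  finally show ?thesis .
qed

section \<open>Continuity of translation\<close>

lemma compact_open_sandwich:
  fixes A :: "'a::euclidean_space set"
  assumes [measurable]: "A \<in> sets borel" and fin: "emeasure lborel A < \<infinity>" and e: "e > 0"
  obtains K U where "compact K" "open U" "K \<subseteq> A" "A \<subseteq> U" "emeasure lborel (U - K) \<le> ennreal e"
proof -
  have e2: "e / 2 > 0" using e by simp
  obtain U where U: "open U" "A \<subseteq> U" "emeasure lborel (U - A) < ennreal (e / 2)"
    using outer_regular_lborel[OF assms(1) e2] by metis
  let ?M = "density lborel (indicator A)"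
  have M: "emeasure ?M B = emeasure lborel (A \<inter> B)" if "B \<in> sets borel" for B
    using that by (simp add: emeasure_density indicator_inter_arith[symmetric] Int_commute mult.commute)
  have "emeasure ?M A = (SUP K\<in>{K. K \<subseteq> A \<and> compact K}. emeasure ?M K)"
    by (rule inner_regular) (use fin M[of UNIV] in auto)
  then have SUP: "emeasure lborel A = (SUP K\<in>{K. K \<subseteq> A \<and> compact K}. emeasure ?M K)"
    using M[of A] by simp
  obtain K where K: "K \<subseteq> A" "compact K" "emeasure lborel A < emeasure ?M K + ennreal (e / 2)"
  proof (cases "emeasure lborel A = 0")
    case True
    then show ?thesis using e that[of "{}"] by simp
  next
    case False
    have "emeasure lborel A - ennreal (e / 2) < emeasure lborel A"
      using False fin e by (intro ennreal_between) (auto simp: zero_less_iff_neq_zero)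
    then have "\<exists>K\<in>{K. K \<subseteq> A \<and> compact K}. emeasure lborel A - ennreal (e / 2) < emeasure ?M K"
      by (subst (asm) (2) SUP) (simp add: less_SUP_iff)
    then obtain K where K: "K \<subseteq> A" "compact K" "emeasure lborel A - ennreal (e / 2) < emeasure ?M K" by auto
    have "emeasure lborel A \<le> ennreal (e / 2) + (emeasure lborel A - ennreal (e / 2))"
      using ennreal_minus_le_iff[THEN iffD1, OF order_refl] by blast
    also have "\<dots> < ennreal (e / 2) + emeasure ?M K" using K(3) by (simp add: ennreal_add_left_cancel_less)
    finally show ?thesis using that K by (simp add: add.commute)
  qed
  have Kb [measurable]: "K \<in> sets borel" "U \<in> sets borel" using K U by (auto intro: borel_compact)
  have MK: "emeasure ?M K = emeasure lborel K" using M[of K] Kb K(1) by (simp add: Int_absorb1)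
  have finK: "emeasure lborel K \<noteq> \<infinity>" using emeasure_mono[OF K(1), of lborel] fin by auto
  have "emeasure lborel (A - K) = emeasure lborel A - emeasure lborel K"
    using finK K by (intro emeasure_Diff) auto
  also have "\<dots> \<le> ennreal (e / 2)" using K(3) MK fin finK by (simp add: ennreal_minus_le_iff add.commute less_imp_le)
  finally have AK: "emeasure lborel (A - K) \<le> ennreal (e / 2)" .
  have "U - K = (U - A) \<union> (A - K)" using K U by auto
  then have "emeasure lborel (U - K) \<le> emeasure lborel (U - A) + emeasure lborel (A - K)"
    by (metis emeasure_subadditive Kb assms(1) sets.Diff sets_lborel)
  also have "\<dots> \<le> ennreal (e / 2) + ennreal (e / 2)" using U(3) AK by (intro add_mono) auto
  also have "\<dots> = ennreal e" using e by (simp add: ennreal_plus[symmetric] del: ennreal_plus)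
  finally show ?thesis using that K U by blast
qed

text \<open>Enclose \<open>A\<close> between a compact set \<open>K\<close> and an open set \<open>U\<close> of almost the same measure. If \<open>h\<close> is shorter than the
  distance from \<open>K\<close> to the complement of \<open>U\<close>, then membership in \<open>A\<close> can differ at \<open>x\<close> and \<open>x + h\<close> only if one of
  them is in \<open>U - K\<close>.\<close>

lemma translation_continuous_indicator:
  fixes A :: "'a::euclidean_space set"
  assumes [measurable]: "A \<in> sets borel" and fin: "emeasure lborel A < \<infinity>" and e: "e > 0"
  shows "\<exists>\<rho>>0. \<forall>h. norm h \<le> \<rho> \<longrightarrow> L1_mass (\<lambda>x. indicator A (x + h) - indicator A x) \<le> ennreal e"
proof -
  have e2: "e / 2 > 0" using e by simp
  obtain K U where KU: "compact K" "open U" "K \<subseteq> A" "A \<subseteq> U" "emeasure lborel (U - K) \<le> ennreal (e / 2)"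
    using compact_open_sandwich[OF assms(1) fin e2] by metis
  have [measurable]: "K \<in> sets borel" "U \<in> sets borel" using KU by (auto intro: borel_compact)
  obtain \<rho> where \<rho>: "\<rho> > 0" "\<And>x y. x \<in> K \<Longrightarrow> y \<in> - U \<Longrightarrow> \<rho> \<le> dist x y"
  proof -
    have "closed (- U)" "K \<inter> - U = {}" using KU by auto
    from separate_compact_closed[OF KU(1) this] show ?thesis using that by blast
  qed
  have "L1_mass (\<lambda>x. indicator A (x + h) - indicator A x) \<le> ennreal e" if h: "norm h < \<rho>" for h
  proof -
    have "L1_mass (\<lambda>x. indicator A (x + h) - indicator A x)
       \<le> (\<integral>\<^sup>+x. indicator (U - K) (h + 1 *\<^sub>R x) + indicator (U - K) x \<partial>lborel)"
    proof (rule nn_integral_mono)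
      fix x
      have 1: "x + h \<in> U" if "x \<in> K"
      proof (rule ccontr)
        assume "x + h \<notin> U" then show False using \<rho>(2)[OF that, of "x + h"] h by (simp add: dist_norm)
      qed
      have 2: "x \<in> U" if "x + h \<in> K"
      proof (rule ccontr)
        assume "x \<notin> U" then show False using \<rho>(2)[OF that, of x] h by (simp add: dist_norm)
      qed
      from 1 2 show "ennreal \<bar>indicator A (x + h) - indicator A x\<bar> \<le> indicator (U - K) (h + 1 *\<^sub>R x) + indicator (U - K) x"
        using KU(3,4) by (auto simp: indicator_def add.commute)
    qed
    also have "\<dots> = emeasure lborel (U - K) + emeasure lborel (U - K)"
      using lborel_nn_integral_isometry[of "indicator (U - K)" 1 h] by (subst nn_integral_add) auto
    also have "\<dots> \<le> ennreal (e / 2) + ennreal (e / 2)" using KU(5) by (intro add_mono)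
    also have "\<dots> = ennreal e" using e by (simp add: ennreal_plus[symmetric] del: ennreal_plus)
    finally show ?thesis .
  qed
  then show ?thesis using \<rho>(1) by (intro exI[of _ "\<rho> / 2"]) auto
qed

lemma translation_continuous_L1:
  fixes f :: "'a::euclidean_space \<Rightarrow> real"
  assumes "integrable lborel f"
  shows "\<forall>e>0. \<exists>\<rho>>0. \<forall>h. norm h \<le> \<rho> \<longrightarrow> L1_mass (\<lambda>x. f (x + h) - f x) \<le> ennreal e"
  using assms
proof (induction rule: integrable_induct)
  case (base A c)
  have [measurable]: "A \<in> sets borel" using base by simp
  show ?case
  proof (intro allI impI)
    fix e :: real assume e: "e > 0"
    let ?e = "e / (\<bar>c\<bar> + 1)"
    have e': "?e > 0" using e by (intro divide_pos_pos) auto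
    from translation_continuous_indicator[OF _ base(2) this]
    obtain \<rho> where \<rho>: "\<rho> > 0" "\<And>h. norm h \<le> \<rho> \<Longrightarrow> L1_mass (\<lambda>x. indicator A (x + h) - indicator A x) \<le> ennreal ?e"
      by auto
    have "L1_mass (\<lambda>x. indicator A (x + h) *\<^sub>R c - indicator A x *\<^sub>R c) \<le> ennreal e" if h: "norm h \<le> \<rho>" for h
    proof -
      have "L1_mass (\<lambda>x. indicator A (x + h) *\<^sub>R c - indicator A x *\<^sub>R c)
          = (\<integral>\<^sup>+x. ennreal \<bar>c\<bar> * ennreal \<bar>indicator A (x + h) - indicator A x\<bar> \<partial>lborel)"
        by (intro nn_integral_cong) (auto simp: ennreal_mult[symmetric] abs_mult[symmetric] algebra_simps simp del: ennreal_mult)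
      also have "\<dots> = ennreal \<bar>c\<bar> * L1_mass (\<lambda>x. indicator A (x + h) - indicator A x)"
        by (rule nn_integral_cmult) measurable
      also have "\<dots> \<le> ennreal \<bar>c\<bar> * ennreal ?e" by (intro mult_left_mono \<rho> h) auto
      also have "\<dots> = ennreal (\<bar>c\<bar> * ?e)" by (rule ennreal_mult[symmetric]) (use e' in auto)
      also have "\<bar>c\<bar> * ?e \<le> e" using e by (simp add: field_simps)
      finally show ?thesis by (simp add: ennreal_leI)
    qed
    then show "\<exists>\<rho>>0. \<forall>h. norm h \<le> \<rho> \<longrightarrow> L1_mass (\<lambda>x. indicator A (x + h) *\<^sub>R c - indicator A x *\<^sub>R c) \<le> ennreal e"
      using \<rho>(1) by blast
  qed
next
  case (add f g)
  have [measurable]: "f \<in> borel_measurable borel" "g \<in> borel_measurable borel"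
    using add(1,2) by (auto dest: borel_measurable_integrable)
  show ?case
  proof (intro allI impI)
    fix e :: real assume e: "e > 0"
    then have "e / 2 > 0" by simp
    from add(3)[rule_format, OF this] obtain r where
      r: "r > 0" "\<And>h. norm h \<le> r \<Longrightarrow> L1_mass (\<lambda>x. f (x + h) - f x) \<le> ennreal (e / 2)" by blast
    from add(4)[rule_format, OF \<open>e / 2 > 0\<close>] obtain s where
      s: "s > 0" "\<And>h. norm h \<le> s \<Longrightarrow> L1_mass (\<lambda>x. g (x + h) - g x) \<le> ennreal (e / 2)" by blast
    have "L1_mass (\<lambda>x. f (x + h) + g (x + h) - (f x + g x)) \<le> ennreal e" if h: "norm h \<le> min r s" for h
    proof -
      have "L1_mass (\<lambda>x. f (x + h) + g (x + h) - (f x + g x))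
        \<le> (\<integral>\<^sup>+x. ennreal \<bar>f (x + h) - f x\<bar> + ennreal \<bar>g (x + h) - g x\<bar> \<partial>lborel)"
        by (intro nn_integral_mono) (auto simp: ennreal_plus[symmetric] simp del: ennreal_plus intro!: ennreal_leI)
      also have "\<dots> = L1_mass (\<lambda>x. f (x + h) - f x) + L1_mass (\<lambda>x. g (x + h) - g x)"
        by (rule nn_integral_add) measurable
      also have "\<dots> \<le> ennreal (e / 2) + ennreal (e / 2)" using h by (intro add_mono r s) auto
      also have "\<dots> = ennreal e" using e by (simp add: ennreal_plus[symmetric] del: ennreal_plus)
      finally show ?thesis .
    qed
    then show "\<exists>\<rho>>0. \<forall>h. norm h \<le> \<rho> \<longrightarrow> L1_mass (\<lambda>x. f (x + h) + g (x + h) - (f x + g x)) \<le> ennreal e"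
      using r(1) s(1) by (intro exI[of _ "min r s"]) auto
  qed
next
  case (lim f s)
  have [measurable]: "f \<in> borel_measurable borel" "\<And>i. s i \<in> borel_measurable borel"
    using lim by (auto dest: borel_measurable_integrable)
  show ?case
  proof (intro allI impI)
    fix e :: real assume e: "e > 0"
    have "(\<lambda>i. (\<integral>\<^sup>+x. norm (f x - s i x) \<partial>lborel)) \<longlonglongrightarrow> 0"
    proof (rule nn_integral_dominated_convergence_norm[where w = "\<lambda>x. 2 * norm (f x)"])
      have "integrable lborel (\<lambda>x. 2 * norm (f x))" using lim(4) by simp
      then show "(\<integral>\<^sup>+x. ennreal (2 * norm (f x)) \<partial>lborel) < \<infinity>"
        unfolding integrable_iff_bounded by simp
    qed (use lim in auto)
    then have "\<forall>\<^sub>F i in sequentially. (\<integral>\<^sup>+x. norm (f x - s i x) \<partial>lborel) < ennreal (e / 4)"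
      using e by (intro order_tendstoD) auto
    then obtain i where i: "(\<integral>\<^sup>+x. norm (f x - s i x) \<partial>lborel) \<le> ennreal (e / 4)"
      by (meson eventually_happens' less_imp_le sequentially_bot)
    have "e / 2 > 0" using e by simp
    from lim(5)[rule_format, OF this] obtain r where
      r: "r > 0" "\<And>h. norm h \<le> r \<Longrightarrow> L1_mass (\<lambda>x. s i (x + h) - s i x) \<le> ennreal (e / 2)" by blast
    have "L1_mass (\<lambda>x. f (x + h) - f x) \<le> ennreal e" if h: "norm h \<le> r" for h
    proof -
      have "L1_mass (\<lambda>x. f (x + h) - f x)
        \<le> (\<integral>\<^sup>+x. ennreal (norm (f (h + 1 *\<^sub>R x) - s i (h + 1 *\<^sub>R x))) + (ennreal \<bar>s i (x + h) - s i x\<bar> + ennreal (norm (f x - s i x))) \<partial>lborel)"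
        by (intro nn_integral_mono) (auto simp: ennreal_plus[symmetric] add.commute simp del: ennreal_plus intro!: ennreal_leI)
      also have "\<dots> = (\<integral>\<^sup>+x. ennreal (norm (f (h + 1 *\<^sub>R x) - s i (h + 1 *\<^sub>R x))) \<partial>lborel)
         + ((L1_mass (\<lambda>x. s i (x + h) - s i x)) + (\<integral>\<^sup>+x. norm (f x - s i x) \<partial>lborel))"
        by (simp add: nn_integral_add)
      also have "(\<integral>\<^sup>+x. ennreal (norm (f (h + 1 *\<^sub>R x) - s i (h + 1 *\<^sub>R x))) \<partial>lborel) = (\<integral>\<^sup>+x. norm (f x - s i x) \<partial>lborel)"
        by (rule lborel_nn_integral_isometry) auto
      also have "(\<integral>\<^sup>+x. norm (f x - s i x) \<partial>lborel) + ((L1_mass (\<lambda>x. s i (x + h) - s i x)) + (\<integral>\<^sup>+x. norm (f x - s i x) \<partial>lborel))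
        \<le> ennreal (e / 4) + (ennreal (e / 2) + ennreal (e / 4))" using h by (intro add_mono r i)
      also have "\<dots> = ennreal e" using e by (simp add: ennreal_plus[symmetric] del: ennreal_plus)
      finally show ?thesis .
    qed
    then show "\<exists>\<rho>>0. \<forall>h. norm h \<le> \<rho> \<longrightarrow> L1_mass (\<lambda>x. f (x + h) - f x) \<le> ennreal e"
      using r(1) by blast
  qed
qed

text \<open>Among functions with a common bound, closeness in \<open>L\<^sup>1\<close> implies closeness in \<open>L\<^sup>p\<close>. Truncation therefore
  reduces the claim to the continuity of translation in \<open>L\<^sup>1\<close>.\<close>

lemma translation_continuous_Lp:
  fixes v :: "'a::euclidean_space \<Rightarrow> real"
  assumes P: "P \<ge> 1" and v: "integrable lborel v" and vP: "integrable lborel (\<lambda>x. \<bar>v x\<bar> powr P)" and e: "e > 0"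
  shows "\<exists>\<rho>>0. \<forall>h. norm h \<le> \<rho> \<longrightarrow> Lp_mass P (\<lambda>x. v (x + h) - v x) \<le> ennreal e"
proof -
  have [measurable]: "v \<in> borel_measurable borel" using v by (auto dest: borel_measurable_integrable)
  define c where "c = (2::real) powr P"
  have c: "c \<ge> 1" using P by (simp add: c_def ge_one_powr_ge_zero)
  define s where "s m x = (if \<bar>v x\<bar> \<le> real m then v x else 0)" for m x
  have [measurable]: "s m \<in> borel_measurable borel" for m unfolding s_def[abs_def] by measurable
  (* powr_add_le is applied twice to the three differences below, which costs the factor c * c. The two
     truncation errors e1 and the translation error e2 of the truncated function, enlarged by the factor b
     from L1 to Lp, are chosen to add up to e. *)
  define e1 where "e1 = e / (4 * c * c)"
  have e1: "e1 > 0" using e c by (simp add: e1_def)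
  have "(\<lambda>m. (\<integral>\<^sup>+x. norm (0 - \<bar>v x - s m x\<bar> powr P) \<partial>lborel)) \<longlonglongrightarrow> 0"
  proof (rule nn_integral_dominated_convergence_norm[where w = "\<lambda>x. \<bar>v x\<bar> powr P"])
    show "Lp_mass P v < \<infinity>" using vP by (simp add: integrable_iff_bounded)
    show "AE x in lborel. norm (\<bar>v x - s j x\<bar> powr P) \<le> \<bar>v x\<bar> powr P" for j by (simp add: s_def)
    show "AE x in lborel. (\<lambda>m. \<bar>v x - s m x\<bar> powr P) \<longlonglongrightarrow> 0"
    proof (intro AE_I2 tendsto_eventually)
      fix x
      obtain N where "\<bar>v x\<bar> \<le> real N" using real_arch_simple by blast
      then show "\<forall>\<^sub>F m in sequentially. \<bar>v x - s m x\<bar> powr P = 0"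
        by (intro eventually_sequentiallyI[of N]) (auto simp: s_def)
    qed
  qed measurable
  then have "\<forall>\<^sub>F m in sequentially. (\<integral>\<^sup>+x. norm (0 - \<bar>v x - s m x\<bar> powr P) \<partial>lborel) < ennreal e1"
    using e1 by (intro order_tendstoD) auto
  then have "\<forall>\<^sub>F m in sequentially. (\<integral>\<^sup>+x. norm (0 - \<bar>v x - s m x\<bar> powr P) \<partial>lborel) < ennreal e1 \<and> 1 \<le> m"
    by (intro eventually_conj eventually_ge_at_top)
  then obtain m where m: "(\<integral>\<^sup>+x. norm (0 - \<bar>v x - s m x\<bar> powr P) \<partial>lborel) < ennreal e1" "1 \<le> m"
    using eventually_happens' sequentially_bot by blast
  from m(1) have m1: "Lp_mass P (\<lambda>x. v x - s m x) \<le> ennreal e1" by simp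
  define b where "b = (2 * real m) powr (P - 1)"
  have b: "b > 0" using m(2) by (simp add: b_def)
  define e2 where "e2 = e / (2 * c * c * b)"
  have e2: "e2 > 0" using e c b by (simp add: e2_def)
  have "integrable lborel (s m)"
    by (rule Bochner_Integration.integrable_bound[OF v]) (auto simp: s_def)
  then obtain r where r: "r > 0" "\<And>h. norm h \<le> r \<Longrightarrow> L1_mass (\<lambda>x. s m (x + h) - s m x) \<le> ennreal e2"
    using translation_continuous_L1 e2 by metis
  have "Lp_mass P (\<lambda>x. v (x + h) - v x) \<le> ennreal e" if h: "norm h \<le> r" for h
  proof -
    let ?A = "\<lambda>x. \<bar>v x - s m x\<bar> powr P"
    have pt: "\<bar>v (x + h) - v x\<bar> powr P \<le> c * c * ?A (x + h) + (c * c * ?A x + c * c * b * \<bar>s m (x + h) - s m x\<bar>)" for x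
    proof -
      have "\<bar>v (x + h) - v x\<bar> powr P = \<bar>(v (x + h) - s m (x + h)) + ((s m x - v x) + (s m (x + h) - s m x))\<bar> powr P" by simp
      also have "\<dots> \<le> c * (?A (x + h) + \<bar>(s m x - v x) + (s m (x + h) - s m x)\<bar> powr P)"
        unfolding c_def by (rule powr_add_le[OF P])
      also have "\<dots> \<le> c * (?A (x + h) + c * (\<bar>s m x - v x\<bar> powr P + \<bar>s m (x + h) - s m x\<bar> powr P))"
        using c powr_add_le[OF P, of "s m x - v x" "s m (x + h) - s m x"]
        by (intro mult_left_mono add_left_mono) (auto simp: c_def)
      also have "\<bar>s m (x + h) - s m x\<bar> powr P \<le> b * \<bar>s m (x + h) - s m x\<bar>"
      proof (cases "s m (x + h) = s m x")
        case False
        have "\<bar>s m (x + h) - s m x\<bar> powr P = \<bar>s m (x + h) - s m x\<bar> powr (P - 1) * \<bar>s m (x + h) - s m x\<bar>"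
          using False by (simp add: powr_diff)
        also have "\<bar>s m (x + h) - s m x\<bar> powr (P - 1) \<le> b" unfolding b_def
          using P by (intro powr_mono2) (auto simp: s_def)
        finally show ?thesis by (simp add: mult_right_mono)
      qed (use P b in simp)
      finally have *: "\<bar>v (x + h) - v x\<bar> powr P \<le> c * (?A (x + h) + c * (\<bar>s m x - v x\<bar> powr P + b * \<bar>s m (x + h) - s m x\<bar>))"
        using c by (simp add: mult_left_mono)
      have "c * ?A (x + h) \<le> c * c * ?A (x + h)" using c by (intro mult_right_mono) auto
      with * show ?thesis by (simp add: algebra_simps abs_minus_commute)
    qed
    have "Lp_mass P (\<lambda>x. v (x + h) - v x)
      \<le> (\<integral>\<^sup>+x. ennreal (c * c) * ennreal (?A (h + 1 *\<^sub>R x)) + (ennreal (c * c) * ennreal (?A x) + ennreal (c * c * b) * ennreal \<bar>s m (x + h) - s m x\<bar>) \<partial>lborel)"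
      using c b pt
      by (intro nn_integral_mono) (auto simp: ennreal_plus[symmetric] ennreal_mult[symmetric] add.commute[of h] simp del: ennreal_plus intro!: ennreal_leI)
    also have "\<dots> = ennreal (c * c) * (\<integral>\<^sup>+x. ennreal (?A (h + 1 *\<^sub>R x)) \<partial>lborel)
       + (ennreal (c * c) * (\<integral>\<^sup>+x. ennreal (?A x) \<partial>lborel) + ennreal (c * c * b) * L1_mass (\<lambda>x. s m (x + h) - s m x))"
      by (simp add: nn_integral_add nn_integral_cmult)
    also have "(\<integral>\<^sup>+x. ennreal (?A (h + 1 *\<^sub>R x)) \<partial>lborel) = (\<integral>\<^sup>+x. ennreal (?A x) \<partial>lborel)"
      by (rule lborel_nn_integral_isometry) auto
    also have "ennreal (c * c) * (\<integral>\<^sup>+x. ennreal (?A x) \<partial>lborel)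
       + (ennreal (c * c) * (\<integral>\<^sup>+x. ennreal (?A x) \<partial>lborel) + ennreal (c * c * b) * L1_mass (\<lambda>x. s m (x + h) - s m x))
      \<le> ennreal (c * c) * ennreal e1 + (ennreal (c * c) * ennreal e1 + ennreal (c * c * b) * ennreal e2)"
      using h by (intro add_mono mult_left_mono m1 r) auto
    also have "\<dots> = ennreal (c * c * e1 + (c * c * e1 + c * c * b * e2))"
      using c b e1 e2 by (simp add: ennreal_mult[symmetric] ennreal_plus[symmetric] del: ennreal_plus)
    also have "c * c * e1 + (c * c * e1 + c * c * b * e2) = e"
      using c b by (simp add: e1_def e2_def field_simps)
    finally show ?thesis .
  qed
  then show ?thesis using r(1) by blast
qed

section \<open>Mollification\<close>

text \<open>The left-hand side is an average of translates of \<open>v\<close>, to which the \<open>L\<^sup>p\<close> estimates apply, and the right-hand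
  side an average of translates of \<open>\<psi>\<close>, which is smooth.\<close>

lemma mollify_eq:
  fixes \<psi> :: "real^'n::finite \<Rightarrow> real"
  assumes "smooth \<psi>" "\<And>x. \<psi> x \<ge> 0" and [measurable]: "v \<in> borel_measurable borel"
  shows "average (density lborel (\<lambda>x. ennreal (\<psi> x))) (\<lambda>_. 1) (\<lambda>y. - y) v = average lborel v (\<lambda>z. - z) \<psi>"
proof
  fix x
  note [measurable] = smooth_borel[OF assms(1)]
  have "average (density lborel (\<lambda>x. ennreal (\<psi> x))) (\<lambda>_. 1) (\<lambda>y. - y) v x = (LINT y|lborel. \<psi> y * v (x - y))"
    unfolding average_def using assms(2) by (subst integral_density) auto
  also have "\<dots> = (LINT z|lborel. (\<lambda>y. \<psi> y * v (x - y)) (x + (-1) *\<^sub>R z))"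
    by (rule lborel_integral_isometry(1)[symmetric]) auto
  also have "\<dots> = average lborel v (\<lambda>z. - z) \<psi> x"
    unfolding average_def by (simp add: mult.commute)
  finally show "average (density lborel (\<lambda>x. ennreal (\<psi> x))) (\<lambda>_. 1) (\<lambda>y. - y) v x = average lborel v (\<lambda>z. - z) \<psi> x" .
qed

lemma mollify_close:
  fixes \<psi> :: "real^'n::finite \<Rightarrow> real"
  assumes "smooth \<psi>" "\<And>x. \<psi> x \<ge> 0" "(LINT x|lborel. \<psi> x) = 1" "\<And>x. norm x > \<rho> \<Longrightarrow> \<psi> x = 0"
    and P: "P \<ge> 1" and v: "integrable lborel v" "v \<in> borel_measurable borel"
    and T: "\<And>h. norm h \<le> \<rho> \<Longrightarrow> Lp_mass P (\<lambda>x. v (x + h) - v x) \<le> ennreal e"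
  shows "Lp_mass P (\<lambda>x. average lborel v (\<lambda>z. - z) \<psi> x - v x) \<le> ennreal e"
proof -
  note [measurable] = smooth_borel[OF assms(1)] v(2)
  \<comment> \<open>Outside the ball of radius \<open>\<rho>\<close> the kernel vanishes, so the shift may be replaced by \<open>0\<close> there.\<close>
  define q where "q y = (if norm y \<le> \<rho> then - y else 0)" for y :: "real^'n"
  have [measurable]: "q \<in> borel_measurable borel" unfolding q_def[abs_def] by measurable
  let ?M = "density lborel (\<lambda>x. ennreal (\<psi> x))"
  have M: "prob_space ?M" by (rule prob_space_density_lborel) fact+
  have "average ?M (\<lambda>_. 1) (\<lambda>y. - y) v x = average ?M (\<lambda>_. 1) q v x" for x
  proof -
    have "average ?M (\<lambda>_. 1) (\<lambda>y. - y) v x = (LINT y|lborel. \<psi> y * v (x - y))"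
      unfolding average_def using assms(2) by (subst integral_density) auto
    also have "\<dots> = (LINT y|lborel. \<psi> y * v (x + q y))"
      by (rule Bochner_Integration.integral_cong) (use assms(4) in \<open>auto simp: q_def\<close>)
    also have "\<dots> = average ?M (\<lambda>_. 1) q v x"
      unfolding average_def using assms(2) by (subst integral_density) auto
    finally show ?thesis .
  qed
  then have eq: "average lborel v (\<lambda>z. - z) \<psi> = average ?M (\<lambda>_. 1) q v"
    by (subst mollify_eq[symmetric]) (use assms in auto)
  have q: "norm (q y) \<le> \<rho>" if "\<rho> \<ge> 0" for y using that by (simp add: q_def)
  have "\<rho> \<ge> 0"
  proof (rule ccontr)
    assume "\<not> \<rho> \<ge> 0"
    then have "\<psi> x = 0" for x using assms(4)[of x] by (simp add: less_le_trans[OF _ norm_ge_zero])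
    then show False using assms(3) by simp
  qed
  show ?thesis unfolding eq
    by (rule average_diff_powr_le[OF M P _ v(2,1)]) (use T q \<open>\<rho> \<ge> 0\<close> in auto)
qed

section \<open>Weak derivatives\<close>

text \<open>Every Lebesgue measurable function is represented by a Borel function, so that Fubini's
  theorem applies to its translates.\<close>

definition locally_integrable :: "(real^'n::finite) set \<Rightarrow> (real^'n \<Rightarrow> real) \<Rightarrow> bool" where
  "locally_integrable \<Omega> u \<longleftrightarrow> u \<in> borel_measurable borel \<and>
     (\<forall>K. compact K \<and> K \<subseteq> \<Omega> \<longrightarrow> set_integrable lborel K u)"

definition borel_weak_deriv ::
  "(real^'n::finite) set \<Rightarrow> 'n list \<Rightarrow> (real^'n \<Rightarrow> real) \<Rightarrow> (real^'n \<Rightarrow> real) \<Rightarrow> bool" where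
  "borel_weak_deriv \<Omega> l u v \<longleftrightarrow>
     (\<forall>\<phi>. test_function \<Omega> \<phi> \<longrightarrow>
        (LINT x|lborel. u x * list_deriv l \<phi> x) = (-1) ^ length l * (LINT x|lborel. v x * \<phi> x))"

definition borel_Lp :: "real \<Rightarrow> (real^'n::finite) set \<Rightarrow> (real^'n \<Rightarrow> real) set" where
  "borel_Lp P \<Omega> = {v \<in> borel_measurable borel. integrable lborel (\<lambda>x. indicator \<Omega> x * \<bar>v x\<bar> powr P)}"

definition borel_version ::
  "(real^'n::finite) set \<Rightarrow> (real^'n \<Rightarrow> real) \<Rightarrow> (real^'n \<Rightarrow> real) \<Rightarrow> bool" where
  "borel_version \<Omega> u u' \<longleftrightarrow> u' \<in> borel_measurable borel \<and> u \<in> borel_measurable (lebesgue_on \<Omega>) \<and>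
     (AE x in lebesgue_on \<Omega>. u x = u' x)"

lemma borel_versionD:
  assumes "borel_version \<Omega> u u'"
  shows "u' \<in> borel_measurable borel" "u \<in> borel_measurable (lebesgue_on \<Omega>)" "AE x in lebesgue_on \<Omega>. u x = u' x"
  using assms by (auto simp: borel_version_def)

lemma AE_lebesgue_on:
  assumes "open \<Omega>"
  shows "(AE x in lebesgue_on \<Omega>. Q x) \<longleftrightarrow> (AE x in lebesgue. x \<in> \<Omega> \<longrightarrow> Q x)"
  by (rule AE_restrict_space_iff) (use assms in auto)

lemma borel_measurable_imp_lebesgue_on:
  assumes "f \<in> borel_measurable borel"
  shows "f \<in> borel_measurable (lebesgue_on \<Omega>)"
proof -
  have "f \<in> borel_measurable lborel" using assms by simp
  then have "f \<in> borel_measurable lebesgue" by (rule measurable_completion)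
  then show ?thesis by (rule measurable_restrict_space1)
qed

lemma borel_version_exists:
  assumes O: "open \<Omega>" and u: "u \<in> borel_measurable (lebesgue_on \<Omega>)"
  obtains u' where "borel_version \<Omega> u u'"
proof -
  have "(\<lambda>x. indicator \<Omega> x *\<^sub>R u x) \<in> borel_measurable lebesgue"
    using u O by (subst (asm) borel_measurable_restrict_space_iff) auto
  then obtain u' where u': "u' \<in> borel_measurable lborel" "AE x in lborel. indicator \<Omega> x *\<^sub>R u x = u' x"
    using completion_ex_borel_measurable_real by blast
  have "AE x in lebesgue. indicator \<Omega> x *\<^sub>R u x = u' x" using u'(2) by (rule AE_completion)
  then have "AE x in lebesgue_on \<Omega>. u x = u' x"
    unfolding AE_lebesgue_on[OF O] by (rule eventually_mono) auto
  then show ?thesis using that u'(1) u by (auto simp: borel_version_def)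
qed

lemma compact_exhaustion:
  fixes \<Omega> :: "'a::euclidean_space set"
  assumes "open \<Omega>"
  shows "\<exists>C :: nat \<Rightarrow> 'a set. (\<forall>n. compact (C n) \<and> C n \<subseteq> \<Omega> \<and> C n \<subseteq> C (Suc n)) \<and> \<Union>(range C) = \<Omega>"
proof -
  obtain C where C: "\<And>n. compact(C n)" "\<And>n. C n \<subseteq> \<Omega>" "\<And>n. C n \<subseteq> interior(C(Suc n))" "\<Union>(range C) = \<Omega>"
      "\<And>K. \<lbrakk>compact K; K \<subseteq> \<Omega>\<rbrakk> \<Longrightarrow> \<exists>N. \<forall>n\<ge>N. K \<subseteq> (C n)"
    by (fact open_Union_compact_subsets[OF assms])
  have "C n \<subseteq> C (Suc n)" for n using C(3)[of n] interior_subset by (rule order_trans)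
  then show ?thesis using C(1,2,4) by (intro exI[of _ C]) simp
qed

lemma L1_loc_measurable:
  assumes O: "open \<Omega>" and u: "u \<in> L1_loc \<Omega>"
  shows "u \<in> borel_measurable (lebesgue_on \<Omega>)"
proof -
  from compact_exhaustion[OF O] obtain C :: "nat \<Rightarrow> (real^'a) set"
    where "(\<forall>n. compact (C n) \<and> C n \<subseteq> \<Omega> \<and> C n \<subseteq> C (Suc n)) \<and> \<Union>(range C) = \<Omega>" by (elim exE)
  then have C: "\<And>n. compact (C n)" "\<And>n. C n \<subseteq> \<Omega>" "\<And>n. C n \<subseteq> C (Suc n)" "\<Union>(range C) = \<Omega>"
    by simp_all
  have C': "C n \<in> sets lebesgue" for n using C(1) by (simp add: borel_compact)
  have m: "(\<lambda>x. indicator (C n) x *\<^sub>R u x) \<in> borel_measurable lebesgue" for n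
    using u C(1,2)[of n] C'[of n] unfolding L1_loc_def
    by (subst borel_measurable_restrict_space_iff[symmetric]) (auto dest: borel_measurable_integrable)
  have mono: "C n \<subseteq> C m" if "n \<le> m" for n m
  proof (rule lift_Suc_mono_le[OF _ that])
    show "C n \<subseteq> C (Suc n)" for n by (rule C(3))
  qed
  have "(\<lambda>x. indicator \<Omega> x *\<^sub>R u x) \<in> borel_measurable lebesgue"
  proof (rule borel_measurable_LIMSEQ_real[OF _ m])
    fix x
    show "(\<lambda>n. indicator (C n) x *\<^sub>R u x) \<longlonglongrightarrow> indicator \<Omega> x *\<^sub>R u x"
    proof (cases "x \<in> \<Omega>")
      case True
      then obtain N where "x \<in> C N" using C(4) by blast
      then have "x \<in> C n" if "n \<ge> N" for n using mono[OF that] by auto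
      then show ?thesis using True by (intro tendsto_eventually eventually_sequentiallyI[of N]) auto
    next
      case False
      then have "x \<notin> C n" for n using C(2) by auto
      then show ?thesis using False by simp
    qed
  qed
  then show ?thesis using O by (subst borel_measurable_restrict_space_iff) auto
qed

text \<open>The general integrand covers products with a test function as well as powers of the function.\<close>

lemma integral_borel_version:
  assumes O: "open \<Omega>" and v: "borel_version \<Omega> u u'" and [measurable]: "case_prod g \<in> borel_measurable (borel \<Otimes>\<^sub>M borel)"
    and z: "\<And>x y. x \<notin> \<Omega> \<Longrightarrow> g x y = 0"
  shows "(LINT x|lebesgue_on \<Omega>. g x (u x)) = (LINT x|lborel. (g x (u' x) :: real))"
    and "integrable (lebesgue_on \<Omega>) (\<lambda>x. g x (u x)) \<longleftrightarrow> integrable lborel (\<lambda>x. g x (u' x))"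
proof -
  note [measurable] = borel_versionD(1,2)[OF v]
  have id [measurable]: "(\<lambda>x. x) \<in> lebesgue_on \<Omega> \<rightarrow>\<^sub>M borel"
    by (rule borel_measurable_imp_lebesgue_on) simp
  have gu' [measurable]: "(\<lambda>x. g x (u' x)) \<in> borel_measurable borel" by measurable
  have gu'': "(\<lambda>x. g x (u' x)) \<in> borel_measurable (lebesgue_on \<Omega>)"
    by (rule borel_measurable_imp_lebesgue_on) measurable
  have gu: "(\<lambda>x. g x (u x)) \<in> borel_measurable (lebesgue_on \<Omega>)" by measurable
  have ae: "AE x in lebesgue_on \<Omega>. g x (u x) = g x (u' x)"
    using borel_versionD(3)[OF v] by (rule eventually_mono) simp
  have ind: "(\<lambda>x. indicator \<Omega> x *\<^sub>R g x (u' x)) = (\<lambda>x. g x (u' x))" using z by (force simp: indicator_def)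
  have "(LINT x|lebesgue_on \<Omega>. g x (u x)) = (LINT x|lebesgue_on \<Omega>. g x (u' x))"
    by (rule integral_cong_AE[OF gu gu'' ae])
  also have "\<dots> = (LINT x|lebesgue. indicator \<Omega> x *\<^sub>R g x (u' x))"
    using O by (subst integral_restrict_space) auto
  also have "\<dots> = (LINT x|lborel. g x (u' x))" unfolding ind by (rule integral_completion) simp
  finally show "(LINT x|lebesgue_on \<Omega>. g x (u x)) = (LINT x|lborel. g x (u' x))" .
  have "integrable (lebesgue_on \<Omega>) (\<lambda>x. g x (u x)) \<longleftrightarrow> integrable (lebesgue_on \<Omega>) (\<lambda>x. g x (u' x))"
    by (rule integrable_cong_AE[OF gu gu'' ae])
  also have "\<dots> \<longleftrightarrow> integrable lebesgue (\<lambda>x. indicator \<Omega> x *\<^sub>R g x (u' x))"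
    using O by (subst integrable_restrict_space) auto
  also have "\<dots> \<longleftrightarrow> integrable lborel (\<lambda>x. g x (u' x))" unfolding ind by (rule integrable_completion) simp
  finally show "integrable (lebesgue_on \<Omega>) (\<lambda>x. g x (u x)) \<longleftrightarrow> integrable lborel (\<lambda>x. g x (u' x))" .
qed

lemma borel_version_subset:
  assumes "open \<Omega>" "compact K" "K \<subseteq> \<Omega>" "borel_version \<Omega> u u'"
  shows "integrable (lebesgue_on K) u \<longleftrightarrow> set_integrable lborel K u'"
proof -
  have K: "K \<in> sets borel" using assms by (simp add: borel_compact)
  have "integrable (lebesgue_on K) u \<longleftrightarrow> integrable lebesgue (\<lambda>x. indicator K x *\<^sub>R u x)"
    using K by (subst integrable_restrict_space) auto
  also have "(\<lambda>x. indicator K x *\<^sub>R u x) = (\<lambda>x. indicator \<Omega> x *\<^sub>R (indicator K x * u x))"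
    using assms(3) by (auto simp: fun_eq_iff indicator_def)
  also have "integrable lebesgue \<dots> \<longleftrightarrow> integrable (lebesgue_on \<Omega>) (\<lambda>x. indicator K x * u x)"
    using assms(1) by (subst integrable_restrict_space) auto
  also have "\<dots> \<longleftrightarrow> integrable lborel (\<lambda>x. indicator K x * u' x)"
    using K assms(3) by (intro integral_borel_version(2)[OF assms(1,4)]) (auto split: split_indicator)
  finally show ?thesis by (simp add: set_integrable_def)
qed

lemma L1_loc_borel_version:
  assumes "open \<Omega>" "borel_version \<Omega> u u'"
  shows "u \<in> L1_loc \<Omega> \<longleftrightarrow> locally_integrable \<Omega> u'"
  unfolding L1_loc_def locally_integrable_def
  using borel_version_subset[OF assms(1) _ _ assms(2)] borel_versionD(1)[OF assms(2)] by auto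

lemma is_weak_deriv_borel_version:
  assumes O: "open \<Omega>" and u: "borel_version \<Omega> u u'" and v: "borel_version \<Omega> v v'"
  shows "is_weak_deriv \<Omega> \<alpha> u v \<longleftrightarrow> locally_integrable \<Omega> u' \<and> locally_integrable \<Omega> v' \<and>
     borel_weak_deriv \<Omega> (mi_list \<alpha>) u' v'"
proof -
  have eq: "(LINT x|lebesgue_on \<Omega>. w x * \<phi> x) = (LINT x|lborel. w' x * \<phi> x)"
    if t: "test_function \<Omega> \<phi>" and w: "borel_version \<Omega> w w'" for \<phi> w w'
  proof -
    note [measurable] = smooth_borel[OF testD(1)[OF t]]
    show ?thesis
      using integral_borel_version(1)[OF O w, of "\<lambda>x y. y * \<phi> x"] test_function_outside[OF t] by auto
  qed
  have "(\<forall>\<phi>. test_function \<Omega> \<phi> \<longrightarrow> (LINT x|lebesgue_on \<Omega>. u x * mi_deriv \<alpha> \<phi> x)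
          = (- 1) ^ mi_order \<alpha> * (LINT x|lebesgue_on \<Omega>. v x * \<phi> x)) \<longleftrightarrow> borel_weak_deriv \<Omega> (mi_list \<alpha>) u' v'"
    unfolding borel_weak_deriv_def mi_deriv_eq length_mi_list
  proof (intro iff_allI imp_cong refl)
    fix \<phi> assume t: "test_function \<Omega> \<phi>"
    show "(LINT x|lebesgue_on \<Omega>. u x * list_deriv (mi_list \<alpha>) \<phi> x) = (- 1) ^ mi_order \<alpha> * (LINT x|lebesgue_on \<Omega>. v x * \<phi> x)
      \<longleftrightarrow> (LINT x|lborel. u' x * list_deriv (mi_list \<alpha>) \<phi> x) = (- 1) ^ mi_order \<alpha> * (LINT x|lborel. v' x * \<phi> x)"
      unfolding eq[OF test_function_list_deriv[OF t] u] eq[OF t v] ..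
  qed
  then show ?thesis
    unfolding is_weak_deriv_def L1_loc_borel_version[OF O u] L1_loc_borel_version[OF O v] by blast
qed

lemma Lp_borel_version:
  assumes O: "open \<Omega>" and v: "borel_version \<Omega> v v'" and p: "p \<noteq> \<infinity>" "enn2real p > 0"
  shows "v \<in> Lp p \<Omega> \<longleftrightarrow> v' \<in> borel_Lp (enn2real p) \<Omega>"
    and "Lp_norm p \<Omega> v = (LINT x|lborel. indicator \<Omega> x * \<bar>v' x\<bar> powr enn2real p) powr (1 / enn2real p)"
proof -
  have [measurable]: "\<Omega> \<in> sets borel" using O by simp
  let ?g = "\<lambda>x y. indicator \<Omega> x * \<bar>y\<bar> powr enn2real p :: real"
  have m: "case_prod ?g \<in> borel_measurable (borel \<Otimes>\<^sub>M borel)" by measurable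
  have c1: "integrable (lebesgue_on \<Omega>) (\<lambda>x. \<bar>v x\<bar> powr enn2real p) \<longleftrightarrow> integrable (lebesgue_on \<Omega>) (\<lambda>x. ?g x (v x))"
    by (rule Bochner_Integration.integrable_cong) (auto simp: space_restrict_space)
  have c2: "(LINT x|lebesgue_on \<Omega>. \<bar>v x\<bar> powr enn2real p) = (LINT x|lebesgue_on \<Omega>. ?g x (v x))"
    by (rule Bochner_Integration.integral_cong) (auto simp: space_restrict_space)
  show "v \<in> Lp p \<Omega> \<longleftrightarrow> v' \<in> borel_Lp (enn2real p) \<Omega>"
    unfolding Lp_def borel_Lp_def using p borel_versionD(1,2)[OF v] c1 integral_borel_version(2)[OF O v m] by auto
  show "Lp_norm p \<Omega> v = (LINT x|lborel. indicator \<Omega> x * \<bar>v' x\<bar> powr enn2real p) powr (1 / enn2real p)"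
    unfolding Lp_norm_def using p c2 integral_borel_version(1)[OF O v m] by auto
qed

lemma compact_neighbourhood_in_open:
  fixes K :: "'a::euclidean_space set"
  assumes "compact K" "open \<Omega>" "K \<subseteq> \<Omega>"
  obtains r K' where "r > 0" "compact K'" "K' \<subseteq> \<Omega>" "\<And>x y. x \<in> K \<Longrightarrow> dist x y \<le> r \<Longrightarrow> y \<in> K'"
proof -
  have "closed (- \<Omega>)" "K \<inter> - \<Omega> = {}" using assms by auto
  from separate_compact_closed[OF assms(1) this] obtain d where
    d: "d > 0" "\<And>x y. x \<in> K \<Longrightarrow> y \<in> - \<Omega> \<Longrightarrow> d \<le> dist x y" by blast
  let ?K = "{x + y |x y. x \<in> K \<and> y \<in> cball 0 (d / 2)}"
  show ?thesis
  proof (rule that[of "d / 2" ?K])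
    show "compact ?K" by (intro compact_sums assms compact_cball)
    show "?K \<subseteq> \<Omega>"
    proof safe
      fix x y :: 'a assume "x \<in> K" "y \<in> cball 0 (d / 2)"
      then show "x + y \<in> \<Omega>" using d(2)[of x "x + y"] d(1) by (force simp: dist_norm)
    qed
    fix x y assume "x \<in> K" "dist x y \<le> d / 2"
    then show "y \<in> ?K" by (intro CollectI exI[of _ x] exI[of _ "y - x"]) (auto simp: dist_norm norm_minus_commute)
  qed (use d in auto)
qed

text \<open>The fundamental lemma of the calculus of variations: mollifications of a function that
  annihilates all test functions vanish, and they converge to the function.\<close>

lemma annihilates_test_functions_imp_zero:
  assumes O: "open \<Omega>" and w: "locally_integrable \<Omega> w"
    and ann: "\<And>\<phi>. test_function \<Omega> \<phi> \<Longrightarrow> (LINT x|lborel. w x * \<phi> x) = 0"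
  shows "AE x in lborel. x \<in> \<Omega> \<longrightarrow> w x = 0"
proof -
  have [measurable]: "w \<in> borel_measurable borel" using w by (simp add: locally_integrable_def)
  have K: "AE x in lborel. x \<in> K \<longrightarrow> w x = 0" if K: "compact K" "K \<subseteq> \<Omega>" for K
  proof -
    obtain r K' where r: "r > 0" "compact K'" "K' \<subseteq> \<Omega>" "\<And>x y. x \<in> K \<Longrightarrow> dist x y \<le> r \<Longrightarrow> y \<in> K'"
      using compact_neighbourhood_in_open[OF K(1) O K(2)] by metis
    have [measurable]: "K \<in> sets borel" "K' \<in> sets borel" using K r by (auto intro: borel_compact)
    define v where "v x = indicator K' x * w x" for x
    have v: "integrable lborel v" using w r(2,3) by (simp add: locally_integrable_def set_integrable_def v_def[abs_def])
    have [measurable]: "v \<in> borel_measurable borel" unfolding v_def[abs_def] by measurable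
    have v1: "integrable lborel (\<lambda>x. \<bar>v x\<bar> powr 1)" using v by simp
    have le: "(\<integral>\<^sup>+x. ennreal (indicator K x * \<bar>w x\<bar>) \<partial>lborel) \<le> 0 + ennreal e" if e: "e > 0" for e
    proof -
      obtain \<rho> where \<rho>: "\<rho> > 0" "\<And>h. norm h \<le> \<rho> \<Longrightarrow> Lp_mass 1 (\<lambda>x. v (x + h) - v x) \<le> ennreal e"
        using translation_continuous_Lp[OF order_refl v v1 e] by metis
      define s where "s = min \<rho> r"
      have s: "s > 0" "s \<le> \<rho>" "s \<le> r" using \<rho>(1) r(1) by (auto simp: s_def)
      obtain \<psi> :: "real^'a \<Rightarrow> real" where \<psi>: "smooth \<psi>" "\<And>x. \<psi> x \<ge> 0" "\<And>x. x \<notin> cball 0 s \<Longrightarrow> \<psi> x = 0"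
        "(LINT x|lborel. \<psi> x) = 1" using mollifier_exists[OF s(1)] by metis
      note [measurable] = smooth_borel[OF \<psi>(1)]
      let ?T = "average lborel v (\<lambda>z. - z) \<psi>"
      have close: "Lp_mass 1 (\<lambda>x. ?T x - v x) \<le> ennreal e"
        by (rule mollify_close[where \<rho> = s, OF \<psi>(1,2,4)]) (use \<psi>(3) v \<rho>(2) s in auto)
      have zero: "?T x = 0" if x: "x \<in> K" for x
      proof -
        have t: "test_function \<Omega> (\<lambda>z. \<psi> (x + (-1) *\<^sub>R z))" unfolding test_function_def
        proof (intro conjI exI[of _ K'] allI impI)
          show "smooth (\<lambda>z. \<psi> (x + - 1 *\<^sub>R z))" by (rule smooth_affine[OF \<psi>(1)])
          fix z assume "z \<notin> K'"
          then have "dist x z > r" using r(4)[OF x, of z] not_le by blast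
          then show "\<psi> (x + - 1 *\<^sub>R z) = 0" using \<psi>(3)[of "x - z"] s by (simp add: dist_norm norm_minus_commute)
        qed (use r in auto)
        have "?T x = (LINT z|lborel. w z * \<psi> (x + (-1) *\<^sub>R z))"
          unfolding average_def
        proof (rule Bochner_Integration.integral_cong[OF refl])
          fix z
          show "v z * \<psi> (x + - z) = w z * \<psi> (x + (-1) *\<^sub>R z)"
          proof (cases "z \<in> K'")
            case False
            then have "dist x z > r" using r(4)[OF x, of z] not_le by blast
            then show ?thesis using \<psi>(3)[of "x - z"] s by (simp add: dist_norm norm_minus_commute)
          qed (simp add: v_def)
        qed
        then show ?thesis using ann[OF t] by simp
      qed
      have "(\<integral>\<^sup>+x. ennreal (indicator K x * \<bar>w x\<bar>) \<partial>lborel) \<le> Lp_mass 1 (\<lambda>x. ?T x - v x)"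
      proof (rule nn_integral_mono)
        fix x
        show "ennreal (indicator K x * \<bar>w x\<bar>) \<le> ennreal (\<bar>?T x - v x\<bar> powr 1)"
          using zero[of x] r(4)[of x x] r(1) by (cases "x \<in> K") (auto simp: v_def)
      qed
      then show ?thesis using close by simp
    qed
    have "(\<integral>\<^sup>+x. ennreal (indicator K x * \<bar>w x\<bar>) \<partial>lborel) \<le> 0"
      by (rule ennreal_le_epsilon) (use le in auto)
    then have "(\<integral>\<^sup>+x. ennreal (indicator K x * \<bar>w x\<bar>) \<partial>lborel) = 0" by simp
    then have "AE x in lborel. ennreal (indicator K x * \<bar>w x\<bar>) = 0" by (subst (asm) nn_integral_0_iff_AE) auto
    then show ?thesis by (rule eventually_mono) (auto simp: ennreal_eq_0_iff indicator_def split: if_splits)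
  qed
  from compact_exhaustion[OF O] obtain C :: "nat \<Rightarrow> (real^'a) set"
    where "(\<forall>n. compact (C n) \<and> C n \<subseteq> \<Omega> \<and> C n \<subseteq> C (Suc n)) \<and> \<Union>(range C) = \<Omega>" by (elim exE)
  then have C: "\<And>n. compact (C n)" "\<And>n. C n \<subseteq> \<Omega>" "\<Union>(range C) = \<Omega>" by simp_all
  have "AE x in lborel. \<forall>n. x \<in> C n \<longrightarrow> w x = 0"
    unfolding AE_all_countable by (intro allI K C)
  then show ?thesis by (rule eventually_mono) (use C(3) in blast)
qed

lemma locally_integrable_times_test:
  assumes u: "locally_integrable \<Omega> u" and t: "test_function \<Omega> \<phi>"
  shows "integrable lborel (\<lambda>x. u x * \<phi> x)"
proof -
  obtain K where K: "compact K" "K \<subseteq> \<Omega>" "\<And>x. x \<notin> K \<Longrightarrow> \<phi> x = 0" using testD(2)[OF t] by auto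
  obtain B where B: "B > 0" "\<And>x. \<bar>\<phi> x\<bar> \<le> B" using test_bounded[OF testD(3)[OF t]] by blast
  have [measurable]: "u \<in> borel_measurable borel" "\<phi> \<in> borel_measurable borel"
    using u smooth_borel[OF testD(1)[OF t]] by (auto simp: locally_integrable_def)
  have "integrable lborel (\<lambda>x. indicator K x * u x)"
    using u K by (simp add: locally_integrable_def set_integrable_def)
  then have "integrable lborel (\<lambda>x. B * (indicator K x * u x))" by simp
  then show ?thesis
  proof (rule Bochner_Integration.integrable_bound)
    show "AE x in lborel. norm (u x * \<phi> x) \<le> norm (B * (indicator K x * u x))"
    proof (rule AE_I2)
      fix x show "norm (u x * \<phi> x) \<le> norm (B * (indicator K x * u x))"
        using K(3)[of x] mult_right_mono[OF B(2)[of x], of "\<bar>u x\<bar>"] B(1)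
        by (cases "x \<in> K") (auto simp: abs_mult mult.commute)
    qed
  qed measurable
qed

lemma borel_weak_deriv_unique:
  assumes O: "open \<Omega>" and v: "locally_integrable \<Omega> v" "locally_integrable \<Omega> w"
    and d: "borel_weak_deriv \<Omega> l u v" "borel_weak_deriv \<Omega> l u w"
  shows "AE x in lborel. x \<in> \<Omega> \<longrightarrow> v x = w x"
proof -
  have "AE x in lborel. x \<in> \<Omega> \<longrightarrow> v x - w x = 0"
  proof (rule annihilates_test_functions_imp_zero[OF O])
    show "locally_integrable \<Omega> (\<lambda>x. v x - w x)"
      using v unfolding locally_integrable_def by (auto intro: set_integral_diff)
    fix \<phi> assume t: "test_function \<Omega> \<phi>"
    have "(LINT x|lborel. v x * \<phi> x) = (LINT x|lborel. w x * \<phi> x)"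
    proof -
      have "(-1) ^ length l * (LINT x|lborel. v x * \<phi> x) = (-1) ^ length l * (LINT x|lborel. w x * \<phi> x)"
        using d t unfolding borel_weak_deriv_def by (metis (no_types))
      then show ?thesis by simp
    qed
    then show "(LINT x|lborel. (v x - w x) * \<phi> x) = 0"
      using locally_integrable_times_test[OF v(1) t] locally_integrable_times_test[OF v(2) t]
      by (simp add: left_diff_distrib)
  qed
  then show ?thesis by (rule eventually_mono) auto
qed

section \<open>The segment property\<close>

text \<open>The classical segment condition, in a uniform and localized form. The ball shrinks to a point as \<open>s\<close> tends to
  \<open>0\<close>, hence \<open>s\<close> is positive. That \<open>N\<close> is arbitrary allows the condition to be applied again inside a neighbourhood that is
  already given.\<close>

definition segment_property :: "(real^'n::finite) set \<Rightarrow> bool" where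
  "segment_property \<Omega> \<longleftrightarrow> (\<forall>x\<in>closure \<Omega>. \<forall>N. open N \<and> x \<in> N \<longrightarrow>
     (\<exists>V d. open V \<and> x \<in> V \<and> V \<subseteq> N \<and> bounded V \<and>
       (\<forall>s. 0 < s \<and> s \<le> 1 \<longrightarrow> (\<exists>\<rho>>0. \<forall>z\<in>V \<inter> \<Omega>. cball (z - s *\<^sub>R d) \<rho> \<subseteq> N \<inter> \<Omega>))))"

text \<open>A move by \<open>s c\<close> against the direction of the distinguished coordinate does not change the value of \<open>f\<close>, so it opens a gap of
  \<open>s c\<close> below the graph. By uniform continuity, points that are close to the moved point keep two thirds of this
  gap in the coordinate and lose at most another third in the value of \<open>f\<close>.\<close>

lemma C0_boundary_segment_property:
  assumes O: "open \<Omega>" and C: "C0_boundary \<Omega>"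
  shows "segment_property \<Omega>"
  unfolding segment_property_def
proof (intro ballI allI impI, elim conjE)
  fix x N assume x: "x \<in> closure \<Omega>" and N: "open N" "x \<in> N"
  let ?goal = "\<exists>V d. open V \<and> x \<in> V \<and> V \<subseteq> N \<and> bounded V \<and>
       (\<forall>s. 0 < s \<and> s \<le> 1 \<longrightarrow> (\<exists>\<rho>>0. \<forall>z\<in>V \<inter> \<Omega>. cball (z - s *\<^sub>R d) \<rho> \<subseteq> N \<inter> \<Omega>))"
  show ?goal
  proof (cases "x \<in> \<Omega>")
    case True
    then have "open (N \<inter> \<Omega>)" "x \<in> N \<inter> \<Omega>" using N O by auto
    then obtain R where R: "R > 0" "ball x R \<subseteq> N \<inter> \<Omega>" by (meson openE)
    have A: "cball (z - s *\<^sub>R 0) (R / 3) \<subseteq> N \<inter> \<Omega>" if "z \<in> ball x (R / 3)" for z s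
    proof
      fix y assume y: "y \<in> cball (z - s *\<^sub>R 0) (R / 3)"
      have "dist x y \<le> dist x z + dist z y" by (rule dist_triangle)
      also have "\<dots> < R" using that y R(1) by auto
      finally show "y \<in> N \<inter> \<Omega>" using R(2) by auto
    qed
    have "ball x (R / 3) \<subseteq> N" using R subset_ball[of "R / 3" R x] by auto
    moreover have "\<exists>\<rho>>0. \<forall>z\<in>ball x (R / 3) \<inter> \<Omega>. cball (z - s *\<^sub>R 0) \<rho> \<subseteq> N \<inter> \<Omega>" for s
      using R(1) A[of _ s] by (intro exI[of _ "R / 3"]) auto
    ultimately show ?thesis using R(1)
      by (intro exI[of _ "ball x (R / 3)"] exI[of _ 0]) simp
  next
    case False
    then have "x \<in> frontier \<Omega>" using x O by (simp add: frontier_def interior_open)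
    from C[unfolded C0_boundary_def, THEN bspec, OF this]
    obtain U T i f where UT: "open U \<and> x \<in> U \<and> orthogonal_transformation (T :: real^'a \<Rightarrow> real^'a) \<and>
        continuous_on UNIV (f :: real^'a \<Rightarrow> real) \<and>
        (\<forall>y y'. (\<forall>j. j \<noteq> i \<longrightarrow> y $ j = y' $ j) \<longrightarrow> f y = f y') \<and>
        U \<inter> \<Omega> = {z \<in> U. T z $ i < f (T z)}" by (elim exE)
    then have U: "open U" "x \<in> U" and T: "orthogonal_transformation T" and f1: "continuous_on UNIV f"
      and UO: "U \<inter> \<Omega> = {z \<in> U. T z $ i < f (T z)}" by simp_all
    have f2: "f y = f y'" if "\<And>j. j \<noteq> i \<Longrightarrow> y $ j = y' $ j" for y y'
      using UT that by blast
    have linT: "linear T" using T by (rule orthogonal_transformation_linear)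
    have nT: "norm (T v) = norm v" for v using T by (rule orthogonal_transformation_norm)
    have "surj T" using T by (rule orthogonal_transformation_surj)
    then obtain e where e: "T e = axis i 1" by (metis surj_def)
    have ne: "norm e = 1" using nT[of e] e by simp
    have "open (U \<inter> N)" "x \<in> U \<inter> N" using U N by auto
    then obtain R where R: "R > 0" "ball x R \<subseteq> U \<inter> N" by (meson openE)
    define c where "c = R / 3"
    have c: "c > 0" using R by (simp add: c_def)
    have contfT: "continuous_on UNIV (\<lambda>z. f (T z))"
      using f1 linear_continuous_on[OF linT[unfolded linear_conv_bounded_linear]]
      by (rule continuous_on_compose2) auto
    have fT: "uniformly_continuous_on (cball x (2 * R)) (\<lambda>z. f (T z))"
      by (intro compact_uniformly_continuous continuous_on_subset[OF contfT]) auto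
    have "\<exists>\<rho>>0. \<forall>z\<in>ball x c \<inter> \<Omega>. cball (z - s *\<^sub>R (c *\<^sub>R e)) \<rho> \<subseteq> N \<inter> \<Omega>" if s: "0 < s" "s \<le> 1" for s
    proof -
      have sc: "s * c > 0" "s * c \<le> c" using s c by auto
      then have "s * c / 3 > 0" by simp
      with fT obtain \<rho>0 where \<rho>0: "\<rho>0 > 0"
        "\<And>y z. y \<in> cball x (2 * R) \<Longrightarrow> z \<in> cball x (2 * R) \<Longrightarrow> dist z y < \<rho>0 \<Longrightarrow> dist (f (T z)) (f (T y)) < s * c / 3"
        unfolding uniformly_continuous_on_def by metis
      define \<rho> where "\<rho> = min (\<rho>0 / 2) (s * c / 3)"
      have \<rho>: "\<rho> > 0" "\<rho> < \<rho>0" "\<rho> \<le> s * c / 3" using \<rho>0(1) sc by (auto simp: \<rho>_def)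
      show ?thesis
      proof (intro exI[of _ \<rho>] conjI ballI subsetI \<rho>(1))
        fix z w assume z: "z \<in> ball x c \<inter> \<Omega>" and w: "w \<in> cball (z - s *\<^sub>R (c *\<^sub>R e)) \<rho>"
        let ?z = "z - s *\<^sub>R (c *\<^sub>R e)"
        have zz: "dist z ?z = s * c" using ne s c by (simp add: dist_norm)
        have zc: "dist x z < c" using z by simp
        have Rc: "R = 3 * c" by (simp add: c_def)
        have 1: "dist x ?z < R" using dist_triangle[of x ?z z] zz zc sc(2) Rc c by linarith
        have wz: "dist ?z w \<le> \<rho>" using w by simp
        have "dist x w \<le> dist x z + dist z ?z + dist ?z w"
          using dist_triangle[of x w ?z] dist_triangle[of x ?z z] by linarith
        also have "\<dots> < R" using zc zz wz sc(2) \<rho>(3) Rc c by linarith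
        finally have w': "w \<in> ball x R" by simp
        have zU: "z \<in> U \<inter> \<Omega>" using z R c_def by auto
        then have Tz: "T z $ i < f (T z)" using UO by auto
        have Tz': "T ?z = T z - (s * c) *\<^sub>R axis i 1"
          using linT e by (simp add: linear_diff linear_cmul)
        have fz: "f (T ?z) = f (T z)" by (rule f2) (unfold Tz', simp add: axis_def)
        have Tzi: "T ?z $ i = T z $ i - s * c" unfolding Tz' by simp
        have "\<bar>T w $ i - T ?z $ i\<bar> \<le> norm (T w - T ?z)"
          using component_le_norm_cart[of "T w - T ?z" i] by simp
        also have "\<dots> = dist ?z w" using nT[of "w - ?z"] linT by (simp add: linear_diff dist_norm norm_minus_commute)
        finally have 2: "\<bar>T w $ i - T ?z $ i\<bar> \<le> s * c / 3" using wz \<rho>(3) by linarith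
        have "dist (f (T w)) (f (T ?z)) < s * c / 3"
          using 1 w' wz \<rho>(2) R(1) by (intro \<rho>0(2)) (auto simp: dist_commute)
        then have "T w $ i < f (T w)" using 2 Tz Tzi fz sc unfolding dist_real_def by linarith
        then show "w \<in> N \<inter> \<Omega>" using w' R(2) UO by blast
      qed
    qed
    moreover have "ball x c \<subseteq> N" using R subset_ball[of c R x] by (auto simp: c_def)
    ultimately show ?thesis using c
      by (intro exI[of _ "ball x c"] exI[of _ "c *\<^sub>R e"]) auto
  qed
qed

section \<open>\<open>L\<^sup>p\<close> on bounded sets\<close>

lemma borel_LpD:
  assumes "v \<in> borel_Lp P \<Omega>"
  shows "v \<in> borel_measurable borel" "integrable lborel (\<lambda>x. indicator \<Omega> x * \<bar>v x\<bar> powr P)"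
  using assms by (auto simp: borel_Lp_def)

lemma borel_Lp_mono:
  assumes "v \<in> borel_Lp P \<Omega>" "\<Omega>' \<subseteq> \<Omega>" "\<Omega>' \<in> sets borel"
  shows "v \<in> borel_Lp P \<Omega>'"
proof -
  note [measurable] = borel_LpD(1)[OF assms(1)] assms(3)
  have "integrable lborel (\<lambda>x. indicator \<Omega>' x * \<bar>v x\<bar> powr P)"
    by (rule Bochner_Integration.integrable_bound[OF borel_LpD(2)[OF assms(1)]])
      (use assms(2) in \<open>auto simp: indicator_def\<close>)
  then show ?thesis using assms(1) by (simp add: borel_Lp_def)
qed

lemma borel_Lp_add:
  assumes P: "P \<ge> 1" and v: "v \<in> borel_Lp P \<Omega>" "w \<in> borel_Lp P \<Omega>" and [measurable]: "\<Omega> \<in> sets borel"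
  shows "(\<lambda>x. v x + w x) \<in> borel_Lp P \<Omega>"
proof -
  note [measurable] = borel_LpD(1)[OF v(1)] borel_LpD(1)[OF v(2)]
  have "integrable lborel (\<lambda>x. indicator \<Omega> x * \<bar>v x + w x\<bar> powr P)"
  proof (rule Bochner_Integration.integrable_bound)
    show "integrable lborel (\<lambda>x. 2 powr P * (indicator \<Omega> x * \<bar>v x\<bar> powr P + indicator \<Omega> x * \<bar>w x\<bar> powr P))"
      by (intro integrable_mult_right Bochner_Integration.integrable_add borel_LpD(2) v)
    show "AE x in lborel. norm (indicator \<Omega> x * \<bar>v x + w x\<bar> powr P)
      \<le> norm (2 powr P * (indicator \<Omega> x * \<bar>v x\<bar> powr P + indicator \<Omega> x * \<bar>w x\<bar> powr P))"
    proof (rule AE_I2)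
      fix x show "norm (indicator \<Omega> x * \<bar>v x + w x\<bar> powr P)
        \<le> norm (2 powr P * (indicator \<Omega> x * \<bar>v x\<bar> powr P + indicator \<Omega> x * \<bar>w x\<bar> powr P))"
        using powr_add_le[OF P, of "v x" "w x"] by (cases "x \<in> \<Omega>") auto
    qed
  qed measurable
  then show ?thesis by (simp add: borel_Lp_def)
qed

lemma borel_Lp_zero: "(\<lambda>x. 0) \<in> borel_Lp P \<Omega>"
  by (simp add: borel_Lp_def)

lemma borel_Lp_sum:
  assumes P: "P \<ge> 1" and v: "\<And>i. i \<in> I \<Longrightarrow> v i \<in> borel_Lp P \<Omega>" and "\<Omega> \<in> sets borel"
  shows "(\<lambda>x. \<Sum>i\<in>I. v i x) \<in> borel_Lp P \<Omega>"
  using v by (induction I rule: infinite_finite_induct) (auto intro: borel_Lp_zero borel_Lp_add[OF P] assms)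

lemma finite_measure_bounded: "bounded S \<Longrightarrow> S \<in> sets borel \<Longrightarrow> integrable lborel (indicator S :: 'a::euclidean_space \<Rightarrow> real)"
  by (intro integrable_real_indicator emeasure_bounded_finite) auto

lemma borel_Lp_bounded_mult:
  assumes P: "P \<ge> 1" and v: "v \<in> borel_Lp P \<Omega>" and [measurable]: "\<Omega> \<in> sets borel" "g \<in> borel_measurable borel"
    and B: "\<And>x. \<bar>g x\<bar> \<le> B"
  shows "(\<lambda>x. g x * v x) \<in> borel_Lp P \<Omega>"
proof -
  note [measurable] = borel_LpD(1)[OF v]
  have "integrable lborel (\<lambda>x. indicator \<Omega> x * \<bar>g x * v x\<bar> powr P)"
  proof (rule Bochner_Integration.integrable_bound)
    show "integrable lborel (\<lambda>x. B powr P * (indicator \<Omega> x * \<bar>v x\<bar> powr P))"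
      by (intro integrable_mult_right borel_LpD(2) v)
    show "AE x in lborel. norm (indicator \<Omega> x * \<bar>g x * v x\<bar> powr P) \<le> norm (B powr P * (indicator \<Omega> x * \<bar>v x\<bar> powr P))"
    proof (rule AE_I2)
      fix x
      have "\<bar>g x\<bar> powr P \<le> B powr P" using B[of x] P by (intro powr_mono2) auto
      then show "norm (indicator \<Omega> x * \<bar>g x * v x\<bar> powr P) \<le> norm (B powr P * (indicator \<Omega> x * \<bar>v x\<bar> powr P))"
        by (cases "x \<in> \<Omega>") (auto simp: abs_mult powr_mult intro: mult_right_mono)
    qed
  qed measurable
  then show ?thesis by (simp add: borel_Lp_def)
qed

lemma borel_Lp_bounded:
  assumes P: "P \<ge> 1" and b: "bounded \<Omega>" and [measurable]: "\<Omega> \<in> sets borel" "g \<in> borel_measurable borel"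
    and B: "\<And>x. x \<in> \<Omega> \<Longrightarrow> \<bar>g x\<bar> \<le> B"
  shows "g \<in> borel_Lp P \<Omega>"
proof -
  have "integrable lborel (\<lambda>x. indicator \<Omega> x * \<bar>g x\<bar> powr P)"
  proof (rule Bochner_Integration.integrable_bound)
    show "integrable lborel (\<lambda>x. B powr P * indicator \<Omega> x)"
      by (intro integrable_mult_right finite_measure_bounded b) auto
    show "AE x in lborel. norm (indicator \<Omega> x * \<bar>g x\<bar> powr P) \<le> norm (B powr P * indicator \<Omega> x)"
    proof (rule AE_I2)
      fix x
      have "x \<in> \<Omega> \<Longrightarrow> \<bar>g x\<bar> powr P \<le> B powr P" using B[of x] P by (intro powr_mono2) auto
      then show "norm (indicator \<Omega> x * \<bar>g x\<bar> powr P) \<le> norm (B powr P * indicator \<Omega> x)"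
        by (cases "x \<in> \<Omega>") auto
    qed
  qed measurable
  then show ?thesis by (simp add: borel_Lp_def)
qed

text \<open>Extension by zero makes translates meaningful. On a bounded set \<open>L\<^sup>p\<close> is contained in \<open>L\<^sup>1\<close>, because
  \<open>\<bar>v\<bar> \<le> 1 + \<bar>v\<bar> powr P\<close>.\<close>

lemma borel_Lp_extend:
  assumes P: "P \<ge> 1" and b: "bounded \<Omega>" and v: "v \<in> borel_Lp P \<Omega>" and [measurable]: "\<Omega> \<in> sets borel"
  defines "v0 \<equiv> (\<lambda>x. indicator \<Omega> x * v x)"
  shows "v0 \<in> borel_measurable borel" "integrable lborel v0" "integrable lborel (\<lambda>x. \<bar>v0 x\<bar> powr P)"
proof -
  note [measurable] = borel_LpD(1)[OF v]
  show m [measurable]: "v0 \<in> borel_measurable borel" unfolding v0_def by measurable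
  have "(\<lambda>x. \<bar>v0 x\<bar> powr P) = (\<lambda>x. indicator \<Omega> x * \<bar>v x\<bar> powr P)"
    using P by (auto simp: v0_def fun_eq_iff indicator_def)
  then show "integrable lborel (\<lambda>x. \<bar>v0 x\<bar> powr P)" using borel_LpD(2)[OF v] by simp
  show "integrable lborel v0"
  proof (rule Bochner_Integration.integrable_bound)
    show "integrable lborel (\<lambda>x. indicator \<Omega> x + indicator \<Omega> x * \<bar>v x\<bar> powr P)"
      by (intro Bochner_Integration.integrable_add finite_measure_bounded borel_LpD(2) b v) auto
    show "AE x in lborel. norm (v0 x) \<le> norm (indicator \<Omega> x + indicator \<Omega> x * \<bar>v x\<bar> powr P)"
    proof (rule AE_I2)
      fix x show "norm (v0 x) \<le> norm (indicator \<Omega> x + indicator \<Omega> x * \<bar>v x\<bar> powr P)"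
        using le_one_plus_powr[OF P, of "\<bar>v x\<bar>"] by (cases "x \<in> \<Omega>") (auto simp: v0_def)
    qed
  qed measurable
qed

lemma borel_Lp_locally_integrable:
  assumes P: "P \<ge> 1" and b: "bounded \<Omega>" and v: "v \<in> borel_Lp P \<Omega>" and [measurable]: "\<Omega> \<in> sets borel"
  shows "locally_integrable \<Omega> v"
  unfolding locally_integrable_def
proof (intro conjI allI impI)
  show [measurable]: "v \<in> borel_measurable borel" by (rule borel_LpD(1)[OF v])
  fix K assume K: "compact K \<and> K \<subseteq> \<Omega>"
  then have [measurable]: "K \<in> sets borel" by (simp add: borel_compact)
  have "integrable lborel (\<lambda>x. indicator K x *\<^sub>R v x)"
    by (rule Bochner_Integration.integrable_bound[OF borel_Lp_extend(2)[OF P b v]])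
      (use K in \<open>auto simp: indicator_def\<close>)
  then show "set_integrable lborel K v" by (simp add: set_integrable_def)
qed

lemma locally_integrable_mono: "locally_integrable \<Omega> u \<Longrightarrow> \<Omega>' \<subseteq> \<Omega> \<Longrightarrow> locally_integrable \<Omega>' u"
  by (auto simp: locally_integrable_def)

lemma borel_weak_deriv_mono: "borel_weak_deriv \<Omega> l u v \<Longrightarrow> \<Omega>' \<subseteq> \<Omega> \<Longrightarrow> borel_weak_deriv \<Omega>' l u v"
  unfolding borel_weak_deriv_def using test_function_mono by blast

section \<open>The averaged fundamental theorem of calculus\<close>

text \<open>The time along a segment is uniformly distributed on the unit interval, and the offset \<open>y\<close> of its end point has the density \<open>\<phi>\<close>.\<close>

definition path_measure :: "(real^'n::finite \<Rightarrow> real) \<Rightarrow> (real \<times> (real^'n)) measure" where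
  "path_measure \<phi> = density lborel (\<lambda>t. ennreal (indicator {0..1} t)) \<Otimes>\<^sub>M density lborel (\<lambda>y. ennreal (\<phi> y))"

lemma prob_space_unit_interval: "prob_space (density lborel (\<lambda>t::real. ennreal (indicator {0..1} t)))"
proof
  show "emeasure (density lborel (\<lambda>t::real. ennreal (indicator {0..1} t))) (space (density lborel (\<lambda>t::real. ennreal (indicator {0..1} t)))) = 1"
    by (subst emeasure_density) (auto simp: ennreal_indicator)
qed

lemma sets_path_measure [measurable_cong]: "sets (path_measure \<phi>) = sets (borel \<Otimes>\<^sub>M borel)"
  unfolding path_measure_def by (intro sets_pair_measure_cong) auto

lemma prob_space_path_measure:
  assumes "smooth \<phi>" "\<And>x. \<phi> x \<ge> 0" "(LINT x|lborel. \<phi> x) = 1"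
  shows "prob_space (path_measure \<phi>)"
  unfolding path_measure_def
  by (rule prob_space_pair[OF prob_space_unit_interval prob_space_density_lborel[OF assms]])

lemma integral_path_measure:
  fixes f :: "real \<Rightarrow> real^'n::finite \<Rightarrow> real"
  assumes \<phi>: "smooth \<phi>" "\<And>x. \<phi> x \<ge> 0" "(LINT x|lborel. \<phi> x) = 1"
    and [measurable]: "case_prod f \<in> borel_measurable (borel \<Otimes>\<^sub>M borel)" and B: "\<And>t y. \<bar>f t y\<bar> \<le> B"
  shows "(LINT w|path_measure \<phi>. f (fst w) (snd w)) = (LINT y|lborel. \<phi> y * (LINT t|lborel. indicator {0..1} t *\<^sub>R f t y))"
proof -
  note [measurable] = smooth_borel[OF \<phi>(1)]
  let ?N = "density lborel (\<lambda>t::real. ennreal (indicator {0..1} t))" and ?D = "density lborel (\<lambda>y. ennreal (\<phi> y))"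
  interpret N: prob_space ?N by (rule prob_space_unit_interval)
  interpret D: prob_space ?D by (rule prob_space_density_lborel[OF \<phi>])
  interpret pair_prob_space ?N ?D ..
  have "integrable (?N \<Otimes>\<^sub>M ?D) (case_prod f)"
    by (rule P.integrable_const_bound[of _ B]) (use B in auto)
  then have "(LINT w|(?N \<Otimes>\<^sub>M ?D). case_prod f w) = (LINT y|?D. LINT t|?N. f t y)"
    by (rule integral_snd[symmetric])
  also have "\<dots> = (LINT y|lborel. \<phi> y * (LINT t|?N. f t y))"
    using \<phi>(2) by (subst integral_density) auto
  also have "\<dots> = (LINT y|lborel. \<phi> y * (LINT t|lborel. indicator {0..1} t *\<^sub>R f t y))"
    by (subst integral_density) auto
  finally show ?thesis by (simp add: path_measure_def case_prod_beta)
qed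

lemma line_integral_gradient:
  assumes "smooth \<psi>"
  shows "(LINT t|lborel. indicator {0..1} t *\<^sub>R (\<Sum>i\<in>UNIV. v $ i * partial_deriv i \<psi> (x + t *\<^sub>R v))) = \<psi> (x + v) - \<psi> x"
proof -
  let ?g = "\<lambda>t. \<Sum>i\<in>UNIV. v $ i * partial_deriv i \<psi> (x + t *\<^sub>R v)"
  have "(LINT t|lborel. indicator {0..1} t *\<^sub>R ?g t) = \<psi> (x + 1 *\<^sub>R v) - \<psi> (x + 0 *\<^sub>R v)"
  proof (rule integral_FTC_Icc)
    show "((\<lambda>t. \<psi> (x + t *\<^sub>R v)) has_vector_derivative ?g t) (at t within {0..1})" for t
      by (rule has_vector_derivative_at_within[OF
          partial_deriv_line[OF assms, unfolded has_real_derivative_iff_has_vector_derivative]])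
    have c: "continuous_on UNIV (partial_deriv i \<psi>)" for i
      by (intro smooth_continuous smooth_partial assms)
    show "continuous_on {0..1} ?g"
      by (intro continuous_intros continuous_on_compose2[OF c]) auto
  qed simp
  then show ?thesis by simp
qed

text \<open>Integrands of the path from \<open>x\<close> along the stem to \<open>x + d\<close>, and from there along a fan of segments to the points
  \<open>x + d + y\<close>: the weight is the velocity and the shift the position relative to \<open>x\<close>. The indicators change nothing
  almost everywhere, but they make the weights bounded and confine the shifts that count to a compact set.\<close>

definition stem_weight :: "real^'n::finite \<Rightarrow> 'n \<Rightarrow> real \<times> (real^'n) \<Rightarrow> real" where
  "stem_weight d i w = indicator {0..1} (fst w) * d $ i"

definition stem_shift :: "real^'n::finite \<Rightarrow> real \<times> (real^'n) \<Rightarrow> real^'n" where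
  "stem_shift d w = fst w *\<^sub>R d"

definition fan_weight :: "real \<Rightarrow> 'n::finite \<Rightarrow> real \<times> (real^'n) \<Rightarrow> real" where
  "fan_weight r i w = indicator {0..1} (fst w) * indicator (cball 0 r) (snd w) * snd w $ i"

definition fan_shift :: "real^'n::finite \<Rightarrow> real \<times> (real^'n) \<Rightarrow> real^'n" where
  "fan_shift d w = d + fst w *\<^sub>R snd w"

lemma stem_fan_measurable:
  fixes d :: "real^'n::finite"
  shows "stem_weight d i \<in> borel_measurable (path_measure \<phi>)" "stem_shift d \<in> borel_measurable (path_measure \<phi>)"
  "fan_weight r i \<in> borel_measurable (path_measure \<phi>)" "fan_shift d \<in> borel_measurable (path_measure \<phi>)"
proof -
  have [measurable]: "(\<lambda>x::real^'n. x $ i) \<in> borel_measurable borel"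
    by (intro borel_measurable_continuous_onI continuous_intros)
  have [measurable]: "cball (0::real^'n) r \<in> sets borel" by simp
  have [measurable]: "fst \<in> path_measure \<phi> \<rightarrow>\<^sub>M borel" "snd \<in> path_measure \<phi> \<rightarrow>\<^sub>M borel"
    unfolding measurable_cong_sets[OF sets_path_measure refl] by (rule measurable_fst measurable_snd)+
  show "stem_weight d i \<in> borel_measurable (path_measure \<phi>)" "stem_shift d \<in> borel_measurable (path_measure \<phi>)"
    "fan_weight r i \<in> borel_measurable (path_measure \<phi>)" "fan_shift d \<in> borel_measurable (path_measure \<phi>)"
    unfolding stem_weight_def[abs_def] stem_shift_def[abs_def] fan_weight_def[abs_def] fan_shift_def[abs_def] by measurable
qed

lemma stem_weight_bound: "\<bar>stem_weight d i w\<bar> \<le> norm d"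
  unfolding stem_weight_def using component_le_norm_cart[of d i] by (auto simp: indicator_def)

lemma fan_weight_bound: "r > 0 \<Longrightarrow> \<bar>fan_weight r i w\<bar> \<le> r"
  unfolding fan_weight_def using component_le_norm_cart[of "snd w" i] by (auto simp: indicator_def intro: order_trans)

text \<open>Integrate the gradient of \<open>\<psi>\<close> along the stem and the fan, and average over the end points. Thus \<open>\<psi>\<close> differs from its
  average over a ball around \<open>x + d\<close> by a divergence of averages of translates of \<open>\<psi>\<close>.\<close>

lemma averaged_fundamental_theorem:
  assumes \<phi>: "smooth \<phi>" "\<And>x. \<phi> x \<ge> 0" "\<And>x. x \<notin> cball 0 r \<Longrightarrow> \<phi> x = 0" "(LINT x|lborel. \<phi> x) = 1" and r: "r > 0"
    and t: "test \<psi>"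
  shows "\<psi> x = average lborel \<phi> (\<lambda>y. d + y) \<psi> x
     - (\<Sum>i\<in>UNIV. average (path_measure \<phi>) (stem_weight d i) (stem_shift d) (partial_deriv i \<psi>) x
            + average (path_measure \<phi>) (fan_weight r i) (fan_shift d) (partial_deriv i \<psi>) x)"
proof -
  note [measurable] = smooth_borel[OF \<phi>(1)] stem_fan_measurable
  let ?M = "path_measure \<phi>"
  interpret M: prob_space ?M by (rule prob_space_path_measure) fact+
  have sm: "smooth \<psi>" using t by (rule testD)
  have [measurable]: "(\<lambda>x::real^'a. x $ i) \<in> borel_measurable borel" for i
    by (intro borel_measurable_continuous_onI continuous_intros)
  have [measurable]: "\<psi> \<in> borel_measurable borel" "partial_deriv i \<psi> \<in> borel_measurable borel" for i
    using sm by (auto intro: smooth_borel smooth_partial)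
  have i_stem: "integrable ?M (stem_weight d i)" for i
    by (rule M.integrable_const_bound[of _ "norm d"], rule AE_I2, simp only: real_norm_def stem_weight_bound)
      (rule stem_fan_measurable)
  have i_fan: "integrable ?M (fan_weight r i)" for i
    by (rule M.integrable_const_bound[of _ r], rule AE_I2, simp only: real_norm_def fan_weight_bound[OF r])
      (rule stem_fan_measurable)
  let ?f = "\<lambda>t y. \<Sum>i\<in>UNIV. stem_weight d i (t, y) * partial_deriv i \<psi> (x + stem_shift d (t, y))
     + fan_weight r i (t, y) * partial_deriv i \<psi> (x + fan_shift d (t, y))"
  have tp: "test (partial_deriv i \<psi>)" for i by (rule test_function_partial[OF t])
  have iA: "integrable lborel \<phi>" using \<phi>(4) not_integrable_integral_eq by fastforce
  have "\<exists>B. \<forall>x. \<bar>partial_deriv i \<psi> x\<bar> \<le> B" for i using test_bounded[OF tp] by metis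
  then obtain B where B: "\<And>i x. \<bar>partial_deriv i \<psi> x\<bar> \<le> B i" by metis
  have "(\<Sum>i\<in>UNIV. average ?M (stem_weight d i) (stem_shift d) (partial_deriv i \<psi>) x
            + average ?M (fan_weight r i) (fan_shift d) (partial_deriv i \<psi>) x)
     = (LINT w|?M. ?f (fst w) (snd w))"
    unfolding average_def
    by (subst Bochner_Integration.integral_sum)
      (auto intro!: sum.cong Bochner_Integration.integrable_add average_integrable i_stem i_fan tp Bochner_Integration.integral_add[symmetric])
  also have "\<dots> = (LINT y|lborel. \<phi> y * (LINT t|lborel. indicator {0..1} t *\<^sub>R ?f t y))"
  proof (rule integral_path_measure[OF \<phi>(1,2,4)])
    show "case_prod ?f \<in> borel_measurable (borel \<Otimes>\<^sub>M borel)"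
    proof -
      have "(\<lambda>w. \<Sum>i\<in>UNIV. stem_weight d i w * partial_deriv i \<psi> (x + stem_shift d w)
          + fan_weight r i w * partial_deriv i \<psi> (x + fan_shift d w)) \<in> borel_measurable ?M"
        by (intro borel_measurable_sum borel_measurable_add borel_measurable_times stem_fan_measurable
            measurable_compose[OF _ smooth_borel[OF smooth_partial[OF sm]]] borel_measurable_const)
      then show ?thesis
        unfolding measurable_cong_sets[OF sets_path_measure refl] by (simp add: case_prod_beta')
    qed
    show "\<bar>?f t y\<bar> \<le> (\<Sum>i\<in>UNIV. norm d * B i + r * B i)" for t y
    proof (rule order_trans[OF sum_abs sum_mono])
      fix i
      have "\<bar>stem_weight d i (t, y) * partial_deriv i \<psi> (x + stem_shift d (t, y))\<bar> \<le> norm d * B i"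
        unfolding abs_mult by (intro mult_mono stem_weight_bound B) auto
      moreover have "\<bar>fan_weight r i (t, y) * partial_deriv i \<psi> (x + fan_shift d (t, y))\<bar> \<le> r * B i"
        unfolding abs_mult using r by (intro mult_mono fan_weight_bound B) auto
      ultimately show "\<bar>stem_weight d i (t, y) * partial_deriv i \<psi> (x + stem_shift d (t, y))
        + fan_weight r i (t, y) * partial_deriv i \<psi> (x + fan_shift d (t, y))\<bar> \<le> norm d * B i + r * B i" by linarith
    qed
  qed
  also have "\<dots> = (LINT y|lborel. \<phi> y * (\<psi> (x + (d + y)) - \<psi> x))"
  proof (rule Bochner_Integration.integral_cong[OF refl])
    fix y
    show "\<phi> y * (LINT t|lborel. indicator {0..1} t *\<^sub>R ?f t y) = \<phi> y * (\<psi> (x + (d + y)) - \<psi> x)"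
    proof (cases "y \<in> cball 0 r")
      case False then show ?thesis using \<phi>(3) by simp
    next
      case True
      have eq: "indicator {0..1} t *\<^sub>R ?f t y = indicator {0..1} t *\<^sub>R (\<Sum>i\<in>UNIV. d $ i * partial_deriv i \<psi> (x + t *\<^sub>R d))
          + indicator {0..1} t *\<^sub>R (\<Sum>i\<in>UNIV. y $ i * partial_deriv i \<psi> ((x + d) + t *\<^sub>R y))" for t
        using True by (auto simp: stem_weight_def stem_shift_def fan_weight_def fan_shift_def sum.distrib add.assoc indicator_def)
      have cont: "continuous_on {0..1} (\<lambda>t. \<Sum>i\<in>UNIV. v $ i * partial_deriv i \<psi> (z + t *\<^sub>R v))" for v z
      proof -
        have c: "continuous_on UNIV (partial_deriv i \<psi>)" for i by (intro smooth_continuous smooth_partial sm)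
        show ?thesis by (intro continuous_intros continuous_on_compose2[OF c]) auto
      qed
      have "(LINT t|lborel. indicator {0..1} t *\<^sub>R ?f t y) = (\<psi> (x + d) - \<psi> x) + (\<psi> ((x + d) + y) - \<psi> (x + d))"
        unfolding eq line_integral_gradient[OF sm, symmetric]
        by (intro Bochner_Integration.integral_add borel_integrable_compact cont) auto
      then show ?thesis by (simp add: add.assoc)
    qed
  qed
  also have "\<dots> = (LINT y|lborel. \<phi> y * \<psi> (x + (d + y)) - \<phi> y * \<psi> x)" by (simp add: algebra_simps)
  also have "\<dots> = (LINT y|lborel. \<phi> y * \<psi> (x + (d + y))) - (LINT y|lborel. \<phi> y * \<psi> x)"
    by (intro Bochner_Integration.integral_diff average_integrable iA t integrable_mult_left) auto
  also have "(LINT y|lborel. \<phi> y * \<psi> x) = \<psi> x" using \<phi>(4) by simp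
  finally show ?thesis by (simp add: average_def)
qed

section \<open>Lower order derivatives near the closure\<close>

lemma list_deriv_diff: "smooth f \<Longrightarrow> smooth g \<Longrightarrow>
    list_deriv l (\<lambda>x. f x - g x) = (\<lambda>x. list_deriv l f x - list_deriv l g x)"
  using list_deriv_add[of f "\<lambda>x. (-1) * g x" l] list_deriv_cmult[of g l "-1"] smooth_cmult[of g "-1"]
  by simp

lemma test_function_add:
  assumes "test_function \<Omega> f" "test_function \<Omega> g"
  shows "test_function \<Omega> (\<lambda>x. f x + g x)"
proof -
  obtain K L where "compact K" "K \<subseteq> \<Omega>" "\<And>x. x \<notin> K \<Longrightarrow> f x = 0" "compact L" "L \<subseteq> \<Omega>" "\<And>x. x \<notin> L \<Longrightarrow> g x = 0"
    using testD(2)[OF assms(1)] testD(2)[OF assms(2)] by metis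
  then show ?thesis unfolding test_function_def
    using smooth_add[OF testD(1)[OF assms(1)] testD(1)[OF assms(2)]]
    by (intro conjI exI[of _ "K \<union> L"]) (auto intro: compact_Un)
qed

lemma average_density:
  assumes [measurable]: "\<phi> \<in> borel_measurable borel" "q \<in> borel_measurable borel" "v \<in> borel_measurable borel"
    and "\<And>x. \<phi> x \<ge> 0"
  shows "average (density lborel (\<lambda>x. ennreal (\<phi> x))) (\<lambda>_. 1) q v = average lborel \<phi> q v"
proof
  fix x
  have [measurable]: "(\<lambda>y. v (x + q y)) \<in> borel_measurable borel" by measurable
  show "average (density lborel (\<lambda>x. ennreal (\<phi> x))) (\<lambda>_. 1) q v x = average lborel \<phi> q v x"
    unfolding average_def using assms(4) by (subst integral_density) auto
qed

text \<open>Insert the averaged fundamental theorem for the test function \<open>\<psi>\<close> into \<open>\<integral> u D\<^sup>l \<psi>\<close>. The divergence terms only involve the given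
  derivatives \<open>v i\<close>, and transposition turns them into averages of translates of \<open>v i\<close>, which are in \<open>L\<^sup>p\<close>. In the remaining
  term all derivatives are moved to the kernel of the average, and \<open>u\<close> contributes only its values on a compact
  subset of \<open>G\<close>. The hypothesis on \<open>d\<close> keeps all shifted test functions inside \<open>G\<close>.\<close>

lemma lower_order_weak_deriv:
  fixes G G' :: "(real^'n::finite) set"
  assumes P: "P \<ge> 1" and G: "open G" "bounded G" and G': "open G'" "G' \<subseteq> G"
    and seg: "\<And>s. 0 < s \<Longrightarrow> s \<le> 1 \<Longrightarrow> \<exists>\<rho>>0. \<forall>z\<in>G'. cball (z - s *\<^sub>R d) \<rho> \<subseteq> G"
    and u: "locally_integrable G u"
    and v: "\<And>i. v i \<in> borel_Lp P G" "\<And>i. borel_weak_deriv G (l @ [i]) u (v i)"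
  shows "\<exists>w\<in>borel_Lp P G'. borel_weak_deriv G' l u w"
proof -
  have Gb [measurable]: "G \<in> sets borel" "G' \<in> sets borel" using G G' by auto
  obtain \<rho> where \<rho>: "\<rho> > 0" "\<And>z. z \<in> G' \<Longrightarrow> cball (z - d) \<rho> \<subseteq> G" using seg[of 1] by auto
  define r where "r = \<rho> / 2"
  have r: "r > 0" "r < \<rho>" using \<rho>(1) by (auto simp: r_def)
  (* C contains all points whose values of u enter the smooth term. Since r < \<rho>, even its closure points lie
     in G. *)
  define C where "C = closure (\<Union>z\<in>G'. cball (z - d) r)"
  have CG: "C \<subseteq> G"
  proof
    fix x assume "x \<in> C"
    then obtain y where y: "y \<in> (\<Union>z\<in>G'. cball (z - d) r)" "dist y x < r"
      unfolding C_def closure_approachable using r(1) by blast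
    then obtain z where z: "z \<in> G'" "dist (z - d) y \<le> r" by auto
    have "dist (z - d) x \<le> dist (z - d) y + dist y x" by (rule dist_triangle)
    also have "\<dots> \<le> \<rho>" using z(2) y(2) by (simp add: r_def)
    finally show "x \<in> G" using \<rho>(2)[OF z(1)] by auto
  qed
  have cC: "compact C"
    using bounded_subset[OF G(2) CG] by (simp add: C_def compact_eq_bounded_closed)
  have [measurable]: "C \<in> sets borel" "u \<in> borel_measurable borel"
    using cC u by (auto simp: borel_compact locally_integrable_def)
  define ut where "ut x = indicator C x * u x" for x
  have ut [measurable]: "ut \<in> borel_measurable borel" unfolding ut_def[abs_def] by measurable
  have iut: "integrable lborel ut"
    using u cC CG by (simp add: locally_integrable_def set_integrable_def ut_def[abs_def])
  obtain \<phi> :: "real^'n \<Rightarrow> real" where \<phi>: "smooth \<phi>" "\<And>x. \<phi> x \<ge> 0" "\<And>x. x \<notin> cball 0 r \<Longrightarrow> \<phi> x = 0"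
    "(LINT x|lborel. \<phi> x) = 1" using mollifier_exists[OF r(1), of 0] by metis
  have t\<phi>: "test \<phi>" unfolding test_function_def using \<phi>(1,3) by (metis compact_cball subset_UNIV)
  note [measurable] = smooth_borel[OF \<phi>(1)]
  have i\<phi>: "integrable lborel \<phi>" by (rule test_integrable[OF t\<phi>])
  let ?D = "density lborel (\<lambda>x. ennreal (\<phi> x))"
  have D: "prob_space ?D" by (rule prob_space_density_lborel) fact+
  let ?M = "path_measure \<phi>"
  have M: "prob_space ?M" by (rule prob_space_path_measure) fact+
  interpret M: prob_space ?M by (rule M)
  note meas = stem_fan_measurable
  define v0 where "v0 i x = indicator G x * v i x" for i x
  have v0: "v0 i \<in> borel_measurable borel" "integrable lborel (v0 i)" "integrable lborel (\<lambda>x. \<bar>v0 i x\<bar> powr P)" for i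
    using borel_Lp_extend[OF P G(2) v(1)[of i] Gb(1)] by (auto simp: v0_def[abs_def])
  (* J x is an average of u over the ball around x - d. Together with the transposed averages R2 and R3 of the
     derivatives it makes up the weak derivative w. *)
  define T where "T = average lborel ut (\<lambda>z. - z) \<phi>"
  have smT: "smooth T" unfolding T_def by (rule average_smooth[OF iut _ t\<phi>]) measurable
  define J where "J x = T (- d + 1 *\<^sub>R x)" for x
  have smJ: "smooth J" unfolding J_def[abs_def] by (rule smooth_affine[OF smT])
  define R2 where "R2 i = average ?M (stem_weight d i) (\<lambda>w. - stem_shift d w) (v0 i)" for i
  define R3 where "R3 i = average ?M (fan_weight r i) (\<lambda>w. - fan_shift d w) (v0 i)" for i
  have m': "(\<lambda>w. - stem_shift d w) \<in> borel_measurable ?M" "(\<lambda>w. - fan_shift d w) \<in> borel_measurable ?M"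
    by (intro borel_measurable_uminus meas)+
  have R2: "R2 i \<in> borel_Lp P UNIV" for i unfolding borel_Lp_def R2_def
    using average_borel_measurable[OF M meas(1) m'(1) v0(1)] average_powr_integrable[OF M P meas(1) m'(1) v0(1) stem_weight_bound v0(3)]
    by simp
  have R3: "R3 i \<in> borel_Lp P UNIV" for i unfolding borel_Lp_def R3_def
    using average_borel_measurable[OF M meas(3) m'(2) v0(1)] average_powr_integrable[OF M P meas(3) m'(2) v0(1) fan_weight_bound[OF r(1)] v0(3)]
    by simp
  define w where "w x = list_deriv l J x + (\<Sum>i\<in>UNIV. R2 i x + R3 i x)" for x
  have smDJ: "smooth (list_deriv l J)" by (rule smooth_list_deriv[OF smJ])
  have bG': "bounded G'" using bounded_subset[OF G(2) G'(2)] .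
  have "bounded (list_deriv l J ` closure G')"
    using bG' smooth_continuous[OF smDJ] by (intro compact_imp_bounded compact_continuous_image) auto
  then obtain B where B: "\<And>x. x \<in> closure G' \<Longrightarrow> \<bar>list_deriv l J x\<bar> \<le> B" by (auto simp: bounded_iff)
  have "list_deriv l J \<in> borel_Lp P G'"
    by (rule borel_Lp_bounded[OF P bG' Gb(2) smooth_borel[OF smDJ] B]) (use closure_subset in blast)
  moreover have "(\<lambda>x. \<Sum>i\<in>UNIV. R2 i x + R3 i x) \<in> borel_Lp P G'"
    by (intro borel_Lp_sum[OF P] borel_Lp_add[OF P] borel_Lp_mono[OF R2] borel_Lp_mono[OF R3] Gb) auto
  ultimately have wLp: "w \<in> borel_Lp P G'"
    unfolding w_def[abs_def] by (rule borel_Lp_add[OF P _ _ Gb(2)])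
  have "borel_weak_deriv G' l u w"
    unfolding borel_weak_deriv_def
  proof (intro allI impI)
    fix \<psi> assume t': "test_function G' \<psi>"
    have sm: "smooth \<psi>" and t: "test \<psi>" using testD[OF t'] by auto
    obtain K where K: "compact K" "K \<subseteq> G'" "\<And>x. x \<notin> K \<Longrightarrow> \<psi> x = 0" using testD(2)[OF t'] by auto
    (* \<psi> is the average A minus the divergence of the vector field with the components S i. *)
    define A where "A = average lborel \<phi> (\<lambda>y. d + y) \<psi>"
    define S2 where "S2 i = average ?M (stem_weight d i) (stem_shift d) \<psi>" for i
    define S3 where "S3 i = average ?M (fan_weight r i) (fan_shift d) \<psi>" for i
    define S where "S i x = S2 i x + S3 i x" for i x
    have ball_in: "x - y \<in> G" if "x \<in> K" "y \<in> cball d r" for x y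
    proof -
      have "dist (x - d) (x - y) \<le> \<rho>" using that(2) r(2) by (simp add: dist_norm norm_minus_commute)
      then have "x - y \<in> cball (x - d) \<rho>" by (simp only: mem_cball)
      moreover have "x \<in> G'" using that(1) K(2) by blast
      ultimately show ?thesis using \<rho>(2) by blast
    qed
    have i_stem: "integrable ?M (stem_weight d i)" for i
      by (rule M.integrable_const_bound[of _ "norm d"], rule AE_I2, simp only: real_norm_def stem_weight_bound)
        (rule meas)
    have i_fan: "integrable ?M (fan_weight r i)" for i
      by (rule M.integrable_const_bound[of _ r], rule AE_I2, simp only: real_norm_def fan_weight_bound[OF r(1)])
        (rule meas)
    have tA: "test_function G A" unfolding A_def
    proof (rule average_test_function[OF i\<phi> _ sm K(1,3)])
      show "compact (cball d r)" by simp
      show "d + w \<in> cball d r" if "\<phi> w \<noteq> 0" for w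
        using \<phi>(3)[of w] that by (auto simp: dist_norm)
    qed (use ball_in in auto)
    have tS2: "test_function G (S2 i)" for i unfolding S2_def
    proof (rule average_test_function[OF i_stem meas(2) sm K(1,3)])
      show "compact ((\<lambda>t. t *\<^sub>R d) ` {0..1})" by (intro compact_continuous_image continuous_intros) auto
      show "stem_shift d w \<in> (\<lambda>t. t *\<^sub>R d) ` {0..1}" if "stem_weight d i w \<noteq> 0" for w
        using that by (auto simp: stem_weight_def stem_shift_def indicator_def split: if_splits)
      fix x y assume x: "x \<in> K" and "y \<in> (\<lambda>t. t *\<^sub>R d) ` {0..1}"
      then obtain s where "y = s *\<^sub>R d" "s \<in> {0..1}" by blast
      then have s: "y = s *\<^sub>R d" "0 \<le> s" "s \<le> 1" by simp_all
      show "x - y \<in> G"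
      proof (cases "s = 0")
        case True then show ?thesis using x K(2) G'(2) s(1) by auto
      next
        case False
        then obtain \<rho>' where "\<rho>' > 0" "\<forall>z\<in>G'. cball (z - s *\<^sub>R d) \<rho>' \<subseteq> G" using seg[of s] s by auto
        then show ?thesis using x K(2) s(1) by (meson centre_in_cball less_imp_le subsetD)
      qed
    qed
    have tS3: "test_function G (S3 i)" for i unfolding S3_def
    proof (rule average_test_function[OF i_fan meas(4) sm K(1,3)])
      show "compact (cball d r)" by simp
      show "fan_shift d w \<in> cball d r" if "fan_weight r i w \<noteq> 0" for w
      proof -
        have w: "0 \<le> fst w" "fst w \<le> 1" "norm (snd w) \<le> r"
          using that by (auto simp: fan_weight_def indicator_def split: if_splits)
        then have "\<bar>fst w\<bar> * norm (snd w) \<le> 1 * r" by (intro mult_mono) auto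
        then show ?thesis by (simp add: fan_shift_def dist_norm)
      qed
    qed (use ball_in in auto)
    have tS: "test_function G (S i)" for i unfolding S_def[abs_def] by (rule test_function_add[OF tS2 tS3])
    have smS: "smooth (S i)" for i by (rule testD(1)[OF tS])
    have pS: "partial_deriv i (S i) x = average ?M (stem_weight d i) (stem_shift d) (partial_deriv i \<psi>) x
            + average ?M (fan_weight r i) (fan_shift d) (partial_deriv i \<psi>) x" for i x
    proof -
      have "partial_deriv i (S i) = (\<lambda>x. partial_deriv i (S2 i) x + partial_deriv i (S3 i) x)"
        unfolding S_def[abs_def] by (intro partial_deriv_add smooth_diffble testD(1)[OF tS2] testD(1)[OF tS3])
      then show ?thesis
        unfolding S2_def S3_def average_partial[OF i_stem meas(2) t] average_partial[OF i_fan meas(4) t] by simp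
    qed
    have "\<psi> = (\<lambda>x. A x - (\<Sum>i\<in>UNIV. partial_deriv i (S i) x))"
      unfolding pS A_def using averaged_fundamental_theorem[OF \<phi> r(1) t, of _ d] by auto
    then have "list_deriv l \<psi> = list_deriv l (\<lambda>x. A x - (\<Sum>i\<in>UNIV. partial_deriv i (S i) x))" by simp
    also have "\<dots> = (\<lambda>x. list_deriv l A x - (\<Sum>i\<in>UNIV. list_deriv l (partial_deriv i (S i)) x))"
    proof -
      have "list_deriv l (\<lambda>x. \<Sum>i\<in>UNIV. partial_deriv i (S i) x) = (\<lambda>x. \<Sum>i\<in>UNIV. list_deriv l (partial_deriv i (S i)) x)"
        by (rule list_deriv_sum[OF finite]) (rule smooth_partial[OF smS])
      then show ?thesis
        by (subst list_deriv_diff[OF testD(1)[OF tA] smooth_sum[OF smooth_partial[OF smS]]]) simp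
    qed
    finally have D\<psi>: "list_deriv l \<psi> = (\<lambda>x. list_deriv l A x - (\<Sum>i\<in>UNIV. list_deriv (l @ [i]) (S i) x))"
      by (simp add: list_deriv_append)
    have [measurable]: "\<psi> \<in> borel_measurable borel" "list_deriv l \<psi> \<in> borel_measurable borel"
      using sm by (auto intro: smooth_borel smooth_list_deriv)
    obtain B1 where B1: "\<And>x. \<bar>\<psi> x\<bar> \<le> B1" using test_bounded[OF t] by blast
    obtain B2 where B2: "\<And>x. \<bar>list_deriv l \<psi> x\<bar> \<le> B2"
      using test_bounded[OF test_function_list_deriv[OF t]] by blast
    have uA: "(LINT x|lborel. u x * list_deriv l A x) = (-1) ^ length l * (LINT x|lborel. list_deriv l J x * \<psi> x)"
    proof -
      have DA: "list_deriv l A = average lborel \<phi> (\<lambda>y. d + y) (list_deriv l \<psi>)"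
        unfolding A_def by (rule average_list_deriv[OF i\<phi> _ t]) measurable
      then have eq: "list_deriv l A = average ?D (\<lambda>_. 1) (\<lambda>y. d + y) (list_deriv l \<psi>)"
        using \<phi>(2) by (subst average_density) auto
      have off: "list_deriv l A x = 0" if x: "x \<notin> C" for x
      proof -
        have "\<phi> y * list_deriv l \<psi> (x + (d + y)) = 0" for y
        proof (rule ccontr)
          assume ne: "\<phi> y * list_deriv l \<psi> (x + (d + y)) \<noteq> 0"
          then have y: "norm y \<le> r" using \<phi>(3)[of y] by auto
          have "x + (d + y) \<in> K"
            using ne list_deriv_zero_off_closed[OF compact_imp_closed[OF K(1)], of \<psi> "x + (d + y)" l] K(3) by auto
          then have "x + (d + y) \<in> G'" using K(2) by auto
          moreover have "x \<in> cball (x + (d + y) - d) r" using y by (simp add: dist_norm)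
          ultimately have "x \<in> (\<Union>z\<in>G'. cball (z - d) r)" by blast
          then have "x \<in> C" unfolding C_def by (rule subsetD[OF closure_subset])
          then show False using x by contradiction
        qed
        then show ?thesis
          unfolding DA average_def by (simp only: Bochner_Integration.integral_zero)
      qed
      have "average ?D (\<lambda>_. 1) (\<lambda>y. - (d + y)) ut x = J x" for x
      proof -
        have "average ?D (\<lambda>_. 1) (\<lambda>y. - (d + y)) ut x = average ?D (\<lambda>_. 1) (\<lambda>y. - y) ut (x - d)"
          by (simp add: average_def algebra_simps)
        also have "\<dots> = J x" unfolding mollify_eq[OF \<phi>(1,2) ut] J_def T_def by simp
        finally show ?thesis .
      qed
      then have J: "average ?D (\<lambda>_. 1) (\<lambda>y. - (d + y)) ut = J" by auto
      have "(LINT x|lborel. u x * list_deriv l A x) = (LINT x|lborel. ut x * list_deriv l A x)"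
      proof (rule Bochner_Integration.integral_cong[OF refl])
        fix x show "u x * list_deriv l A x = ut x * list_deriv l A x"
          using off[of x] by (cases "x \<in> C") (auto simp: ut_def)
      qed
      also have "\<dots> = (LINT x|lborel. average ?D (\<lambda>_. 1) (\<lambda>y. - (d + y)) ut x * list_deriv l \<psi> x)"
        unfolding eq
        by (rule average_transpose(1)[OF D _ _ _ iut ut _ B2, where C = 1]) auto
      also have "\<dots> = (-1) ^ length l * (LINT x|lborel. list_deriv l J x * \<psi> x)"
        unfolding J by (rule integration_by_parts[OF smJ t])
      finally show ?thesis .
    qed
    have iJ: "integrable lborel (\<lambda>x. list_deriv l J x * \<psi> x)"
      by (rule test_integrable[OF test_function_mult[OF t smDJ]])
    have tr2: "(LINT x|lborel. v0 i x * S2 i x) = (LINT x|lborel. R2 i x * \<psi> x)" "integrable lborel (\<lambda>x. R2 i x * \<psi> x)" for i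
      unfolding S2_def R2_def
      using average_transpose[OF M meas(1,2) stem_weight_bound v0(2,1) _ B1] by auto
    have tr3: "(LINT x|lborel. v0 i x * S3 i x) = (LINT x|lborel. R3 i x * \<psi> x)" "integrable lborel (\<lambda>x. R3 i x * \<psi> x)" for i
      unfolding S3_def R3_def
      using average_transpose[OF M meas(3,4) fan_weight_bound[OF r(1)] v0(2,1) _ B1] by auto
    have liv: "locally_integrable G (v i)" for i by (rule borel_Lp_locally_integrable[OF P G(2) v(1) Gb(1)])
    have uS: "(LINT x|lborel. u x * list_deriv (l @ [i]) (S i) x) = - ((-1) ^ length l) * (LINT x|lborel. (R2 i x + R3 i x) * \<psi> x)" for i
    proof -
      have v0_eq: "v i x * \<theta> x = v0 i x * \<theta> x" if "test_function G \<theta>" for \<theta> x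
        using test_function_outside[OF that, of x] by (cases "x \<in> G") (auto simp: v0_def)
      have "(LINT x|lborel. u x * list_deriv (l @ [i]) (S i) x) = (-1) ^ length (l @ [i]) * (LINT x|lborel. v i x * S i x)"
        using v(2)[of i] tS[of i] unfolding borel_weak_deriv_def by blast
      also have "(LINT x|lborel. v i x * S i x) = (LINT x|lborel. v i x * S2 i x + v i x * S3 i x)"
        by (simp add: S_def algebra_simps)
      also have "\<dots> = (LINT x|lborel. v i x * S2 i x) + (LINT x|lborel. v i x * S3 i x)"
        by (intro Bochner_Integration.integral_add locally_integrable_times_test[OF liv] tS2 tS3)
      also have "\<dots> = (LINT x|lborel. R2 i x * \<psi> x) + (LINT x|lborel. R3 i x * \<psi> x)"
        unfolding v0_eq[OF tS2] v0_eq[OF tS3] tr2(1) tr3(1) ..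
      also have "\<dots> = (LINT x|lborel. R2 i x * \<psi> x + R3 i x * \<psi> x)"
        by (intro Bochner_Integration.integral_add[symmetric] tr2(2) tr3(2))
      also have "\<dots> = (LINT x|lborel. (R2 i x + R3 i x) * \<psi> x)" by (simp add: algebra_simps)
      finally show ?thesis by simp
    qed
    have iR: "integrable lborel (\<lambda>x. (R2 i x + R3 i x) * \<psi> x)" for i
      using Bochner_Integration.integrable_add[OF tr2(2) tr3(2), of i i] by (simp add: algebra_simps)
    have iu: "integrable lborel (\<lambda>x. u x * list_deriv m \<theta> x)" if "test_function G \<theta>" for m \<theta>
      by (rule locally_integrable_times_test[OF u test_function_list_deriv[OF that]])
    have "(LINT x|lborel. u x * list_deriv l \<psi> x)
        = (LINT x|lborel. u x * list_deriv l A x - (\<Sum>i\<in>UNIV. u x * list_deriv (l @ [i]) (S i) x))"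
      unfolding D\<psi> by (simp add: right_diff_distrib sum_distrib_left)
    also have "\<dots> = (LINT x|lborel. u x * list_deriv l A x) - (\<Sum>i\<in>UNIV. LINT x|lborel. u x * list_deriv (l @ [i]) (S i) x)"
    proof -
      have "(LINT x|lborel. (\<Sum>i\<in>UNIV. u x * list_deriv (l @ [i]) (S i) x)) = (\<Sum>i\<in>UNIV. LINT x|lborel. u x * list_deriv (l @ [i]) (S i) x)"
        by (rule Bochner_Integration.integral_sum) (rule iu[OF tS])
      moreover have "integrable lborel (\<lambda>x. \<Sum>i\<in>UNIV. u x * list_deriv (l @ [i]) (S i) x)"
        by (rule Bochner_Integration.integrable_sum) (rule iu[OF tS])
      ultimately show ?thesis by (subst Bochner_Integration.integral_diff[OF iu[OF tA]]) simp_all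
    qed
    also have "\<dots> = (-1) ^ length l * ((LINT x|lborel. list_deriv l J x * \<psi> x) + (\<Sum>i\<in>UNIV. LINT x|lborel. (R2 i x + R3 i x) * \<psi> x))"
      unfolding uA uS by (simp add: sum_negf sum_distrib_left algebra_simps)
    also have "(LINT x|lborel. list_deriv l J x * \<psi> x) + (\<Sum>i\<in>UNIV. LINT x|lborel. (R2 i x + R3 i x) * \<psi> x)
        = (LINT x|lborel. list_deriv l J x * \<psi> x + (\<Sum>i\<in>UNIV. (R2 i x + R3 i x) * \<psi> x))"
    proof -
      have "(LINT x|lborel. (\<Sum>i\<in>UNIV. (R2 i x + R3 i x) * \<psi> x)) = (\<Sum>i\<in>UNIV. LINT x|lborel. (R2 i x + R3 i x) * \<psi> x)"
        by (rule Bochner_Integration.integral_sum) (rule iR)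
      moreover have "integrable lborel (\<lambda>x. \<Sum>i\<in>UNIV. (R2 i x + R3 i x) * \<psi> x)"
        by (rule Bochner_Integration.integrable_sum) (rule iR)
      ultimately show ?thesis by (subst Bochner_Integration.integral_add[OF iJ]) simp_all
    qed
    also have "\<dots> = (LINT x|lborel. w x * \<psi> x)"
      by (simp add: w_def algebra_simps sum_distrib_left)
    finally show "(LINT x|lborel. u x * list_deriv l \<psi> x) = (-1) ^ length l * (LINT x|lborel. w x * \<psi> x)" .
  qed
  then show ?thesis using wLp by blast
qed

text \<open>Each step down in the order applies \<open>lower_order_weak_deriv\<close> between the neighbourhood reached so far and a smaller
  one.\<close>

lemma local_weak_derivs:
  fixes \<Omega> :: "(real^'n::finite) set"
  assumes P: "P \<ge> 1" and \<Omega>: "open \<Omega>" "bounded \<Omega>" "segment_property \<Omega>" and u: "locally_integrable \<Omega> u"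
    and top: "\<And>l. length l = k \<Longrightarrow> \<exists>v\<in>borel_Lp P \<Omega>. borel_weak_deriv \<Omega> l u v"
    and "m \<le> k" and x: "x \<in> closure \<Omega>"
  shows "\<exists>V. open V \<and> x \<in> V \<and>
      (\<forall>l. length l = k - m \<longrightarrow> (\<exists>v\<in>borel_Lp P (V \<inter> \<Omega>). borel_weak_deriv (V \<inter> \<Omega>) l u v))"
  using assms(7)
proof (induction m)
  case 0
  then show ?case using top by (intro exI[of _ UNIV]) auto
next
  case (Suc m)
  then obtain N where N: "open N" "x \<in> N"
    "\<And>l. length l = k - m \<Longrightarrow> \<exists>v\<in>borel_Lp P (N \<inter> \<Omega>). borel_weak_deriv (N \<inter> \<Omega>) l u v"
    by auto
  obtain V d where V: "open V" "x \<in> V" "V \<subseteq> N"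
    "\<And>s. 0 < s \<Longrightarrow> s \<le> 1 \<Longrightarrow> \<exists>\<rho>>0. \<forall>z\<in>V \<inter> \<Omega>. cball (z - s *\<^sub>R d) \<rho> \<subseteq> N \<inter> \<Omega>"
    using \<Omega>(3) x N(1,2) unfolding segment_property_def by meson
  show ?case
  proof (intro exI[of _ V] conjI allI impI V(1,2))
    fix l :: "'n list" assume "length l = k - Suc m"
    then have l: "length (l @ [i]) = k - m" for i using Suc.prems by simp
    obtain v where v: "\<And>i. v i \<in> borel_Lp P (N \<inter> \<Omega>)" "\<And>i. borel_weak_deriv (N \<inter> \<Omega>) (l @ [i]) u (v i)"
      using N(3)[OF l] by metis
    show "\<exists>v\<in>borel_Lp P (V \<inter> \<Omega>). borel_weak_deriv (V \<inter> \<Omega>) l u v"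
    proof (rule lower_order_weak_deriv[OF P _ _ _ _ V(4) _ v])
      show "open (N \<inter> \<Omega>)" "open (V \<inter> \<Omega>)" using N V \<Omega> by auto
      show "bounded (N \<inter> \<Omega>)" using \<Omega>(2) by (rule bounded_subset) blast
      show "V \<inter> \<Omega> \<subseteq> N \<inter> \<Omega>" using V(3) by blast
      show "locally_integrable (N \<inter> \<Omega>) u" using u by (rule locally_integrable_mono) blast
    qed
  qed
qed

lemma local_weak_derivs_upto:
  fixes \<Omega> :: "(real^'n::finite) set"
  assumes P: "P \<ge> 1" and \<Omega>: "open \<Omega>" "bounded \<Omega>" "segment_property \<Omega>" and u: "locally_integrable \<Omega> u"
    and top: "\<And>l. length l = k \<Longrightarrow> \<exists>v\<in>borel_Lp P \<Omega>. borel_weak_deriv \<Omega> l u v"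
    and x: "x \<in> closure \<Omega>"
  obtains V where "open V" "x \<in> V"
    "\<And>l. length l \<le> k \<Longrightarrow> \<exists>v\<in>borel_Lp P (V \<inter> \<Omega>). borel_weak_deriv (V \<inter> \<Omega>) l u v"
proof -
  have "\<forall>m. \<exists>V. m \<le> k \<longrightarrow> open V \<and> x \<in> V \<and>
      (\<forall>l. length l = k - m \<longrightarrow> (\<exists>v\<in>borel_Lp P (V \<inter> \<Omega>). borel_weak_deriv (V \<inter> \<Omega>) l u v))"
    using local_weak_derivs[OF P \<Omega> u top _ x] by blast
  then obtain V where V: "\<And>m. m \<le> k \<Longrightarrow> open (V m) \<and> x \<in> V m \<and>
      (\<forall>l. length l = k - m \<longrightarrow> (\<exists>v\<in>borel_Lp P (V m \<inter> \<Omega>). borel_weak_deriv (V m \<inter> \<Omega>) l u v))" by metis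
  let ?V = "\<Inter>m\<in>{..k}. V m"
  show ?thesis
  proof (rule that)
    show o: "open ?V" using V by (intro open_INT) auto
    show "x \<in> ?V" using V by auto
    fix l :: "'n list" assume l: "length l \<le> k"
    let ?m = "k - length l"
    have m: "?m \<le> k" "length l = k - ?m" using l by auto
    obtain v where v: "v \<in> borel_Lp P (V ?m \<inter> \<Omega>)" "borel_weak_deriv (V ?m \<inter> \<Omega>) l u v"
      using V[OF m(1)] m(2) by metis
    have sub: "?V \<inter> \<Omega> \<subseteq> V ?m \<inter> \<Omega>" using m(1) by auto
    show "\<exists>v\<in>borel_Lp P (?V \<inter> \<Omega>). borel_weak_deriv (?V \<inter> \<Omega>) l u v"
    proof (rule bexI[of _ v])
      show "borel_weak_deriv (?V \<inter> \<Omega>) l u v" by (rule borel_weak_deriv_mono[OF v(2) sub])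
      show "v \<in> borel_Lp P (?V \<inter> \<Omega>)" using o \<Omega>(1) by (intro borel_Lp_mono[OF v(1) sub]) auto
    qed
  qed
qed

section \<open>Localization\<close>

text \<open>Sobolev functions of order \<open>m\<close> vanishing, with all their derivatives, outside \<open>S\<close>. The
  recursion over first derivatives makes the product rule a simple induction.\<close>

primrec supported_sobolev :: "nat \<Rightarrow> real \<Rightarrow> (real^'n::finite) set \<Rightarrow> (real^'n) set \<Rightarrow> (real^'n \<Rightarrow> real) \<Rightarrow> bool" where
  "supported_sobolev 0 P \<Omega> S u \<longleftrightarrow> u \<in> borel_Lp P \<Omega> \<and> (\<forall>x. x \<notin> S \<longrightarrow> u x = 0)"
| "supported_sobolev (Suc m) P \<Omega> S u \<longleftrightarrow> u \<in> borel_Lp P \<Omega> \<and> (\<forall>x. x \<notin> S \<longrightarrow> u x = 0) \<and>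
     (\<forall>i. \<exists>v. borel_weak_deriv \<Omega> [i] u v \<and> supported_sobolev m P \<Omega> S v)"

lemma supported_sobolev_Lp:
  assumes "supported_sobolev m P \<Omega> S u"
  shows "u \<in> borel_Lp P \<Omega>" "\<And>x. x \<notin> S \<Longrightarrow> u x = 0"
  using assms by (cases m; simp)+

lemma supported_sobolev_Suc_imp: "supported_sobolev (Suc m) P \<Omega> S u \<Longrightarrow> supported_sobolev m P \<Omega> S u"
proof (induction m arbitrary: u)
  case (Suc m)
  show ?case unfolding supported_sobolev.simps(2)[of m]
  proof (intro conjI allI)
    fix i
    obtain v where "borel_weak_deriv \<Omega> [i] u v" "supported_sobolev (Suc m) P \<Omega> S v"
      using Suc.prems unfolding supported_sobolev.simps(2)[of "Suc m"] by blast
    then show "\<exists>v. borel_weak_deriv \<Omega> [i] u v \<and> supported_sobolev m P \<Omega> S v" using Suc.IH by blast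
  qed (use supported_sobolev_Lp[OF Suc.prems] in auto)
qed simp

lemma borel_weak_deriv_add:
  assumes "locally_integrable \<Omega> f" "locally_integrable \<Omega> g" "locally_integrable \<Omega> F" "locally_integrable \<Omega> G"
    and d: "borel_weak_deriv \<Omega> l f F" "borel_weak_deriv \<Omega> l g G"
  shows "borel_weak_deriv \<Omega> l (\<lambda>x. f x + g x) (\<lambda>x. F x + G x)"
  unfolding borel_weak_deriv_def
proof (intro allI impI)
  fix \<phi> assume t: "test_function \<Omega> \<phi>"
  note t' = test_function_list_deriv[OF t, of l]
  have "(LINT x|lborel. (f x + g x) * list_deriv l \<phi> x)
     = (LINT x|lborel. f x * list_deriv l \<phi> x) + (LINT x|lborel. g x * list_deriv l \<phi> x)"
    unfolding distrib_right by (intro Bochner_Integration.integral_add locally_integrable_times_test[OF _ t'] assms)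
  also have "\<dots> = (-1) ^ length l * (LINT x|lborel. F x * \<phi> x) + (-1) ^ length l * (LINT x|lborel. G x * \<phi> x)"
    using d t unfolding borel_weak_deriv_def by simp
  also have "\<dots> = (-1) ^ length l * ((LINT x|lborel. F x * \<phi> x) + (LINT x|lborel. G x * \<phi> x))"
    by (simp add: distrib_left)
  also have "(LINT x|lborel. F x * \<phi> x) + (LINT x|lborel. G x * \<phi> x) = (LINT x|lborel. (F x + G x) * \<phi> x)"
    unfolding distrib_right by (intro Bochner_Integration.integral_add[symmetric] locally_integrable_times_test[OF _ t] assms)
  finally show "(LINT x|lborel. (f x + g x) * list_deriv l \<phi> x) = (-1) ^ length l * (LINT x|lborel. (F x + G x) * \<phi> x)" .
qed

lemma supported_sobolev_add:
  assumes P: "P \<ge> 1" and b: "bounded \<Omega>" "\<Omega> \<in> sets borel"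
  shows "supported_sobolev m P \<Omega> S u \<Longrightarrow> supported_sobolev m P \<Omega> S v \<Longrightarrow> supported_sobolev m P \<Omega> S (\<lambda>x. u x + v x)"
proof (induction m arbitrary: u v)
  case 0
  then show ?case using borel_Lp_add[OF P _ _ b(2)] by auto
next
  case (Suc m)
  note u = supported_sobolev_Lp[OF Suc.prems(1)] and v = supported_sobolev_Lp[OF Suc.prems(2)]
  show ?case unfolding supported_sobolev.simps(2)
  proof (intro conjI allI impI)
    show "(\<lambda>x. u x + v x) \<in> borel_Lp P \<Omega>" by (rule borel_Lp_add[OF P u(1) v(1) b(2)])
    show "u x + v x = 0" if "x \<notin> S" for x using u(2) v(2) that by simp
    fix i
    obtain u' where u': "borel_weak_deriv \<Omega> [i] u u'" "supported_sobolev m P \<Omega> S u'" using Suc.prems(1) by auto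
    obtain v' where v': "borel_weak_deriv \<Omega> [i] v v'" "supported_sobolev m P \<Omega> S v'" using Suc.prems(2) by auto
    note li = borel_Lp_locally_integrable[OF P b(1) _ b(2)]
    show "\<exists>w. borel_weak_deriv \<Omega> [i] (\<lambda>x. u x + v x) w \<and> supported_sobolev m P \<Omega> S w"
      using borel_weak_deriv_add[OF li[OF u(1)] li[OF v(1)] li[OF supported_sobolev_Lp(1)[OF u'(2)]]
          li[OF supported_sobolev_Lp(1)[OF v'(2)]] u'(1) v'(1)] Suc.IH[OF u'(2) v'(2)] by blast
  qed
qed

lemma borel_Lp_cong_AE:
  assumes "v \<in> borel_Lp P \<Omega>" and [measurable]: "u \<in> borel_measurable borel" "\<Omega> \<in> sets borel"
    and ae: "AE x in lborel. x \<in> \<Omega> \<longrightarrow> u x = v x"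
  shows "u \<in> borel_Lp P \<Omega>"
proof -
  note [measurable] = borel_LpD(1)[OF assms(1)]
  have "integrable lborel (\<lambda>x. indicator \<Omega> x * \<bar>u x\<bar> powr P) \<longleftrightarrow> integrable lborel (\<lambda>x. indicator \<Omega> x * \<bar>v x\<bar> powr P)"
    by (rule integrable_cong_AE) (use ae in \<open>auto elim!: eventually_mono simp: indicator_def\<close>)
  then show ?thesis using borel_LpD(2)[OF assms(1)] by (simp add: borel_Lp_def)
qed

lemma weak_derivs_imp_supported_sobolev:
  fixes G :: "(real^'n::finite) set"
  assumes P: "P \<ge> 1" and G: "open G" "bounded G"
    and d: "\<And>l. length l \<le> k \<Longrightarrow> \<exists>v\<in>borel_Lp P G. borel_weak_deriv G l u v"
  shows "length l + m \<le> k \<Longrightarrow> v \<in> borel_Lp P G \<Longrightarrow> borel_weak_deriv G l u v \<Longrightarrow> supported_sobolev m P G UNIV v"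
proof (induction m arbitrary: l v)
  case (Suc m)
  show ?case unfolding supported_sobolev.simps(2)
  proof (intro conjI allI impI)
    fix i
    have len: "length (l @ [i]) \<le> k" using Suc.prems(1) by simp
    obtain v' where v': "v' \<in> borel_Lp P G" "borel_weak_deriv G (l @ [i]) u v'" using d[OF len] by auto
    have "borel_weak_deriv G [i] v v'" unfolding borel_weak_deriv_def
    proof (intro allI impI)
      fix \<phi> assume t: "test_function G \<phi>"
      have "(-1) ^ length l * (LINT x|lborel. v x * partial_deriv i \<phi> x)
          = (LINT x|lborel. u x * list_deriv l (partial_deriv i \<phi>) x)"
        using Suc.prems(3) test_function_partial[OF t] unfolding borel_weak_deriv_def by simp
      also have "\<dots> = (LINT x|lborel. u x * list_deriv (l @ [i]) \<phi> x)" by (simp add: list_deriv_append)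
      also have "\<dots> = (-1) ^ length l * (- (LINT x|lborel. v' x * \<phi> x))"
        using v'(2) t unfolding borel_weak_deriv_def by simp
      finally have "(LINT x|lborel. v x * partial_deriv i \<phi> x) = - (LINT x|lborel. v' x * \<phi> x)"
        by (simp only: mult_cancel_left power_eq_0_iff) simp
      then show "(LINT x|lborel. v x * list_deriv [i] \<phi> x) = (-1) ^ length [i] * (LINT x|lborel. v' x * \<phi> x)" by simp
    qed
    moreover have "supported_sobolev m P G UNIV v'"
      by (rule Suc.IH[OF _ v']) (use Suc.prems(1) in simp)
    ultimately show "\<exists>v'. borel_weak_deriv G [i] v v' \<and> supported_sobolev m P G UNIV v'" by blast
  qed (use Suc.prems in auto)
qed simp

text \<open>The weak derivative of order zero equals \<open>u\<close> almost everywhere, so \<open>u\<close> itself is in \<open>L\<^sup>p\<close>.\<close>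

lemma weak_derivs_imp_supported_sobolev_self:
  fixes G :: "(real^'n::finite) set"
  assumes P: "P \<ge> 1" and G: "open G" "bounded G" and u: "locally_integrable G u"
    and d: "\<And>l. length l \<le> k \<Longrightarrow> \<exists>v\<in>borel_Lp P G. borel_weak_deriv G l u v"
  shows "supported_sobolev k P G UNIV u"
proof -
  have Gb: "G \<in> sets borel" using G by simp
  have self: "borel_weak_deriv G [] u u" by (simp add: borel_weak_deriv_def)
  obtain v where v: "v \<in> borel_Lp P G" "borel_weak_deriv G [] u v" using d[of "[]"] by auto
  have "AE x in lborel. x \<in> G \<longrightarrow> u x = v x"
    by (rule borel_weak_deriv_unique[OF G(1) u borel_Lp_locally_integrable[OF P G(2) v(1) Gb] self v(2)])
  then have "u \<in> borel_Lp P G"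
    using u by (intro borel_Lp_cong_AE[OF v(1) _ Gb]) (auto simp: locally_integrable_def)
  then show ?thesis using weak_derivs_imp_supported_sobolev[OF P G d, where l = "[]" and m = k] self by simp
qed

text \<open>If \<open>\<phi>\<close> is a test function on \<open>\<Omega>\<close>, then \<open>\<eta> \<phi>\<close> is one on \<open>V \<inter> \<Omega>\<close>. Hence weak derivatives of \<open>u\<close> on \<open>V \<inter> \<Omega>\<close> yield
  weak derivatives of \<open>\<eta> u\<close> on all of \<open>\<Omega>\<close>.\<close>

lemma supported_sobolev_mult:
  fixes \<Omega> V :: "(real^'n::finite) set"
  assumes P: "P \<ge> 1" and \<Omega>: "open \<Omega>" "bounded \<Omega>" and V: "open V" and K: "compact K" "K \<subseteq> V"
    and "supported_sobolev m P (V \<inter> \<Omega>) UNIV u" "smooth \<eta>" "\<And>x. x \<notin> K \<Longrightarrow> \<eta> x = 0"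
  shows "supported_sobolev m P \<Omega> K (\<lambda>x. \<eta> x * u x)"
  using assms(7-9)
proof (induction m arbitrary: u \<eta>)
  case 0
  have t: "test \<eta>" using 0 K(1) by (auto simp: test_function_def)
  obtain B where B: "\<And>x. \<bar>\<eta> x\<bar> \<le> B" using test_bounded[OF t] by blast
  have Vb: "V \<inter> \<Omega> \<in> sets borel" using V \<Omega> by auto
  have "(\<lambda>x. \<eta> x * u x) \<in> borel_Lp P (V \<inter> \<Omega>)"
    by (rule borel_Lp_bounded_mult[OF P _ Vb smooth_borel[OF 0(2)] B]) (use 0 in simp)
  moreover have "indicator (V \<inter> \<Omega>) x * \<bar>\<eta> x * u x\<bar> powr P = indicator \<Omega> x * \<bar>\<eta> x * u x\<bar> powr P" for x
    using 0(3)[of x] K(2) P by (cases "x \<in> K") (auto simp: indicator_def)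
  ultimately show ?case using 0(3) by (simp add: borel_Lp_def)
next
  case (Suc m)
  have u: "supported_sobolev m P (V \<inter> \<Omega>) UNIV u" by (rule supported_sobolev_Suc_imp[OF Suc.prems(1)])
  have \<eta>u: "supported_sobolev m P \<Omega> K (\<lambda>x. \<eta> x * u x)" by (rule Suc.IH[OF u Suc.prems(2,3)])
  have bV: "bounded (V \<inter> \<Omega>)" using \<Omega>(2) by (rule bounded_subset) blast
  have Vb: "V \<inter> \<Omega> \<in> sets borel" and \<Omega>b: "\<Omega> \<in> sets borel" using V \<Omega> by auto
  have liu: "locally_integrable (V \<inter> \<Omega>) u"
    by (rule borel_Lp_locally_integrable[OF P bV supported_sobolev_Lp(1)[OF u] Vb])
  show ?case unfolding supported_sobolev.simps(2)
  proof (intro conjI allI impI)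
    show "(\<lambda>x. \<eta> x * u x) \<in> borel_Lp P \<Omega>" by (rule supported_sobolev_Lp(1)[OF \<eta>u])
    show "\<eta> x * u x = 0" if "x \<notin> K" for x by (rule supported_sobolev_Lp(2)[OF \<eta>u that])
    fix i
    obtain v where v: "borel_weak_deriv (V \<inter> \<Omega>) [i] u v" "supported_sobolev m P (V \<inter> \<Omega>) UNIV v"
      using Suc.prems(1) by auto
    have p0: "partial_deriv i \<eta> x = 0" if "x \<notin> K" for x
      using list_deriv_zero_off_closed[OF compact_imp_closed[OF K(1)], of \<eta> x "[i]"] Suc.prems(3) that by simp
    have "supported_sobolev m P \<Omega> K (\<lambda>x. \<eta> x * v x + partial_deriv i \<eta> x * u x)"
      by (intro supported_sobolev_add[OF P \<Omega>(2) \<Omega>b] Suc.IH v(2) u Suc.prems smooth_partial p0)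
    moreover have "borel_weak_deriv \<Omega> [i] (\<lambda>x. \<eta> x * u x) (\<lambda>x. \<eta> x * v x + partial_deriv i \<eta> x * u x)"
      unfolding borel_weak_deriv_def
    proof (intro allI impI)
      fix \<phi> assume t: "test_function \<Omega> \<phi>"
      obtain L where L: "compact L" "L \<subseteq> \<Omega>" "\<And>x. x \<notin> L \<Longrightarrow> \<phi> x = 0" using testD(2)[OF t] by auto
      have loc: "test_function (V \<inter> \<Omega>) (\<lambda>x. \<theta> x * \<phi> x)" if "smooth \<theta>" "\<And>x. x \<notin> K \<Longrightarrow> \<theta> x = 0" for \<theta>
        unfolding test_function_def
        using smooth_mult[OF that(1) testD(1)[OF t]] K L that(2) compact_Int[OF K(1) L(1)]
        by (intro conjI exI[of _ "K \<inter> L"]) auto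
      have t1: "test_function (V \<inter> \<Omega>) (\<lambda>x. \<eta> x * \<phi> x)" by (rule loc[OF Suc.prems(2,3)])
      have t2: "test_function (V \<inter> \<Omega>) (\<lambda>x. partial_deriv i \<eta> x * \<phi> x)" by (rule loc[OF smooth_partial[OF Suc.prems(2)] p0])
      have pd: "partial_deriv i (\<lambda>x. \<eta> x * \<phi> x) = (\<lambda>x. partial_deriv i \<eta> x * \<phi> x + \<eta> x * partial_deriv i \<phi> x)"
        by (intro partial_deriv_mult smooth_diffble Suc.prems(2) testD(1)[OF t])
      note it = locally_integrable_times_test[OF liu]
      have liv: "locally_integrable (V \<inter> \<Omega>) v"
        by (rule borel_Lp_locally_integrable[OF P bV supported_sobolev_Lp(1)[OF v(2)] Vb])
      have "(LINT x|lborel. \<eta> x * u x * list_deriv [i] \<phi> x)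
          = (LINT x|lborel. u x * partial_deriv i (\<lambda>x. \<eta> x * \<phi> x) x - u x * (partial_deriv i \<eta> x * \<phi> x))"
        unfolding pd by (simp add: algebra_simps)
      also have "\<dots> = (LINT x|lborel. u x * partial_deriv i (\<lambda>x. \<eta> x * \<phi> x) x) - (LINT x|lborel. u x * (partial_deriv i \<eta> x * \<phi> x))"
        by (rule Bochner_Integration.integral_diff[OF it[OF test_function_partial[OF t1]] it[OF t2]])
      also have "(LINT x|lborel. u x * partial_deriv i (\<lambda>x. \<eta> x * \<phi> x) x) = - (LINT x|lborel. v x * (\<eta> x * \<phi> x))"
        using v(1) t1 unfolding borel_weak_deriv_def by fastforce
      also have "- (LINT x|lborel. v x * (\<eta> x * \<phi> x)) - (LINT x|lborel. u x * (partial_deriv i \<eta> x * \<phi> x))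
         = - ((LINT x|lborel. v x * (\<eta> x * \<phi> x)) + (LINT x|lborel. u x * (partial_deriv i \<eta> x * \<phi> x)))" by simp
      also have "(LINT x|lborel. v x * (\<eta> x * \<phi> x)) + (LINT x|lborel. u x * (partial_deriv i \<eta> x * \<phi> x))
         = (LINT x|lborel. v x * (\<eta> x * \<phi> x) + u x * (partial_deriv i \<eta> x * \<phi> x))"
        by (rule Bochner_Integration.integral_add[OF locally_integrable_times_test[OF liv t1] it[OF t2], symmetric])
      also have "\<dots> = (LINT x|lborel. (\<eta> x * v x + partial_deriv i \<eta> x * u x) * \<phi> x)" by (simp add: algebra_simps)
      finally show "(LINT x|lborel. \<eta> x * u x * list_deriv [i] \<phi> x)
          = (-1) ^ length [i] * (LINT x|lborel. (\<eta> x * v x + partial_deriv i \<eta> x * u x) * \<phi> x)" by simp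
    qed
    ultimately show "\<exists>v. borel_weak_deriv \<Omega> [i] (\<lambda>x. \<eta> x * u x) v \<and> supported_sobolev m P \<Omega> K v" by blast
  qed
qed

lemma supported_sobolev_derivs:
  "supported_sobolev m P \<Omega> S f \<Longrightarrow> length l \<le> m \<Longrightarrow>
    \<exists>F\<in>borel_Lp P \<Omega>. (\<forall>x. x \<notin> S \<longrightarrow> F x = 0) \<and> borel_weak_deriv \<Omega> l f F"
proof (induction l arbitrary: m f)
  case Nil
  then show ?case using supported_sobolev_Lp[OF Nil(1)] by (intro bexI[of _ f]) (auto simp: borel_weak_deriv_def)
next
  case (Cons i l)
  then obtain m' where m: "m = Suc m'" by (cases m) auto
  obtain v where v: "borel_weak_deriv \<Omega> [i] f v" "supported_sobolev m' P \<Omega> S v" using Cons.prems(1) m by auto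
  obtain F where F: "F \<in> borel_Lp P \<Omega>" "\<And>x. x \<notin> S \<Longrightarrow> F x = 0" "borel_weak_deriv \<Omega> l v F"
    using Cons.IH[OF v(2)] Cons.prems(2) m by auto
  have "borel_weak_deriv \<Omega> (i # l) f F" unfolding borel_weak_deriv_def
  proof (intro allI impI)
    fix \<phi> assume t: "test_function \<Omega> \<phi>"
    have "(LINT x|lborel. f x * partial_deriv i (list_deriv l \<phi>) x) = - (LINT x|lborel. v x * list_deriv l \<phi> x)"
      using v(1) test_function_list_deriv[OF t] unfolding borel_weak_deriv_def by fastforce
    also have "(LINT x|lborel. v x * list_deriv l \<phi> x) = (-1) ^ length l * (LINT x|lborel. F x * \<phi> x)"
      using F(3) t unfolding borel_weak_deriv_def by blast
    finally show "(LINT x|lborel. f x * list_deriv (i # l) \<phi> x) = (-1) ^ length (i # l) * (LINT x|lborel. F x * \<phi> x)" by simp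
  qed
  then show ?case using F(1,2) by blast
qed

section \<open>Approximation\<close>

lemma list_deriv_affine:
  assumes "smooth f"
  shows "list_deriv l (\<lambda>x. f (a + c *\<^sub>R x)) = (\<lambda>x. c ^ length l * list_deriv l f (a + c *\<^sub>R x))"
proof (induction l)
  case (Cons i l)
  have s: "smooth (list_deriv l f)" by (rule smooth_list_deriv[OF assms])
  show ?case unfolding list_deriv_Cons Cons
    by (subst partial_deriv_cmult[OF smooth_diffble[OF smooth_affine[OF s]]])
      (simp add: partial_deriv_affine[OF smooth_diffble[OF s]] mult_ac)
qed simp

text \<open>Weak derivatives are unique almost everywhere, so it makes no difference that \<open>F\<close> is chosen after \<open>\<epsilon>\<close>.\<close>

definition approximable :: "nat \<Rightarrow> real \<Rightarrow> (real^'n::finite) set \<Rightarrow> (real^'n \<Rightarrow> real) \<Rightarrow> bool" where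
  "approximable k P \<Omega> f \<longleftrightarrow> f \<in> borel_Lp P \<Omega> \<and> (\<forall>\<epsilon>>0. \<exists>g. smooth g \<and> (\<forall>l. length l = k \<longrightarrow>
     (\<exists>F\<in>borel_Lp P \<Omega>. borel_weak_deriv \<Omega> l f F \<and>
       (Lp_mass_on \<Omega> P (\<lambda>x. F x - list_deriv l g x)) \<le> ennreal \<epsilon>)))"

lemma approximable_zero: "P \<ge> 1 \<Longrightarrow> approximable k P \<Omega> (\<lambda>x. 0)"
  unfolding approximable_def
  by (intro conjI allI impI exI[of _ "\<lambda>x. 0"] bexI[of _ "\<lambda>x. 0"])
    (auto simp: borel_Lp_zero smooth_const borel_weak_deriv_def list_deriv_const0)

lemma approximable_add:
  assumes P: "P \<ge> 1" and b: "bounded \<Omega>" and [measurable]: "\<Omega> \<in> sets borel"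
    and f: "approximable k P \<Omega> f" and g: "approximable k P \<Omega> g"
  shows "approximable k P \<Omega> (\<lambda>x. f x + g x)"
  unfolding approximable_def
proof (intro conjI allI impI)
  have fL: "f \<in> borel_Lp P \<Omega>" and gL: "g \<in> borel_Lp P \<Omega>" using f g by (auto simp: approximable_def)
  show "(\<lambda>x. f x + g x) \<in> borel_Lp P \<Omega>" by (rule borel_Lp_add[OF P fL gL]) simp
  note li = borel_Lp_locally_integrable[OF P b _ assms(3)]
  fix \<epsilon> :: real assume \<epsilon>: "\<epsilon> > 0"
  define c where "c = (2::real) powr P"
  have c: "c > 0" by (simp add: c_def)
  let ?e = "\<epsilon> / (2 * c)"
  have e: "?e > 0" using \<epsilon> c by simp
  obtain f' where f': "smooth f'" "\<And>l. length l = k \<Longrightarrow> \<exists>F\<in>borel_Lp P \<Omega>. borel_weak_deriv \<Omega> l f F \<and>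
       (Lp_mass_on \<Omega> P (\<lambda>x. F x - list_deriv l f' x)) \<le> ennreal ?e"
    using f e unfolding approximable_def by blast
  obtain g' where g': "smooth g'" "\<And>l. length l = k \<Longrightarrow> \<exists>F\<in>borel_Lp P \<Omega>. borel_weak_deriv \<Omega> l g F \<and>
       (Lp_mass_on \<Omega> P (\<lambda>x. F x - list_deriv l g' x)) \<le> ennreal ?e"
    using g e unfolding approximable_def by blast
  show "\<exists>h. smooth h \<and> (\<forall>l. length l = k \<longrightarrow> (\<exists>F\<in>borel_Lp P \<Omega>. borel_weak_deriv \<Omega> l (\<lambda>x. f x + g x) F \<and>
       (Lp_mass_on \<Omega> P (\<lambda>x. F x - list_deriv l h x)) \<le> ennreal \<epsilon>))"
  proof (intro exI[of _ "\<lambda>x. f' x + g' x"] conjI allI impI)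
    show "smooth (\<lambda>x. f' x + g' x)" by (rule smooth_add[OF f'(1) g'(1)])
    fix l :: "'a list" assume l: "length l = k"
    obtain F where F: "F \<in> borel_Lp P \<Omega>" "borel_weak_deriv \<Omega> l f F"
       "Lp_mass_on \<Omega> P (\<lambda>x. F x - list_deriv l f' x) \<le> ennreal ?e"
      using f'(2)[OF l] by blast
    obtain G where G: "G \<in> borel_Lp P \<Omega>" "borel_weak_deriv \<Omega> l g G"
       "Lp_mass_on \<Omega> P (\<lambda>x. G x - list_deriv l g' x) \<le> ennreal ?e"
      using g'(2)[OF l] by blast
    note [measurable] = borel_LpD(1)[OF F(1)] borel_LpD(1)[OF G(1)]
      smooth_borel[OF smooth_list_deriv[OF f'(1)]] smooth_borel[OF smooth_list_deriv[OF g'(1)]]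
    let ?a = "\<lambda>x. indicator \<Omega> x * \<bar>F x - list_deriv l f' x\<bar> powr P"
    let ?b = "\<lambda>x. indicator \<Omega> x * \<bar>G x - list_deriv l g' x\<bar> powr P"
    have "Lp_mass_on \<Omega> P (\<lambda>x. (F x + G x) - list_deriv l (\<lambda>x. f' x + g' x) x)
        \<le> (\<integral>\<^sup>+x. ennreal c * (ennreal (?a x) + ennreal (?b x)) \<partial>lborel)"
    proof (rule nn_integral_mono)
      fix x
      have "\<bar>(F x + G x) - list_deriv l (\<lambda>x. f' x + g' x) x\<bar> = \<bar>(F x - list_deriv l f' x) + (G x - list_deriv l g' x)\<bar>"
        by (simp add: list_deriv_add[OF f'(1) g'(1)])
      then have "\<bar>(F x + G x) - list_deriv l (\<lambda>x. f' x + g' x) x\<bar> powr P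
          \<le> c * (\<bar>F x - list_deriv l f' x\<bar> powr P + \<bar>G x - list_deriv l g' x\<bar> powr P)"
        unfolding c_def using powr_add_le[OF P] by metis
      then have "indicator \<Omega> x * \<bar>(F x + G x) - list_deriv l (\<lambda>x. f' x + g' x) x\<bar> powr P \<le> c * (?a x + ?b x)"
        by (cases "x \<in> \<Omega>") auto
      then have "ennreal (indicator \<Omega> x * \<bar>(F x + G x) - list_deriv l (\<lambda>x. f' x + g' x) x\<bar> powr P) \<le> ennreal (c * (?a x + ?b x))"
        by (rule ennreal_leI)
      also have "\<dots> = ennreal c * (ennreal (?a x) + ennreal (?b x))"
        using c by (simp add: ennreal_mult ennreal_plus)
      finally show "ennreal (indicator \<Omega> x * \<bar>(F x + G x) - list_deriv l (\<lambda>x. f' x + g' x) x\<bar> powr P)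
          \<le> ennreal c * (ennreal (?a x) + ennreal (?b x))" .
    qed
    also have "\<dots> = ennreal c * ((\<integral>\<^sup>+x. ennreal (?a x) \<partial>lborel) + (\<integral>\<^sup>+x. ennreal (?b x) \<partial>lborel))"
      by (simp add: nn_integral_cmult nn_integral_add)
    also have "\<dots> \<le> ennreal c * (ennreal ?e + ennreal ?e)" by (intro mult_left_mono add_mono F(3) G(3)) auto
    also have "\<dots> = ennreal c * ennreal (?e + ?e)" using e by (subst ennreal_plus) auto
    also have "\<dots> = ennreal (c * (?e + ?e))" by (rule ennreal_mult[symmetric]) (use c e in auto)
    also have "c * (?e + ?e) = \<epsilon>" using c by simp
    finally show "\<exists>H\<in>borel_Lp P \<Omega>. borel_weak_deriv \<Omega> l (\<lambda>x. f x + g x) H \<and>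
       (Lp_mass_on \<Omega> P (\<lambda>x. H x - list_deriv l (\<lambda>x. f' x + g' x) x)) \<le> ennreal \<epsilon>"
      using borel_Lp_add[OF P F(1) G(1) assms(3)]
        borel_weak_deriv_add[OF li[OF fL] li[OF gL] li[OF F(1)] li[OF G(1)] F(2) G(2)]
      by (intro bexI[of _ "\<lambda>x. F x + G x"]) auto
  qed
qed

text \<open>Mollify with a kernel concentrated near \<open>s d\<close>: at points of \<open>V \<inter> \<Omega>\<close> it only sees values inside
  \<open>\<Omega>\<close>, so that derivatives commute with the mollification, and elsewhere in \<open>\<Omega>\<close> it sees
  only zeros.\<close>

lemma supported_sobolev_approximable:
  fixes \<Omega> V :: "(real^'n::finite) set"
  assumes P: "P \<ge> 1" and \<Omega>: "open \<Omega>" "bounded \<Omega>" and V: "open V" and K: "compact K" "K \<subseteq> V"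
    and seg: "\<And>s. 0 < s \<Longrightarrow> s \<le> 1 \<Longrightarrow> \<exists>\<rho>>0. \<forall>z\<in>V \<inter> \<Omega>. cball (z - s *\<^sub>R d) \<rho> \<subseteq> \<Omega>"
    and f: "supported_sobolev k P \<Omega> K f"
  shows "approximable k P \<Omega> f"
  unfolding approximable_def
proof (intro conjI allI impI)
  have \<Omega>b [measurable]: "\<Omega> \<in> sets borel" using \<Omega> by simp
  show fL: "f \<in> borel_Lp P \<Omega>" by (rule supported_sobolev_Lp(1)[OF f])
  fix \<epsilon> :: real assume \<epsilon>: "\<epsilon> > 0"
  obtain F where F: "\<And>l. length l = k \<Longrightarrow> F l \<in> borel_Lp P \<Omega>" "\<And>l x. length l = k \<Longrightarrow> x \<notin> K \<Longrightarrow> F l x = 0"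
      "\<And>l. length l = k \<Longrightarrow> borel_weak_deriv \<Omega> l f (F l)"
    using supported_sobolev_derivs[OF f] by (metis order_refl)
  define f0 where "f0 x = indicator \<Omega> x * f x" for x
  define F0 where "F0 l x = indicator \<Omega> x * F l x" for l x
  have f0: "f0 \<in> borel_measurable borel" "integrable lborel f0"
    using borel_Lp_extend[OF P \<Omega>(2) fL \<Omega>b] by (auto simp: f0_def[abs_def])
  have F0: "F0 l \<in> borel_measurable borel" "integrable lborel (F0 l)" "integrable lborel (\<lambda>x. \<bar>F0 l x\<bar> powr P)" if "length l = k" for l
    using borel_Lp_extend[OF P \<Omega>(2) F(1)[OF that] \<Omega>b] by (auto simp: F0_def[abs_def])
  let ?L = "{l :: 'n list. length l = k}"
  have finL: "finite ?L" using finite_lists_length_eq[of "UNIV :: 'n set" k] by simp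
  let ?\<tau> = "\<lambda>l \<rho>. \<rho> > 0 \<and> (\<forall>h. norm h \<le> \<rho> \<longrightarrow> Lp_mass P (\<lambda>x. F0 l (x + h) - F0 l x) \<le> ennreal \<epsilon>)"
  have "\<forall>l. \<exists>\<rho>. length l = k \<longrightarrow> ?\<tau> l \<rho>"
  proof
    fix l show "\<exists>\<rho>. length l = k \<longrightarrow> ?\<tau> l \<rho>"
      using translation_continuous_Lp[OF P F0(2,3) \<epsilon>, of l] by (cases "length l = k") auto
  qed
  from choice[OF this] obtain \<tau> where \<tau>0: "\<forall>l. length l = k \<longrightarrow> ?\<tau> l (\<tau> l)" ..
  then have \<tau>: "\<And>l. length l = k \<Longrightarrow> \<tau> l > 0"
      "\<And>l h. length l = k \<Longrightarrow> norm h \<le> \<tau> l \<Longrightarrow> Lp_mass P (\<lambda>x. F0 l (x + h) - F0 l x) \<le> ennreal \<epsilon>"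
    by simp_all
  obtain r0 K' where r0: "r0 > 0" "K' \<subseteq> V" "\<And>x y. x \<in> K \<Longrightarrow> dist x y \<le> r0 \<Longrightarrow> y \<in> K'"
    using compact_neighbourhood_in_open[OF K(1) V K(2)] by metis
  define \<rho> where "\<rho> = Min (insert r0 (\<tau> ` ?L))"
  have \<rho>: "\<rho> > 0" "\<rho> \<le> r0" "\<And>l. length l = k \<Longrightarrow> \<rho> \<le> \<tau> l"
    using finL r0(1) \<tau>(1) by (auto simp: \<rho>_def)
  (* The kernel lies in the ball of radius r around s d. The choice of s and r keeps it inside the ball of
     radius \<rho> around 0, where translates are close and the neighbourhood of K is not left. *)
  define s where "s = min 1 (\<rho> / (2 * (norm d + 1)))"
  have nd: "norm d + 1 > 0" by (rule add_nonneg_pos) auto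
  have s: "0 < s" "s \<le> 1" using \<rho>(1) nd by (auto simp: s_def)
  have "s * norm d \<le> \<rho> / (2 * (norm d + 1)) * norm d" by (intro mult_right_mono) (auto simp: s_def)
  also have "\<dots> = \<rho> / 2 * (norm d / (norm d + 1))" by simp
  also have "\<dots> \<le> \<rho> / 2 * 1"
    using \<rho>(1) nd by (intro mult_left_mono) (simp_all add: divide_le_eq)
  finally have sd: "s * norm d \<le> \<rho> / 2" by simp
  obtain \<rho>' where \<rho>': "\<rho>' > 0" "\<And>z. z \<in> V \<inter> \<Omega> \<Longrightarrow> cball (z - s *\<^sub>R d) \<rho>' \<subseteq> \<Omega>" using seg[OF s] by blast
  define r where "r = min \<rho>' (\<rho> / 2)"
  have r: "r > 0" "r \<le> \<rho>'" "r \<le> \<rho> / 2" using \<rho>(1) \<rho>'(1) by (auto simp: r_def)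
  obtain \<psi> :: "real^'n \<Rightarrow> real" where \<psi>: "smooth \<psi>" "\<And>x. \<psi> x \<ge> 0" "\<And>x. x \<notin> cball (s *\<^sub>R d) r \<Longrightarrow> \<psi> x = 0"
    "(LINT x|lborel. \<psi> x) = 1" using mollifier_exists[OF r(1), of "s *\<^sub>R d"] by metis
  have t\<psi>: "test \<psi>" unfolding test_function_def using \<psi>(1,3) by (metis compact_cball subset_UNIV)
  have small: "norm y \<le> \<rho>" if "y \<in> cball (s *\<^sub>R d) r" for y
  proof -
    have "norm y \<le> norm (s *\<^sub>R d) + dist (s *\<^sub>R d) y"
      by (metis dist_norm norm_minus_commute norm_triangle_sub)
    also have "\<dots> \<le> \<rho>" using sd that r(3) s by simp
    finally show ?thesis .
  qed
  define g where "g = average lborel f0 (\<lambda>z. - z) \<psi>"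
  have Dg: "list_deriv l g = average lborel f0 (\<lambda>z. - z) (list_deriv l \<psi>)" for l
    unfolding g_def by (rule average_list_deriv[OF f0(2) _ t\<psi>]) simp
  have D\<psi>0: "list_deriv l \<psi> y = 0" if "y \<notin> cball (s *\<^sub>R d) r" for l y
    by (rule list_deriv_zero_off_closed[OF closed_cball \<psi>(3) that])
  show "\<exists>g. smooth g \<and> (\<forall>l. length l = k \<longrightarrow> (\<exists>F\<in>borel_Lp P \<Omega>. borel_weak_deriv \<Omega> l f F \<and>
       (Lp_mass_on \<Omega> P (\<lambda>x. F x - list_deriv l g x)) \<le> ennreal \<epsilon>))"
  proof (intro exI[of _ g] conjI allI impI)
    show smg: "smooth g" unfolding g_def by (rule average_smooth[OF f0(2) _ t\<psi>]) simp
    fix l :: "'n list" assume l: "length l = k"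
    let ?T = "average lborel (F0 l) (\<lambda>z. - z) \<psi>"
    have eq: "list_deriv l g x = ?T x" if x: "x \<in> \<Omega>" for x
    proof (cases "x \<in> V")
      case True
      define \<theta> where "\<theta> z = \<psi> (x + (-1) *\<^sub>R z)" for z
      have off: "\<theta> z = 0" "list_deriv l \<psi> (x - z) = 0" if "z \<notin> cball (x - s *\<^sub>R d) r" for z
      proof -
        have "x - z \<notin> cball (s *\<^sub>R d) r" using that by (simp add: dist_norm algebra_simps norm_minus_commute)
        then show "\<theta> z = 0" "list_deriv l \<psi> (x - z) = 0" using \<psi>(3) D\<psi>0 by (auto simp: \<theta>_def)
      qed
      have sub: "cball (x - s *\<^sub>R d) r \<subseteq> \<Omega>" using \<rho>'(2)[of x] True x r(2) subset_cball[of r \<rho>' "x - s *\<^sub>R d"] by blast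
      have t\<theta>: "test_function \<Omega> \<theta>" unfolding test_function_def
      proof (intro conjI exI[of _ "cball (x - s *\<^sub>R d) r"] allI impI)
        show "smooth \<theta>" unfolding \<theta>_def[abs_def] by (rule smooth_affine[OF \<psi>(1)])
      qed (use sub off in auto)
      have D\<theta>: "list_deriv l \<theta> z = (-1) ^ length l * list_deriv l \<psi> (x - z)" for z
        unfolding \<theta>_def[abs_def] list_deriv_affine[OF \<psi>(1)] by simp
      have one: "(-1 :: real) ^ length l * (-1) ^ length l = 1" by (simp flip: power_mult_distrib)
      have "list_deriv l g x = (LINT z|lborel. (-1) ^ length l * (f z * list_deriv l \<theta> z))"
        unfolding Dg average_def
      proof (rule Bochner_Integration.integral_cong[OF refl])
        fix z
        show "f0 z * list_deriv l \<psi> (x + - z) = (-1) ^ length l * (f z * list_deriv l \<theta> z)"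
        proof (cases "z \<in> \<Omega>")
          case True
          have "(-1) ^ length l * (f z * list_deriv l \<theta> z) = ((-1) ^ length l * (-1) ^ length l) * (f z * list_deriv l \<psi> (x - z))"
            unfolding D\<theta> by (simp only: mult_ac)
          then show ?thesis using True unfolding one by (auto simp: f0_def)
        next
          case False
          then have "z \<notin> cball (x - s *\<^sub>R d) r" by (rule contra_subsetD[OF sub])
          then have "list_deriv l \<psi> (x - z) = 0" by (rule off(2))
          then show ?thesis unfolding D\<theta> by simp
        qed
      qed
      also have "\<dots> = (-1) ^ length l * ((-1) ^ length l * (LINT z|lborel. F l z * \<theta> z))"
        using F(3)[OF l] t\<theta> unfolding borel_weak_deriv_def by simp
      also have "\<dots> = (LINT z|lborel. F l z * \<theta> z)"
        by (simp only: mult.assoc[symmetric] one mult_1)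
      also have "\<dots> = ?T x" unfolding average_def
      proof (rule Bochner_Integration.integral_cong[OF refl])
        fix z
        show "F l z * \<theta> z = F0 l z * \<psi> (x + - z)"
          using test_function_outside[OF t\<theta>, of z] by (cases "z \<in> \<Omega>") (auto simp: F0_def \<theta>_def)
      qed
      finally show ?thesis .
    next
      case False
      have far: "x - z \<notin> cball (s *\<^sub>R d) r" if "z \<in> K" for z
      proof
        assume "x - z \<in> cball (s *\<^sub>R d) r"
        then have "norm (x - z) \<le> r0" using small \<rho>(2) by (meson order_trans)
        then have "x \<in> K'" using r0(3)[OF that, of x] by (simp add: dist_norm norm_minus_commute)
        then show False using r0(2) False by blast
      qed
      have 1: "f0 z * list_deriv l \<psi> (x + - z) = 0" for z
        using far[of z] D\<psi>0[of "x - z" l] supported_sobolev_Lp(2)[OF f, of z] by (cases "z \<in> K") (auto simp: f0_def)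
      have 2: "F0 l z * \<psi> (x + - z) = 0" for z
        using far[of z] \<psi>(3)[of "x - z"] F(2)[OF l, of z] by (cases "z \<in> K") (auto simp: F0_def)
      show ?thesis unfolding Dg average_def 1 2 ..
    qed
    have "Lp_mass_on \<Omega> P (\<lambda>x. F l x - list_deriv l g x)
        \<le> Lp_mass P (\<lambda>x. ?T x - F0 l x)"
    proof (rule nn_integral_mono)
      fix x show "ennreal (indicator \<Omega> x * \<bar>F l x - list_deriv l g x\<bar> powr P) \<le> ennreal (\<bar>?T x - F0 l x\<bar> powr P)"
        using eq[of x] by (cases "x \<in> \<Omega>") (auto simp: F0_def abs_minus_commute)
    qed
    also have "\<dots> \<le> ennreal \<epsilon>"
    proof (rule mollify_close[OF \<psi>(1,2,4) _ P F0(2,1)[OF l]])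
      show "\<psi> x = 0" if "norm x > \<rho>" for x using small[of x] \<psi>(3)[of x] that by force
      show "Lp_mass P (\<lambda>x. F0 l (x + h) - F0 l x) \<le> ennreal \<epsilon>" if "norm h \<le> \<rho>" for h
        using \<tau>(2)[OF l, of h] \<rho>(3)[OF l] that by simp
    qed
    finally show "\<exists>F\<in>borel_Lp P \<Omega>. borel_weak_deriv \<Omega> l f F \<and>
       (Lp_mass_on \<Omega> P (\<lambda>x. F x - list_deriv l g x)) \<le> ennreal \<epsilon>"
      using F(1,3)[OF l] by blast
  qed
qed

text \<open>The functions \<open>1 - (\<Prod>j\<in>J. 1 - \<eta> j)\<close> take the place of a partition of unity: the product
  vanishes wherever some \<open>\<eta> j\<close> is \<open>1\<close>, and no division is involved.\<close>

lemma approximable_partition: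
  fixes \<Omega> :: "(real^'n::finite) set"
  assumes P: "P \<ge> 1" and \<Omega>: "open \<Omega>" "bounded \<Omega>" and "finite J"
    and "\<And>j. j \<in> J \<Longrightarrow> open (V j)" "\<And>j. j \<in> J \<Longrightarrow> compact (K j)" "\<And>j. j \<in> J \<Longrightarrow> K j \<subseteq> V j"
    and "\<And>j s. j \<in> J \<Longrightarrow> 0 < s \<Longrightarrow> s \<le> 1 \<Longrightarrow> \<exists>\<rho>>0. \<forall>z\<in>V j \<inter> \<Omega>. cball (z - s *\<^sub>R d j) \<rho> \<subseteq> \<Omega>"
    and "\<And>j. j \<in> J \<Longrightarrow> smooth (\<eta> j)" "\<And>j x. j \<in> J \<Longrightarrow> x \<notin> K j \<Longrightarrow> \<eta> j x = 0"
    and "\<And>j. j \<in> J \<Longrightarrow> supported_sobolev k P (V j \<inter> \<Omega>) UNIV u"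
  shows "approximable k P \<Omega> (\<lambda>x. (1 - (\<Prod>j\<in>J. 1 - \<eta> j x)) * u x)"
  using assms(4-)
proof (induction J rule: finite_induct)
  case empty
  then show ?case using approximable_zero[OF P] by simp
next
  case (insert j J)
  let ?p = "\<lambda>x. \<Prod>i\<in>J. 1 - \<eta> i x"
  have "smooth (\<eta> i)" if "i \<in> J" for i using insert.prems(5) that by simp
  then have smp: "smooth ?p" by (intro smooth_prod smooth_diff smooth_const)
  have sm: "smooth (\<lambda>x. \<eta> j x * ?p x)" using insert.prems(5)[of j] smp by (intro smooth_mult) auto
  have ss: "supported_sobolev k P \<Omega> (K j) (\<lambda>x. (\<eta> j x * ?p x) * u x)"
    using insert.prems(6)[of j]
    by (intro supported_sobolev_mult[OF P \<Omega> insert.prems(1)[of j] insert.prems(2)[of j] insert.prems(3)[of j] insert.prems(7)[of j] sm]) auto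
  have a1: "approximable k P \<Omega> (\<lambda>x. (\<eta> j x * ?p x) * u x)"
    by (rule supported_sobolev_approximable[OF P \<Omega> insert.prems(1)[of j] insert.prems(2)[of j] insert.prems(3)[of j] insert.prems(4)[of j] ss]) auto
  have a2: "approximable k P \<Omega> (\<lambda>x. (1 - ?p x) * u x)"
    by (rule insert.IH) (use insert.prems in auto)
  have "(\<lambda>x. (1 - (\<Prod>i\<in>insert j J. 1 - \<eta> i x)) * u x) = (\<lambda>x. (1 - ?p x) * u x + (\<eta> j x * ?p x) * u x)"
    using insert.hyps by (auto simp: algebra_simps)
  then show ?case using approximable_add[OF P \<Omega>(2) _ a2 a1] \<Omega>(1) by simp
qed

text \<open>Finitely many plateaus cover the compact closure of \<open>\<Omega>\<close>, so that the pieces of \<open>approximable_partition\<close> add up to \<open>u\<close>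
  on \<open>\<Omega>\<close>.\<close>

lemma smooth_approximation:
  fixes \<Omega> :: "(real^'n::finite) set"
  assumes P: "P \<ge> 1" and \<Omega>: "open \<Omega>" "bounded \<Omega>" "segment_property \<Omega>" and u: "locally_integrable \<Omega> u"
    and top: "\<And>l. length l = k \<Longrightarrow> \<exists>v\<in>borel_Lp P \<Omega>. borel_weak_deriv \<Omega> l u v" and \<epsilon>: "\<epsilon> > 0"
  shows "\<exists>g. smooth g \<and> (\<forall>l. length l = k \<longrightarrow> (\<exists>F\<in>borel_Lp P \<Omega>. borel_weak_deriv \<Omega> l u F \<and>
       (Lp_mass_on \<Omega> P (\<lambda>x. F x - list_deriv l g x)) \<le> ennreal \<epsilon>))"
proof -
  have "\<exists>V d r. open V \<and> r > 0 \<and> cball x (3 * r) \<subseteq> V \<and> supported_sobolev k P (V \<inter> \<Omega>) UNIV u \<and>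
     (\<forall>s. 0 < s \<and> s \<le> 1 \<longrightarrow> (\<exists>\<rho>>0. \<forall>z\<in>V \<inter> \<Omega>. cball (z - s *\<^sub>R d) \<rho> \<subseteq> \<Omega>))" if x: "x \<in> closure \<Omega>" for x
  proof -
    obtain N where N: "open N" "x \<in> N"
      "\<And>l. length l \<le> k \<Longrightarrow> \<exists>v\<in>borel_Lp P (N \<inter> \<Omega>). borel_weak_deriv (N \<inter> \<Omega>) l u v"
      using local_weak_derivs_upto[OF P \<Omega> u top x] by blast
    obtain V d where V: "open V" "x \<in> V" "V \<subseteq> N"
      "\<And>s. 0 < s \<Longrightarrow> s \<le> 1 \<Longrightarrow> \<exists>\<rho>>0. \<forall>z\<in>V \<inter> \<Omega>. cball (z - s *\<^sub>R d) \<rho> \<subseteq> N \<inter> \<Omega>"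
      using \<Omega>(3) x N(1,2) unfolding segment_property_def by meson
    obtain R where R: "R > 0" "cball x R \<subseteq> V" using V(1,2) open_contains_cball by blast
    have sub: "V \<inter> \<Omega> \<subseteq> N \<inter> \<Omega>" using V(3) by blast
    have oV: "open (V \<inter> \<Omega>)" using V(1) \<Omega>(1) by auto
    have bV: "bounded (V \<inter> \<Omega>)" using \<Omega>(2) by (rule bounded_subset) blast
    have luV: "locally_integrable (V \<inter> \<Omega>) u" using u by (rule locally_integrable_mono) blast
    have dV: "\<exists>v\<in>borel_Lp P (V \<inter> \<Omega>). borel_weak_deriv (V \<inter> \<Omega>) l u v" if len: "length l \<le> k" for l
    proof -
      obtain v where v: "v \<in> borel_Lp P (N \<inter> \<Omega>)" "borel_weak_deriv (N \<inter> \<Omega>) l u v" using N(3)[OF len] by blast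
      show ?thesis
        using borel_weak_deriv_mono[OF v(2) sub]
        by (rule bexI[OF _ borel_Lp_mono[OF v(1) sub borel_open[OF oV]]])
    qed
    have "supported_sobolev k P (V \<inter> \<Omega>) UNIV u"
      by (rule weak_derivs_imp_supported_sobolev_self[OF P oV bV luV dV])
    moreover have "\<exists>\<rho>>0. \<forall>z\<in>V \<inter> \<Omega>. cball (z - s *\<^sub>R d) \<rho> \<subseteq> \<Omega>" if "0 < s \<and> s \<le> 1" for s
      using V(4)[of s] that by (meson Int_subset_iff)
    ultimately show ?thesis using V(1) R by (intro exI[of _ V] exI[of _ d] exI[of _ "R / 3"]) auto
  qed
  then obtain V d r where V: "\<And>x. x \<in> closure \<Omega> \<Longrightarrow> open (V x) \<and> r x > 0 \<and> cball x (3 * r x) \<subseteq> V x \<and> supported_sobolev k P (V x \<inter> \<Omega>) UNIV u \<and>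
     (\<forall>s. 0 < s \<and> s \<le> 1 \<longrightarrow> (\<exists>\<rho>>0. \<forall>z\<in>V x \<inter> \<Omega>. cball (z - s *\<^sub>R d x) \<rho> \<subseteq> \<Omega>))" by metis
  have "\<exists>\<eta>. smooth \<eta> \<and> (\<forall>y\<in>ball x (r x). \<eta> y = 1) \<and> (\<forall>y. y \<notin> cball x (3 * r x) \<longrightarrow> \<eta> y = 0)" if "x \<in> closure \<Omega>" for x
    using plateau_cutoff_exists[of "r x" x] V[OF that] by metis
  then obtain \<eta> where \<eta>: "\<And>x. x \<in> closure \<Omega> \<Longrightarrow> smooth (\<eta> x)" "\<And>x y. x \<in> closure \<Omega> \<Longrightarrow> y \<in> ball x (r x) \<Longrightarrow> \<eta> x y = 1"
     "\<And>x y. x \<in> closure \<Omega> \<Longrightarrow> y \<notin> cball x (3 * r x) \<Longrightarrow> \<eta> x y = 0" by metis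
  have "compact (closure \<Omega>)" using \<Omega>(2) by simp
  then obtain J where J: "J \<subseteq> closure \<Omega>" "finite J" "closure \<Omega> \<subseteq> (\<Union>x\<in>J. ball x (r x))"
  proof (rule compactE_image[of "closure \<Omega>" "closure \<Omega>" "\<lambda>x. ball x (r x)"])
    show "closure \<Omega> \<subseteq> (\<Union>x\<in>closure \<Omega>. ball x (r x))" using V by force
  qed auto
  define w where "w x = (1 - (\<Prod>j\<in>J. 1 - \<eta> j x)) * u x" for x
  have "approximable k P \<Omega> w"
    unfolding w_def[abs_def]
    by (rule approximable_partition[OF P \<Omega>(1,2) J(2), where V = V and K = "\<lambda>x. cball x (3 * r x)" and d = d])
      (use J(1) V \<eta> in \<open>auto simp: subset_iff\<close>)
  then obtain g where g: "smooth g" "\<And>l. length l = k \<Longrightarrow> \<exists>F\<in>borel_Lp P \<Omega>. borel_weak_deriv \<Omega> l w F \<and>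
       (Lp_mass_on \<Omega> P (\<lambda>x. F x - list_deriv l g x)) \<le> ennreal \<epsilon>"
    using \<epsilon> unfolding approximable_def by blast
  have wu: "w x = u x" if x: "x \<in> \<Omega>" for x
  proof -
    obtain j where j: "j \<in> J" "x \<in> ball j (r j)" using subsetD[OF J(3) subsetD[OF closure_subset x]] by blast
    then have "1 - \<eta> j x = 0" using \<eta>(2)[of j x] J(1) by auto
    then have "(\<Prod>j\<in>J. 1 - \<eta> j x) = 0" using j(1) J(2) by (intro prod_zero) auto
    then show ?thesis by (simp add: w_def)
  qed
  have "borel_weak_deriv \<Omega> l u F" if "borel_weak_deriv \<Omega> l w F" for l F
    unfolding borel_weak_deriv_def
  proof (intro allI impI)
    fix \<phi> assume t: "test_function \<Omega> \<phi>"
    have "(LINT x|lborel. u x * list_deriv l \<phi> x) = (LINT x|lborel. w x * list_deriv l \<phi> x)"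
    proof (rule Bochner_Integration.integral_cong[OF refl])
      fix x show "u x * list_deriv l \<phi> x = w x * list_deriv l \<phi> x"
        using wu[of x] test_function_outside[OF test_function_list_deriv[OF t], of x l] by (cases "x \<in> \<Omega>") auto
    qed
    then show "(LINT x|lborel. u x * list_deriv l \<phi> x) = (-1) ^ length l * (LINT x|lborel. F x * \<phi> x)"
      using that t unfolding borel_weak_deriv_def by simp
  qed
  then show ?thesis using g by blast
qed

section \<open>Density\<close>

lemma borel_version_self: "h \<in> borel_measurable borel \<Longrightarrow> borel_version \<Omega> h h"
  by (simp add: borel_version_def borel_measurable_imp_lebesgue_on)

lemma borel_version_diff:
  assumes "borel_version \<Omega> u u'" "borel_version \<Omega> v v'"
  shows "borel_version \<Omega> (\<lambda>x. u x - v x) (\<lambda>x. u' x - v' x)"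
  unfolding borel_version_def
proof (intro conjI)
  note [measurable] = borel_versionD(1,2)[OF assms(1)] borel_versionD(1,2)[OF assms(2)]
  show "(\<lambda>x. u' x - v' x) \<in> borel_measurable borel" "(\<lambda>x. u x - v x) \<in> borel_measurable (lebesgue_on \<Omega>)"
    by measurable
  show "AE x in lebesgue_on \<Omega>. u x - v x = u' x - v' x"
    using borel_versionD(3)[OF assms(1)] borel_versionD(3)[OF assms(2)] by eventually_elim simp
qed

lemma borel_Lp_diff:
  assumes P: "P \<ge> 1" and v: "v \<in> borel_Lp P \<Omega>" "w \<in> borel_Lp P \<Omega>" and \<Omega>: "\<Omega> \<in> sets borel"
  shows "(\<lambda>x. v x - w x) \<in> borel_Lp P \<Omega>"
proof -
  have "(\<lambda>x. - w x) \<in> borel_Lp P \<Omega>" using v(2) by (simp add: borel_Lp_def)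
  from borel_Lp_add[OF P v(1) this \<Omega>] show ?thesis by simp
qed

lemma borel_weak_deriv_diff:
  assumes "locally_integrable \<Omega> f" "locally_integrable \<Omega> g" "locally_integrable \<Omega> F" "locally_integrable \<Omega> G"
    and "borel_weak_deriv \<Omega> l f F" "borel_weak_deriv \<Omega> l g G"
  shows "borel_weak_deriv \<Omega> l (\<lambda>x. f x - g x) (\<lambda>x. F x - G x)"
proof -
  have li: "locally_integrable \<Omega> (\<lambda>x. - h x)" if "locally_integrable \<Omega> h" for h
    using that by (simp add: locally_integrable_def set_integrable_def)
  have "borel_weak_deriv \<Omega> l (\<lambda>x. - g x) (\<lambda>x. - G x)"
    using assms(6) by (simp add: borel_weak_deriv_def)
  from borel_weak_deriv_add[OF assms(1) li[OF assms(2)] assms(3) li[OF assms(4)] assms(5) this]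
  show ?thesis by simp
qed

lemma smooth_bounded_on:
  assumes "smooth g" "bounded \<Omega>"
  obtains B where "\<And>x. x \<in> \<Omega> \<Longrightarrow> \<bar>g x\<bar> \<le> B"
proof -
  have "bounded (g ` closure \<Omega>)"
    using assms smooth_continuous[OF assms(1)] by (intro compact_imp_bounded compact_continuous_image) auto
  then obtain B where "\<And>x. x \<in> closure \<Omega> \<Longrightarrow> \<bar>g x\<bar> \<le> B" by (auto simp: bounded_iff)
  then show ?thesis using that closure_subset by blast
qed

lemma smooth_borel_Lp:
  assumes "P \<ge> 1" "open \<Omega>" "bounded \<Omega>" "smooth g"
  shows "g \<in> borel_Lp P \<Omega>"
proof -
  obtain B where B: "\<And>x. x \<in> \<Omega> \<Longrightarrow> \<bar>g x\<bar> \<le> B" using smooth_bounded_on[OF assms(4,3)] by blast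
  show ?thesis by (rule borel_Lp_bounded[OF assms(1,3) _ smooth_borel[OF assms(4)] B]) (use assms(2) in auto)
qed

lemma smooth_locally_integrable:
  assumes "open \<Omega>" "bounded \<Omega>" "smooth g"
  shows "locally_integrable \<Omega> g"
  by (rule borel_Lp_locally_integrable[OF order_refl assms(2) smooth_borel_Lp[OF order_refl assms]]) (use assms(1) in auto)

lemma smooth_borel_weak_deriv: "smooth g \<Longrightarrow> borel_weak_deriv \<Omega> l g (list_deriv l g)"
  unfolding borel_weak_deriv_def using integration_by_parts testD(3) by blast

lemma smooth_is_weak_deriv:
  assumes "open \<Omega>" "bounded \<Omega>" "smooth g"
  shows "is_weak_deriv \<Omega> \<alpha> g (list_deriv (mi_list \<alpha>) g)"
proof -
  note m = borel_version_self[OF smooth_borel[OF assms(3)]]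
    borel_version_self[OF smooth_borel[OF smooth_list_deriv[OF assms(3)]]]
  show ?thesis
    unfolding is_weak_deriv_borel_version[OF assms(1) m]
    by (intro conjI smooth_locally_integrable assms smooth_list_deriv smooth_borel_weak_deriv)
qed

lemma smooth_L1_loc: "open \<Omega> \<Longrightarrow> bounded \<Omega> \<Longrightarrow> smooth g \<Longrightarrow> g \<in> L1_loc \<Omega>"
  using L1_loc_borel_version[OF _ borel_version_self[OF smooth_borel]] smooth_locally_integrable by metis

lemma smooth_Lp_infinity:
  assumes "open \<Omega>" "bounded \<Omega>" "smooth g"
  shows "g \<in> Lp \<infinity> \<Omega>"
proof -
  obtain B where "\<And>x. x \<in> \<Omega> \<Longrightarrow> \<bar>g x\<bar> \<le> B" using smooth_bounded_on[OF assms(3,2)] by blast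
  then have "AE x in lebesgue_on \<Omega>. \<bar>g x\<bar> \<le> B" by (intro AE_I2) (simp add: space_restrict_space)
  then show ?thesis using borel_measurable_imp_lebesgue_on[OF smooth_borel[OF assms(3)]] by (auto simp: Lp_def)
qed

lemma smooth_sobolev_W:
  assumes "open \<Omega>" "bounded \<Omega>" "smooth g"
  shows "g \<in> sobolev_W k \<infinity> \<Omega>"
  unfolding sobolev_W_def
  using smooth_L1_loc[OF assms] smooth_is_weak_deriv[OF assms]
    smooth_Lp_infinity[OF assms(1,2) smooth_list_deriv[OF assms(3)]] by blast

lemma smooth_sobolev_L:
  assumes "open \<Omega>" "bounded \<Omega>" "smooth g" and p: "1 \<le> enn2real p" "p \<noteq> \<infinity>"
  shows "g \<in> sobolev_L k p \<Omega>"
proof -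
  have "list_deriv l g \<in> Lp p \<Omega>" for l
    using Lp_borel_version(1)[OF assms(1) borel_version_self[OF smooth_borel[OF smooth_list_deriv[OF assms(3)]]], of p l]
      smooth_borel_Lp[OF p(1) assms(1,2) smooth_list_deriv[OF assms(3)], of l] p by simp
  then show ?thesis unfolding sobolev_L_def
    using smooth_L1_loc[OF assms(1-3)] smooth_is_weak_deriv[OF assms(1-3)] by blast
qed

text \<open>On test functions the order of the derivatives is immaterial, hence the weak derivatives for multi-indices are weak
  derivatives along all lists.\<close>

lemma sobolev_L_borel_weak_derivs:
  assumes \<Omega>: "open \<Omega>" and p: "1 \<le> enn2real p" "p \<noteq> \<infinity>" and u: "u \<in> sobolev_L k p \<Omega>" "borel_version \<Omega> u u'"
    and l: "length l = k"
  shows "\<exists>v\<in>borel_Lp (enn2real p) \<Omega>. borel_weak_deriv \<Omega> l u' v"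
proof -
  let ?\<alpha> = "\<lambda>i. count (mset l) i"
  have ms: "mset (mi_list ?\<alpha>) = mset l" by (rule mset_mi_list_count)
  have len: "length (mi_list ?\<alpha>) = length l" by (metis ms size_mset)
  then have "mi_order ?\<alpha> = k" using l by (simp add: length_mi_list)
  then obtain v where v: "v \<in> Lp p \<Omega>" "is_weak_deriv \<Omega> ?\<alpha> u v" using u(1) unfolding sobolev_L_def by blast
  have "v \<in> borel_measurable (lebesgue_on \<Omega>)" using v(1) by (simp add: Lp_def)
  then obtain v' where v': "borel_version \<Omega> v v'" using borel_version_exists[OF \<Omega>] by blast
  have "borel_weak_deriv \<Omega> (mi_list ?\<alpha>) u' v'"
    using v(2) unfolding is_weak_deriv_borel_version[OF \<Omega> u(2) v'] by blast
  then have "borel_weak_deriv \<Omega> l u' v'"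
    unfolding borel_weak_deriv_def len by (simp add: list_deriv_mset[OF ms testD(1)])
  moreover have "v' \<in> borel_Lp (enn2real p) \<Omega>"
    using v(1) Lp_borel_version(1)[OF \<Omega> v' p(2)] p(1) by simp
  ultimately show ?thesis by blast
qed

text \<open>Weak derivatives are unique almost everywhere, so the norm of the chosen one can be computed from any other.\<close>

lemma Lp_norm_weak_deriv_le:
  assumes \<Omega>: "open \<Omega>" "bounded \<Omega>" and p: "1 \<le> enn2real p" "p \<noteq> \<infinity>"
    and w: "borel_version \<Omega> w w'" "locally_integrable \<Omega> w'"
    and H: "H \<in> borel_Lp (enn2real p) \<Omega>" "borel_weak_deriv \<Omega> (mi_list \<alpha>) w' H"
    and e: "(\<integral>\<^sup>+x. ennreal (indicator \<Omega> x * \<bar>H x\<bar> powr enn2real p) \<partial>lborel) \<le> ennreal (e powr enn2real p)" "e \<ge> 0"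
  shows "Lp_norm p \<Omega> (weak_deriv \<Omega> \<alpha> w) \<le> e"
proof -
  let ?P = "enn2real p"
  have \<Omega>b [measurable]: "\<Omega> \<in> sets borel" using \<Omega> by simp
  note [measurable] = borel_LpD(1)[OF H(1)]
  have HL: "locally_integrable \<Omega> H" by (rule borel_Lp_locally_integrable[OF p(1) \<Omega>(2) H(1) \<Omega>b])
  have "is_weak_deriv \<Omega> \<alpha> w H"
    unfolding is_weak_deriv_borel_version[OF \<Omega>(1) w(1) borel_version_self[OF borel_LpD(1)[OF H(1)]]]
    using w(2) HL H(2) by blast
  then have d: "is_weak_deriv \<Omega> \<alpha> w (weak_deriv \<Omega> \<alpha> w)" unfolding weak_deriv_def
    by (rule someI[where P = "is_weak_deriv \<Omega> \<alpha> w"])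
  then have "weak_deriv \<Omega> \<alpha> w \<in> L1_loc \<Omega>" by (simp add: is_weak_deriv_def)
  then obtain D where D: "borel_version \<Omega> (weak_deriv \<Omega> \<alpha> w) D"
    using borel_version_exists[OF \<Omega>(1) L1_loc_measurable[OF \<Omega>(1)]] by blast
  have D': "locally_integrable \<Omega> D" "borel_weak_deriv \<Omega> (mi_list \<alpha>) w' D"
    using d unfolding is_weak_deriv_borel_version[OF \<Omega>(1) w(1) D] by auto
  note [measurable] = borel_versionD(1)[OF D]
  have ae: "AE x in lborel. x \<in> \<Omega> \<longrightarrow> D x = H x"
    by (rule borel_weak_deriv_unique[OF \<Omega>(1) D'(1) HL D'(2) H(2)])
  have "(LINT x|lborel. indicator \<Omega> x * \<bar>D x\<bar> powr ?P) = (LINT x|lborel. indicator \<Omega> x * \<bar>H x\<bar> powr ?P)"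
    by (rule integral_cong_AE) (use ae in \<open>auto elim!: eventually_mono simp: indicator_def\<close>)
  also have "\<dots> \<le> e powr ?P"
  proof -
    have "ennreal (LINT x|lborel. indicator \<Omega> x * \<bar>H x\<bar> powr ?P) = Lp_mass_on \<Omega> ?P H"
      by (rule nn_integral_eq_integral[symmetric, OF borel_LpD(2)[OF H(1)]]) auto
    then have "ennreal (LINT x|lborel. indicator \<Omega> x * \<bar>H x\<bar> powr ?P) \<le> ennreal (e powr ?P)" using e(1) by simp
    then show ?thesis by (subst (asm) ennreal_le_iff) auto
  qed
  finally have le: "(LINT x|lborel. indicator \<Omega> x * \<bar>D x\<bar> powr ?P) \<le> e powr ?P" .
  have P0: "?P > 0" using p(1) by simp
  have "Lp_norm p \<Omega> (weak_deriv \<Omega> \<alpha> w) = (LINT x|lborel. indicator \<Omega> x * \<bar>D x\<bar> powr ?P) powr (1 / ?P)"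
    by (rule Lp_borel_version(2)[OF \<Omega>(1) D p(2) P0])
  also have "\<dots> \<le> (e powr ?P) powr (1 / ?P)"
    using le P0 by (intro powr_mono2 Bochner_Integration.integral_nonneg) auto
  also have "\<dots> = e" using P0 e(2) by (simp add: powr_powr)
  finally show ?thesis .
qed

theorem corollary1p2:
  fixes \<Omega> :: "(real^'n) set" and \<delta> :: real and k :: nat and p :: ennreal
  assumes "0 \<le> \<delta>" and "k \<ge> 1" and "1 \<le> p" and "p < \<infinity>"
    and "is_domain \<Omega>" and "bounded \<Omega>" and "gromov_hyperbolic \<delta> \<Omega>" and "C0_boundary \<Omega>"
  shows "dense_wrt_seminorm (sobolev_L_seminorm k p \<Omega>)
           ({g. smooth g} \<inter> sobolev_W k \<infinity> \<Omega>) (sobolev_L k p \<Omega>)"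
proof -
  let ?P = "enn2real p"
  have \<Omega>: "open \<Omega>" "bounded \<Omega>" using assms by (auto simp: is_domain_def)
  have seg: "segment_property \<Omega>" by (rule C0_boundary_segment_property[OF \<Omega>(1) assms(8)])
  have P: "1 \<le> ?P" and pinf: "p \<noteq> \<infinity>"
    using assms(3,4) enn2real_mono[of 1 p] by auto
  show ?thesis unfolding dense_wrt_seminorm_def
  proof (intro conjI ballI allI impI)
    show "{g. smooth g} \<inter> sobolev_W k \<infinity> \<Omega> \<subseteq> sobolev_L k p \<Omega>"
      using smooth_sobolev_L[OF \<Omega> _ P pinf] by blast
    fix u and \<epsilon> :: real assume u: "u \<in> sobolev_L k p \<Omega>" and \<epsilon>: "\<epsilon> > 0"
    have uL: "u \<in> L1_loc \<Omega>" using u by (simp add: sobolev_L_def)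
    obtain u' where u': "borel_version \<Omega> u u'"
      using borel_version_exists[OF \<Omega>(1) L1_loc_measurable[OF \<Omega>(1) uL]] by blast
    have u'L: "locally_integrable \<Omega> u'" using uL L1_loc_borel_version[OF \<Omega>(1) u'] by simp
    let ?A = "{\<alpha> :: 'n \<Rightarrow> nat. mi_order \<alpha> = k}"
    define e where "e = \<epsilon> / (real (card ?A) + 1)"
    have e: "e > 0" using \<epsilon> by (simp add: e_def)
    then have "e powr ?P > 0" by simp
    from smooth_approximation[OF P \<Omega> seg u'L sobolev_L_borel_weak_derivs[OF \<Omega>(1) P pinf u u'] this]
    obtain g where g: "smooth g" "\<And>l. length l = k \<Longrightarrow> \<exists>F\<in>borel_Lp ?P \<Omega>. borel_weak_deriv \<Omega> l u' F \<and>
       (Lp_mass_on \<Omega> ?P (\<lambda>x. F x - list_deriv l g x)) \<le> ennreal (e powr ?P)"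
      by blast
    have small: "Lp_norm p \<Omega> (weak_deriv \<Omega> \<alpha> (\<lambda>x. u x - g x)) \<le> e" if \<alpha>: "mi_order \<alpha> = k" for \<alpha> :: "'n \<Rightarrow> nat"
    proof -
      let ?l = "mi_list \<alpha>"
      have l: "length ?l = k" using \<alpha> by (simp add: length_mi_list)
      obtain F where F: "F \<in> borel_Lp ?P \<Omega>" "borel_weak_deriv \<Omega> ?l u' F"
        "Lp_mass_on \<Omega> ?P (\<lambda>x. F x - list_deriv ?l g x) \<le> ennreal (e powr ?P)"
        using g(2)[OF l] by blast
      have \<Omega>b: "\<Omega> \<in> sets borel" using \<Omega>(1) by simp
      have sD: "smooth (list_deriv ?l g)" by (rule smooth_list_deriv[OF g(1)])
      have gL: "locally_integrable \<Omega> g" by (rule smooth_locally_integrable[OF \<Omega> g(1)])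
      have li: "locally_integrable \<Omega> (\<lambda>x. u' x - g x)"
        using u'L gL unfolding locally_integrable_def by (auto intro: set_integral_diff)
      show ?thesis
      proof (rule Lp_norm_weak_deriv_le[OF \<Omega> P pinf borel_version_diff[OF u' borel_version_self[OF smooth_borel[OF g(1)]]] li _ _ F(3)])
        show "(\<lambda>x. F x - list_deriv ?l g x) \<in> borel_Lp ?P \<Omega>"
          by (rule borel_Lp_diff[OF P F(1) smooth_borel_Lp[OF P \<Omega> sD] \<Omega>b])
        show "borel_weak_deriv \<Omega> ?l (\<lambda>x. u' x - g x) (\<lambda>x. F x - list_deriv ?l g x)"
          by (rule borel_weak_deriv_diff[OF u'L gL borel_Lp_locally_integrable[OF P \<Omega>(2) F(1) \<Omega>b]
                smooth_locally_integrable[OF \<Omega> sD] F(2) smooth_borel_weak_deriv[OF g(1)]])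
      qed (use e in simp)
    qed
    have "sobolev_L_seminorm k p \<Omega> (\<lambda>x. u x - g x) \<le> real (card ?A) * e"
      unfolding sobolev_L_seminorm_def by (rule sum_bounded_above) (use small in simp)
    also have "\<dots> < \<epsilon>" using \<epsilon> by (simp add: e_def field_simps)
    finally show "\<exists>g\<in>{g. smooth g} \<inter> sobolev_W k \<infinity> \<Omega>. sobolev_L_seminorm k p \<Omega> (\<lambda>x. u x - g x) < \<epsilon>"
      using g(1) smooth_sobolev_W[OF \<Omega> g(1)] by blast
  qed
qed

end
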